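(* Let $f\colon Y\to\mathbb P^1$ be an elliptic fibration on a normal $K3$ surface $Y$, let $\nu\colon X\to Y$ be the minimal resolution, and put $g:=f\circ\nu\colon X\to\mathbb P^1$. Let $s\in\mathbb P^1$ and assume that $\operatorname{Supp} f^*(s)\cap\operatorname{Sing}(Y)\neq\emptyset$. Write $$g^*(s)=\sum_{i=1}^m a_iG_i+\sum_{j=1}^n b_jE_j,$$ where $G_1,\dots,G_m$ are the irreducible components of $g^*(s)$ which are not contracted by $\nu$, and $E_1,\dots,E_n$ are the irreducible components of $g^*(s)$ contracted by $\nu$. For each $i=1,\dots,m$ put $\overline{G_i}:=\nu(G_i)$, regarded as an irreducible curve on $Y$ with the reduced structure. Then $$f^*(s)=\sum_{i=1}^m a_i\,\overline{G_i}.$$ In other words, the fiber $f^*(s)$ is obtained from $g^*(s)$ by deleting the components contracted by $\nu$, while preserving the multiplicities of the remaining components.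
   Context: We work over an algebraically closed field of characteristic $0$. A normal $K3$ surface is a normal projective surface $Y$ with at most rational double points as singularities whose minimal resolution is a smooth $K3$ surface. An elliptic fibration on a (possibly singular) projective surface $Y$ is a surjective morphism $f\colon Y\to C$ to a smooth projective curve whose general fiber is a smooth curve of genus one. For $t\in C$, $f^*(t)$ denotes the fiber as a Cartier divisor, and the displayed equalities are equalities of (Weil) divisors. For an effective divisor $D=\sum m_iD_i$ with $m_i>0$, $\operatorname{Supp} D=\bigcup D_i$. *)

theory Defs
  imports "HOL-Analysis.Abstract_Topology" "HOL-Library.Function_Algebras"
    "HOL-Computational_Algebra.Computational_Algebra"
begin

section \<open>Projective space and the Zariski topology\<close>

text \<open>
  Varieties are taken in the classical sense, over the field given by the type variable \<open>'k\<close>.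
  A point of projective space is the set of its homogeneous coordinate vectors. Vectors are
  functions on \<open>nat\<close>, and \<open>pspace n\<close> uses the coordinates \<open>0, \<dots>, n\<close> (the others are 0), so that
  \<open>pspace n \<subseteq> pspace (n + 1)\<close> and varieties in projective spaces of all dimensions live
  in the same type.
\<close>

type_synonym 'k ppoint = "(nat \<Rightarrow> 'k) set"

definition ppoint_of :: "(nat \<Rightarrow> 'k::field) \<Rightarrow> 'k ppoint" where
  "ppoint_of v = {(\<lambda>i. c * v i) | c. c \<noteq> 0}"

definition pspace :: "nat \<Rightarrow> 'k::field ppoint set" where
  "pspace n = {ppoint_of v | v. (\<exists>i. v i \<noteq> 0) \<and> (\<forall>i>n. v i = 0)}"

text \<open>Homogeneous polynomials of degree \<open>d\<close> in \<open>x\<^sub>0, \<dots>, x\<^sub>n\<close>, as functions.\<close>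

definition hom_poly :: "nat \<Rightarrow> nat \<Rightarrow> ((nat \<Rightarrow> 'k::field) \<Rightarrow> 'k) \<Rightarrow> bool" where
  "hom_poly n d F \<longleftrightarrow> (\<exists>A c. finite A \<and> (\<forall>\<alpha>\<in>A. (\<Sum>i\<le>n. \<alpha> i) = d) \<and>
     F = (\<lambda>x. \<Sum>\<alpha>\<in>A. c \<alpha> * (\<Prod>i\<le>n. x i ^ (\<alpha> i :: nat))))"

text \<open>
  The topology on the union of all \<open>pspace n\<close> generated by the sets where a homogeneous
  polynomial does not vanish; it induces the usual Zariski topology on each \<open>pspace n\<close>.
\<close>

definition zariski :: "'k::field ppoint topology" where
  "zariski = topology_generated_by
     {{P \<in> (\<Union>N. pspace N). \<forall>v\<in>P. F v \<noteq> 0} | F. \<exists>n d. hom_poly n d F}"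

definition irreducible_set :: "'a topology \<Rightarrow> 'a set \<Rightarrow> bool" where
  "irreducible_set T Z \<longleftrightarrow> Z \<subseteq> topspace T \<and> Z \<noteq> {} \<and>
     (\<forall>A B. closedin T A \<longrightarrow> closedin T B \<longrightarrow> Z \<subseteq> A \<union> B \<longrightarrow> Z \<subseteq> A \<or> Z \<subseteq> B)"

definition projective_variety :: "'k::field ppoint set \<Rightarrow> bool" where
  "projective_variety X \<longleftrightarrow>
     (\<exists>n. X \<subseteq> pspace n) \<and> closedin zariski X \<and> irreducible_set zariski X"

text \<open>\<open>irreducible_chain X d Z\<close>: \<open>Z 0 \<subset> \<dots> \<subset> Z d\<close> are irreducible closed subsets of \<open>X\<close>.\<close>

definition irreducible_chain :: "'k::field ppoint set \<Rightarrow> nat \<Rightarrow> (nat \<Rightarrow> 'k ppoint set) \<Rightarrow> bool" where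
  "irreducible_chain X d Z \<longleftrightarrow>
     (\<forall>i\<le>d. closedin (subtopology zariski X) (Z i) \<and> irreducible_set zariski (Z i)) \<and>
     (\<forall>i<d. Z i \<subset> Z (Suc i))"

definition has_dim :: "'k::field ppoint set \<Rightarrow> nat \<Rightarrow> bool" where
  "has_dim X d \<longleftrightarrow> (\<exists>Z. irreducible_chain X d Z) \<and> \<not> (\<exists>Z. irreducible_chain X (Suc d) Z)"

definition projective_curve :: "'k::field ppoint set \<Rightarrow> bool" where
  "projective_curve X \<longleftrightarrow> projective_variety X \<and> has_dim X 1"

definition projective_surface :: "'k::field ppoint set \<Rightarrow> bool" where
  "projective_surface X \<longleftrightarrow> projective_variety X \<and> has_dim X 2"

section \<open>Regular functions, morphisms and local rings\<close>

text \<open>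
  \<open>X\<close> is any locally closed set. Functions are total; the values outside \<open>U\<close> are irrelevant.
\<close>

definition regular_fns :: "'k::field ppoint set \<Rightarrow> 'k ppoint set \<Rightarrow> ('k ppoint \<Rightarrow> 'k) set" where
  "regular_fns X U = {h. openin (subtopology zariski X) U \<and>
     (\<forall>P\<in>U. \<exists>V. openin (subtopology zariski X) V \<and> P \<in> V \<and> V \<subseteq> U \<and>
        (\<exists>n d F G. hom_poly n d F \<and> hom_poly n d G \<and>
           (\<forall>Q\<in>V. \<forall>v\<in>Q. G v \<noteq> 0 \<and> h Q = F v / G v)))}"

definition morphism ::
    "('k::field ppoint \<Rightarrow> 'k ppoint) \<Rightarrow> 'k ppoint set \<Rightarrow> 'k ppoint set \<Rightarrow> bool" where
  "morphism \<phi> X Y \<longleftrightarrow> continuous_map (subtopology zariski X) (subtopology zariski Y) \<phi> \<and>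
     (\<forall>V. \<forall>h\<in>regular_fns Y V. h \<circ> \<phi> \<in> regular_fns X (X \<inter> \<phi> -` V))"

definition isomorphism ::
    "('k::field ppoint \<Rightarrow> 'k ppoint) \<Rightarrow> 'k ppoint set \<Rightarrow> 'k ppoint set \<Rightarrow> bool" where
  "isomorphism \<phi> X Y \<longleftrightarrow> morphism \<phi> X Y \<and>
     (\<exists>\<psi>. morphism \<psi> Y X \<and> (\<forall>P\<in>X. \<psi> (\<phi> P) = P) \<and> (\<forall>Q\<in>Y. \<phi> (\<psi> Q) = Q))"

definition birational_morphism ::
    "('k::field ppoint \<Rightarrow> 'k ppoint) \<Rightarrow> 'k ppoint set \<Rightarrow> 'k ppoint set \<Rightarrow> bool" where
  "birational_morphism \<phi> X Y \<longleftrightarrow> morphism \<phi> X Y \<and>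
     (\<exists>U V. openin (subtopology zariski X) U \<and> U \<noteq> {} \<and>
            openin (subtopology zariski Y) V \<and> V \<noteq> {} \<and> isomorphism \<phi> U V)"

text \<open>
  For \<open>Z \<subseteq> X\<close> irreducible and closed, the local ring of \<open>X\<close> along \<open>Z\<close> (at the generic point of
  \<open>Z\<close>) consists of the functions in \<open>germ_fns X Z\<close> modulo \<open>germ_eq X Z\<close>. The case \<open>Z = {P}\<close> is
  the local ring at \<open>P\<close>, the case \<open>Z = X\<close> is the function field of \<open>X\<close>.
\<close>

definition nbhd :: "'k::field ppoint set \<Rightarrow> 'k ppoint set \<Rightarrow> 'k ppoint set \<Rightarrow> bool" where
  "nbhd X Z U \<longleftrightarrow> openin (subtopology zariski X) U \<and> U \<inter> Z \<noteq> {}"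

definition germ_fns :: "'k::field ppoint set \<Rightarrow> 'k ppoint set \<Rightarrow> ('k ppoint \<Rightarrow> 'k) set" where
  "germ_fns X Z = {h. \<exists>U. nbhd X Z U \<and> h \<in> regular_fns X U}"

definition germ_eq ::
    "'k::field ppoint set \<Rightarrow> 'k ppoint set \<Rightarrow> ('k ppoint \<Rightarrow> 'k) \<Rightarrow> ('k ppoint \<Rightarrow> 'k) \<Rightarrow> bool" where
  "germ_eq X Z h h' \<longleftrightarrow> (\<exists>U. nbhd X Z U \<and> (\<forall>Q\<in>U. h Q = h' Q))"

text \<open>The ideal, in the local ring along \<open>Z\<close>, of the functions vanishing on a closed set \<open>F\<close>.\<close>

definition vanishing_germs ::
    "'k::field ppoint set \<Rightarrow> 'k ppoint set \<Rightarrow> 'k ppoint set \<Rightarrow> ('k ppoint \<Rightarrow> 'k) set" where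
  "vanishing_germs X Z F =
     {h. \<exists>U. nbhd X Z U \<and> h \<in> regular_fns X U \<and> (\<forall>Q\<in>U \<inter> F. h Q = 0)}"

definition max_ideal :: "'k::field ppoint set \<Rightarrow> 'k ppoint set \<Rightarrow> ('k ppoint \<Rightarrow> 'k) set" where
  "max_ideal X Z = vanishing_germs X Z Z"

definition max_ideal_pow ::
    "'k::field ppoint set \<Rightarrow> 'k ppoint set \<Rightarrow> nat \<Rightarrow> ('k ppoint \<Rightarrow> 'k) set" where
  "max_ideal_pow X Z N = {h \<in> germ_fns X Z. \<exists>r c g.
     (\<forall>i<r. c i \<in> germ_fns X Z \<and> (\<forall>j<N. g i j \<in> max_ideal X Z)) \<and>
     germ_eq X Z h (\<lambda>Q. \<Sum>i<r::nat. c i Q * (\<Prod>j<N. g i j Q))}"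

definition generates_ideal :: "'k::field ppoint set \<Rightarrow> 'k ppoint set \<Rightarrow>
    nat \<Rightarrow> (nat \<Rightarrow> 'k ppoint \<Rightarrow> 'k) \<Rightarrow> ('k ppoint \<Rightarrow> 'k) set \<Rightarrow> bool" where
  "generates_ideal X Z r x I \<longleftrightarrow> (\<forall>i<r. x i \<in> I) \<and>
     (\<forall>h\<in>I. \<exists>c. (\<forall>i<r. c i \<in> germ_fns X Z) \<and> germ_eq X Z h (\<lambda>Q. \<Sum>i<r. c i Q * x i Q))"

text \<open>
  Smoothness means that the local ring at \<open>P\<close> is regular: its maximal ideal is generated by
  \<open>dim X\<close> elements (\<open>X\<close> is irreducible, so this is the dimension of the local ring).
\<close>

definition smooth_at :: "'k::field ppoint set \<Rightarrow> 'k ppoint \<Rightarrow> bool" where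
  "smooth_at X P \<longleftrightarrow> (\<exists>d x. has_dim X d \<and> generates_ideal X {P} d x (max_ideal X {P}))"

definition Sing :: "'k::field ppoint set \<Rightarrow> 'k ppoint set" where
  "Sing X = {P \<in> X. \<not> smooth_at X P}"

text \<open>All local rings of \<open>X\<close> are integrally closed in the function field.\<close>

definition normal_variety :: "'k::field ppoint set \<Rightarrow> bool" where
  "normal_variety X \<longleftrightarrow> (\<forall>P\<in>X. \<forall>h\<in>germ_fns X X.
     (\<exists>n a. (\<forall>i<n::nat. a i \<in> germ_fns X {P}) \<and>
        germ_eq X X (\<lambda>Q. h Q ^ n + (\<Sum>i<n. a i Q * h Q ^ i)) (\<lambda>_. 0)) \<longrightarrow>
     (\<exists>h'\<in>germ_fns X {P}. germ_eq X X h h'))"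

section \<open>Divisors on surfaces\<close>

text \<open>
  A Weil divisor is a function from irreducible curves to \<open>int\<close>, with value 0 off the prime
  divisors of the surface.
\<close>

type_synonym 'k wdivisor = "'k ppoint set \<Rightarrow> int"

definition prime_divisor :: "'k::field ppoint set \<Rightarrow> 'k ppoint set \<Rightarrow> bool" where
  "prime_divisor X D \<longleftrightarrow> D \<subseteq> X \<and> projective_curve D"

text \<open>\<open>wdiv c D\<close> is the divisor \<open>c D\<close>; divisors are added pointwise.\<close>

definition wdiv :: "int \<Rightarrow> 'k ppoint set \<Rightarrow> 'k wdivisor" where
  "wdiv c D = (\<lambda>D'. if D' = D then c else 0)"

definition components :: "'k wdivisor \<Rightarrow> 'k ppoint set set" where
  "components \<Delta> = {D. \<Delta> D \<noteq> 0}"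

definition Supp :: "'k wdivisor \<Rightarrow> 'k ppoint set" where
  "Supp \<Delta> = \<Union> (components \<Delta>)"

text \<open>
  The valuation along a prime divisor \<open>D\<close> of a normal surface, whose local ring is a discrete
  valuation ring; only meaningful for a nonzero \<open>h\<close> in that local ring.
\<close>

definition ord_along :: "'k::field ppoint set \<Rightarrow> 'k ppoint set \<Rightarrow> ('k ppoint \<Rightarrow> 'k) \<Rightarrow> nat" where
  "ord_along X D h = (GREATEST N. h \<in> max_ideal_pow X D N)"

text \<open>
  An effective Cartier divisor is given by the set of its local equations: pairs \<open>(U, h)\<close> of an
  open set and a regular function on it.
\<close>

type_synonym 'k cartier = "('k ppoint set \<times> ('k ppoint \<Rightarrow> 'k)) set"

text \<open>The reduced point \<open>t\<close> as a Cartier divisor on a smooth curve \<open>C\<close>.\<close>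

definition point_divisor :: "'k::field ppoint set \<Rightarrow> 'k ppoint \<Rightarrow> 'k cartier" where
  "point_divisor C t = {(V, \<pi>). \<pi> \<in> regular_fns C V \<and> (\<forall>Q\<in>V. \<pi> Q = 0 \<longleftrightarrow> Q = t) \<and>
     (t \<in> V \<longrightarrow> generates_ideal C {t} 1 (\<lambda>_. \<pi>) (max_ideal C {t}))}"

definition pullback_cartier ::
    "('k::field ppoint \<Rightarrow> 'k ppoint) \<Rightarrow> 'k ppoint set \<Rightarrow> 'k cartier \<Rightarrow> 'k cartier" where
  "pullback_cartier \<phi> X L = {(X \<inter> \<phi> -` V, h \<circ> \<phi>) | V h. (V, h) \<in> L}"

text \<open>
  The multiplicity of \<open>D\<close> is the order along \<open>D\<close> of any local equation whose domain meets \<open>D\<close>;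
  local equations differ by units, so the choice does not matter.
\<close>

definition weil_divisor :: "'k::field ppoint set \<Rightarrow> 'k cartier \<Rightarrow> 'k wdivisor" where
  "weil_divisor X L = (\<lambda>D. if prime_divisor X D
     then int (ord_along X D (SOME h. \<exists>U. (U, h) \<in> L \<and> U \<inter> D \<noteq> {})) else 0)"

text \<open>The divisor \<open>f\<^sup>*(t)\<close> on a normal surface \<open>X\<close>, for \<open>f\<close> from \<open>X\<close> to a smooth curve \<open>C\<close>.\<close>

definition fiber_divisor :: "('k::field ppoint \<Rightarrow> 'k ppoint) \<Rightarrow>
    'k ppoint set \<Rightarrow> 'k ppoint set \<Rightarrow> 'k ppoint \<Rightarrow> 'k wdivisor" where
  "fiber_divisor f X C t = weil_divisor X (pullback_cartier f X (point_divisor C t))"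

definition contracted :: "('k ppoint \<Rightarrow> 'k ppoint) \<Rightarrow> 'k ppoint set \<Rightarrow> bool" where
  "contracted \<nu> D \<longleftrightarrow> (\<exists>P. \<nu> ` D = {P})"

section \<open>Differential forms\<close>

text \<open>
  Tangent vectors at \<open>P\<close> are the \<open>'k\<close>-derivations of the local ring at \<open>P\<close>, extended by 0
  to functions that are not regular at \<open>P\<close>.
\<close>

definition tangent_space ::
    "'k::field ppoint set \<Rightarrow> 'k ppoint \<Rightarrow> (('k ppoint \<Rightarrow> 'k) \<Rightarrow> 'k) set" where
  "tangent_space X P = {D.
     (\<forall>h. h \<notin> germ_fns X {P} \<longrightarrow> D h = 0) \<and>
     (\<forall>c. D (\<lambda>_. c) = 0) \<and>
     (\<forall>h\<in>germ_fns X {P}. \<forall>h'\<in>germ_fns X {P}.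
        (germ_eq X {P} h h' \<longrightarrow> D h = D h') \<and>
        D (\<lambda>Q. h Q + h' Q) = D h + D h' \<and>
        D (\<lambda>Q. h Q * h' Q) = h P * D h' + h' P * D h)}"

text \<open>
  A regular 1-form on a smooth variety is a family of covectors that is locally of the form
  \<open>\<Sum> u\<^sub>i dv\<^sub>i\<close>, where \<open>dv\<close> at \<open>Q\<close> is the covector \<open>D \<mapsto> D v\<close>; a regular 2-form is
  locally \<open>\<Sum> u\<^sub>i dv\<^sub>i \<and> dw\<^sub>i\<close>. The values of 1-forms off the tangent spaces are normalised to 0,
  so that equality of forms is equality of functions.
\<close>

definition regular_1forms :: "'k::field ppoint set \<Rightarrow>
    ('k ppoint \<Rightarrow> (('k ppoint \<Rightarrow> 'k) \<Rightarrow> 'k) \<Rightarrow> 'k) set" where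
  "regular_1forms X = {\<omega>.
     (\<forall>P D. \<not> (P \<in> X \<and> D \<in> tangent_space X P) \<longrightarrow> \<omega> P D = 0) \<and>
     (\<forall>P\<in>X. \<exists>U r u v. P \<in> U \<and> openin (subtopology zariski X) U \<and>
        (\<forall>i<r::nat. u i \<in> regular_fns X U \<and> v i \<in> regular_fns X U) \<and>
        (\<forall>Q\<in>U. \<forall>D\<in>tangent_space X Q. \<omega> Q D = (\<Sum>i<r. u i Q * D (v i))))}"

definition regular_2form :: "'k::field ppoint set \<Rightarrow>
    ('k ppoint \<Rightarrow> (('k ppoint \<Rightarrow> 'k) \<Rightarrow> 'k) \<Rightarrow> (('k ppoint \<Rightarrow> 'k) \<Rightarrow> 'k) \<Rightarrow> 'k) \<Rightarrow> bool" where
  "regular_2form X \<omega> \<longleftrightarrow>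
     (\<forall>P\<in>X. \<exists>U r u v w. P \<in> U \<and> openin (subtopology zariski X) U \<and>
        (\<forall>i<r::nat. u i \<in> regular_fns X U \<and> v i \<in> regular_fns X U \<and> w i \<in> regular_fns X U) \<and>
        (\<forall>Q\<in>U. \<forall>D\<in>tangent_space X Q. \<forall>D'\<in>tangent_space X Q.
           \<omega> Q D D' = (\<Sum>i<r. u i Q * (D (v i) * D' (w i) - D (w i) * D' (v i)))))"

text \<open>The genus of a smooth projective curve: the dimension of the space of regular 1-forms.\<close>

definition genus :: "'k::field ppoint set \<Rightarrow> nat" where
  "genus C = vector_space.dim
     (\<lambda>(c::'k) (\<omega> :: 'k ppoint \<Rightarrow> (('k ppoint \<Rightarrow> 'k) \<Rightarrow> 'k) \<Rightarrow> 'k). \<lambda>P D. c * \<omega> P D)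
     (regular_1forms C)"

text \<open>A trivialisation of the canonical sheaf of a smooth surface is a nowhere vanishing 2-form.\<close>

definition trivial_canonical :: "'k::field ppoint set \<Rightarrow> bool" where
  "trivial_canonical X \<longleftrightarrow> (\<exists>\<omega>. regular_2form X \<omega> \<and>
     (\<forall>P\<in>X. \<exists>D\<in>tangent_space X P. \<exists>D'\<in>tangent_space X P. \<omega> P D D' \<noteq> 0))"

text \<open>
  Vanishing of the first cohomology of the structure sheaf. First cohomology is the colimit of
  the Cech groups over open covers, with injective transition maps, and finite covers are
  cofinal.
\<close>

definition H1_structure_sheaf_zero :: "'k::field ppoint set \<Rightarrow> bool" where
  "H1_structure_sheaf_zero X \<longleftrightarrow> (\<forall>r U g.
     (\<forall>i<r::nat. openin (subtopology zariski X) (U i)) \<longrightarrow> (\<Union>i<r. U i) = X \<longrightarrow>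
     (\<forall>i<r. \<forall>j<r. g i j \<in> regular_fns X (U i \<inter> U j)) \<longrightarrow>
     (\<forall>i<r. \<forall>j<r. \<forall>l<r. \<forall>Q\<in>U i \<inter> U j \<inter> U l. g i j Q + g j l Q = g i l Q) \<longrightarrow>
     (\<exists>h. (\<forall>i<r. h i \<in> regular_fns X (U i)) \<and>
          (\<forall>i<r. \<forall>j<r. \<forall>Q\<in>U i \<inter> U j. g i j Q = h j Q - h i Q)))"

definition smooth_K3 :: "'k::field ppoint set \<Rightarrow> bool" where
  "smooth_K3 X \<longleftrightarrow> projective_surface X \<and> (\<forall>P\<in>X. smooth_at X P) \<and>
     trivial_canonical X \<and> H1_structure_sheaf_zero X"

section \<open>Rational double points and minimal resolutions\<close>

text \<open>Power series in \<open>x, y, z\<close> are iterated power series.\<close>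

abbreviation ps_x :: "'k::field fps fps fps" where "ps_x \<equiv> fps_X"
abbreviation ps_y :: "'k::field fps fps fps" where "ps_y \<equiv> fps_const fps_X"
abbreviation ps_z :: "'k::field fps fps fps" where "ps_z \<equiv> fps_const (fps_const fps_X)"

definition ps_const :: "'k::field \<Rightarrow> 'k fps fps fps" where
  "ps_const c = fps_const (fps_const (fps_const c))"

text \<open>The normal forms in characteristic 0 of types A (\<open>n \<ge> 1\<close>), D (\<open>n \<ge> 4\<close>), E6, E7, E8.\<close>

definition ADE_equations :: "'k::field fps fps fps set" where
  "ADE_equations =
     {ps_x ^ 2 + ps_y ^ 2 + ps_z ^ (n + 1) | n. n \<ge> 1} \<union>
     {ps_x ^ 2 + ps_y ^ 2 * ps_z + ps_z ^ (n - 1) | n. n \<ge> 4} \<union>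
     {ps_x ^ 2 + ps_y ^ 3 + ps_z ^ 4, ps_x ^ 2 + ps_y ^ 3 + ps_y * ps_z ^ 3,
      ps_x ^ 2 + ps_y ^ 3 + ps_z ^ 5}"

text \<open>
  Elements of the completed local ring at \<open>P\<close>, the inverse limit of the quotients by the powers
  of the maximal ideal: coherent sequences \<open>\<sigma>\<close>, where \<open>\<sigma> N\<close> matters modulo the \<open>N\<close>-th power.
\<close>

definition completion :: "'k::field ppoint set \<Rightarrow> 'k ppoint \<Rightarrow> (nat \<Rightarrow> 'k ppoint \<Rightarrow> 'k) set" where
  "completion X P = {\<sigma>. \<forall>N. \<sigma> N \<in> germ_fns X {P} \<and>
     (\<lambda>Q. \<sigma> (Suc N) Q - \<sigma> N Q) \<in> max_ideal_pow X {P} N}"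

definition completion_eq :: "'k::field ppoint set \<Rightarrow> 'k ppoint \<Rightarrow>
    (nat \<Rightarrow> 'k ppoint \<Rightarrow> 'k) \<Rightarrow> (nat \<Rightarrow> 'k ppoint \<Rightarrow> 'k) \<Rightarrow> bool" where
  "completion_eq X P \<sigma> \<tau> \<longleftrightarrow> (\<forall>N. (\<lambda>Q. \<sigma> N Q - \<tau> N Q) \<in> max_ideal_pow X {P} N)"

text \<open>
  The completed local ring is isomorphic, as a \<open>'k\<close>-algebra, to the power series ring modulo
  \<open>q\<close>: there is a surjective algebra homomorphism whose kernel is the ideal generated by \<open>q\<close>.
\<close>

definition formally_isomorphic ::
    "'k::field ppoint set \<Rightarrow> 'k ppoint \<Rightarrow> 'k fps fps fps \<Rightarrow> bool" where
  "formally_isomorphic X P q \<longleftrightarrow> (\<exists>\<Phi>.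
     (\<forall>A. \<Phi> A \<in> completion X P) \<and>
     (\<forall>c. completion_eq X P (\<Phi> (ps_const c)) (\<lambda>N Q. c)) \<and>
     (\<forall>A B. completion_eq X P (\<Phi> (A + B)) (\<lambda>N Q. \<Phi> A N Q + \<Phi> B N Q)) \<and>
     (\<forall>A B. completion_eq X P (\<Phi> (A * B)) (\<lambda>N Q. \<Phi> A N Q * \<Phi> B N Q)) \<and>
     (\<forall>\<sigma>\<in>completion X P. \<exists>A. completion_eq X P \<sigma> (\<Phi> A)) \<and>
     (\<forall>A. completion_eq X P (\<Phi> A) (\<lambda>N Q. 0) \<longleftrightarrow> q dvd A))"

definition rational_double_point :: "'k::field ppoint set \<Rightarrow> 'k ppoint \<Rightarrow> bool" where
  "rational_double_point X P \<longleftrightarrow> (\<exists>q\<in>ADE_equations. formally_isomorphic X P q)"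

text \<open>Resolutions of a projective surface; all varieties here are projective, so \<open>\<nu>\<close> is proper.\<close>

definition resolution ::
    "('k::field ppoint \<Rightarrow> 'k ppoint) \<Rightarrow> 'k ppoint set \<Rightarrow> 'k ppoint set \<Rightarrow> bool" where
  "resolution \<nu> X Y \<longleftrightarrow> projective_surface X \<and> (\<forall>P\<in>X. smooth_at X P) \<and>
     birational_morphism \<nu> X Y"

definition minimal_resolution ::
    "('k::field ppoint \<Rightarrow> 'k ppoint) \<Rightarrow> 'k ppoint set \<Rightarrow> 'k ppoint set \<Rightarrow> bool" where
  "minimal_resolution \<nu> X Y \<longleftrightarrow> resolution \<nu> X Y \<and>
     (\<forall>X' \<nu>'. resolution \<nu>' X' Y \<longrightarrow>
        (\<exists>\<psi>. morphism \<psi> X' X \<and> (\<forall>P\<in>X'. \<nu> (\<psi> P) = \<nu>' P)))"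

definition normal_K3 :: "'k::field ppoint set \<Rightarrow> bool" where
  "normal_K3 Y \<longleftrightarrow> projective_surface Y \<and> normal_variety Y \<and>
     (\<forall>P\<in>Sing Y. rational_double_point Y P) \<and>
     (\<exists>\<nu> X. minimal_resolution \<nu> X Y \<and> smooth_K3 X)"

section \<open>Elliptic fibrations\<close>

text \<open>
  The scheme-theoretic fibre over \<open>t\<close> is a smooth curve of genus one. The last conjunct says
  that it is reduced: at each of its points, the pull-back of a local parameter at \<open>t\<close>
  generates the ideal of the set-theoretic fibre.
\<close>

definition smooth_genus_one_fiber :: "('k::field ppoint \<Rightarrow> 'k ppoint) \<Rightarrow>
    'k ppoint set \<Rightarrow> 'k ppoint set \<Rightarrow> 'k ppoint \<Rightarrow> bool" where
  "smooth_genus_one_fiber f Y C t \<longleftrightarrow> (let F = Y \<inter> f -` {t} in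
     projective_curve F \<and> (\<forall>P\<in>F. smooth_at F P) \<and> genus F = 1 \<and>
     (\<forall>(V, \<pi>)\<in>point_divisor C t. \<forall>P\<in>F. t \<in> V \<longrightarrow>
        generates_ideal Y {P} 1 (\<lambda>_. \<pi> \<circ> f) (vanishing_germs Y {P} F)))"

definition elliptic_fibration :: "('k::field ppoint \<Rightarrow> 'k ppoint) \<Rightarrow>
    'k ppoint set \<Rightarrow> 'k ppoint set \<Rightarrow> bool" where
  "elliptic_fibration f Y C \<longleftrightarrow>
     projective_surface Y \<and> projective_curve C \<and> (\<forall>t\<in>C. smooth_at C t) \<and>
     morphism f Y C \<and> f ` Y = C \<and>
     (\<exists>U. openin (subtopology zariski C) U \<and> U \<noteq> {} \<and>
        (\<forall>t\<in>U. smooth_genus_one_fiber f Y C t))"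

end

theory Submission
  imports Defs
begin

text \<open>
  The multiplicity of the fibre along a curve \<open>D\<close> on \<open>Y\<close> only depends on the local ring of \<open>Y\<close>
  along \<open>D\<close>, so everything follows once \<open>\<nu>\<close> is invertible over a neighbourhood of some point
  of \<open>D\<close>. By dimension and the basis theorem, only finitely many points of \<open>D\<close> have an infinite
  fibre in \<open>X\<close>. Over a point \<open>P\<close> of \<open>D\<close> with finite fibre choose a linear form \<open>l\<close> that does not
  vanish on the fibre. If one of the rational functions \<open>x\<^sub>i / l\<close> on \<open>Y\<close> were not integral over the
  local ring at \<open>P\<close>, some place over \<open>P\<close> would send it to infinity; but the centre of this place on \<open>X\<close>
  lies in the fibre over \<open>P\<close>, where \<open>l\<close> is nonzero. As \<open>Y\<close> is normal, the \<open>x\<^sub>i / l\<close> are regular at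
  \<open>P\<close> and define the inverse. Places also show that \<open>\<nu>\<close> maps the strict transform of \<open>D\<close> onto \<open>D\<close>;
  they are constructed by hand, as homomorphisms to the ground field defined on enough elements.
\<close>

text \<open>Equality of divisors is tested at every curve \<open>D\<close> on \<open>Y\<close>, not
  only at the images of fibre components: each \<open>D\<close> has a strict transform
  \<open>G\<close> with image \<open>D\<close>, and the two coefficients agree there. Uniqueness of
  \<open>G\<close> makes distinct non-contracted components have distinct images; it comes from the
  bound on chains of irreducible sets. Finiteness of the fibre is needed so that one linear form
  serves all places over \<open>P\<close> at once. The coordinate to divide by varies with the
  centre of the place, whereas the common denominator \<open>l\<close> yields fixed functions on
  \<open>Y\<close> to which normality applies. Such a form exists because the field is infinite.
  Only finitely many ratios of coordinates must receive a value, so places are extended by one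
  element at a time and no maximal extension is taken. Values stay in the ground field because it is
  algebraically closed; hence a centre is an ordinary point with homogeneous coordinates and can be
  compared with \<open>P\<close> directly.\<close>

definition ring_ideal :: "'a::comm_ring_1 set \<Rightarrow> bool" where
  "ring_ideal Z \<longleftrightarrow> 0 \<in> Z \<and> (\<forall>a\<in>Z. \<forall>b\<in>Z. a + b \<in> Z) \<and> (\<forall>a\<in>Z. \<forall>c. c * a \<in> Z)"

definition subring :: "'a::comm_ring_1 set \<Rightarrow> bool" where
  "subring A \<longleftrightarrow> 1 \<in> A \<and> (\<forall>a\<in>A. \<forall>b\<in>A. a - b \<in> A) \<and> (\<forall>a\<in>A. \<forall>b\<in>A. a * b \<in> A)"

definition coeffs_in :: "'a::comm_ring_1 set \<Rightarrow> 'a poly \<Rightarrow> bool" where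
  "coeffs_in A p \<longleftrightarrow> (\<forall>i. coeff p i \<in> A)"

lemma ring_ideal_diff: "ring_ideal Z \<Longrightarrow> a \<in> Z \<Longrightarrow> b \<in> Z \<Longrightarrow> a - b \<in> Z"
  unfolding ring_ideal_def by (metis add_uminus_conv_diff mult_minus1)

lemma ring_ideal_mult2: "ring_ideal Z \<Longrightarrow> a \<in> Z \<Longrightarrow> a * c \<in> Z"
  unfolding ring_ideal_def by (metis mult.commute)

lemma ring_ideal_sum:
  assumes "ring_ideal Z" "\<And>i. i \<in> I \<Longrightarrow> g i \<in> Z" shows "sum g I \<in> Z"
  using assms(2)
  by (induction I rule: infinite_finite_induct) (use assms(1) in \<open>auto simp: ring_ideal_def\<close>)

section \<open>Closure properties of a subring and of the polynomials over it\<close>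

context
  fixes A :: "'a::comm_ring_1 set"
  assumes A: "subring A"
begin

lemma subring_0: "0 \<in> A" and subring_1: "1 \<in> A"
  using A unfolding subring_def by (metis diff_self)+

lemma subring_diff: "a \<in> A \<Longrightarrow> b \<in> A \<Longrightarrow> a - b \<in> A"
  and subring_mult: "a \<in> A \<Longrightarrow> b \<in> A \<Longrightarrow> a * b \<in> A"
  using A unfolding subring_def by auto

lemma subring_uminus: "a \<in> A \<Longrightarrow> - a \<in> A"
  using subring_diff[OF subring_0] by fastforce

lemma subring_add: "a \<in> A \<Longrightarrow> b \<in> A \<Longrightarrow> a + b \<in> A"
  using subring_diff[OF _ subring_uminus] by fastforce

lemma subring_sum: "(\<And>i. i \<in> I \<Longrightarrow> g i \<in> A) \<Longrightarrow> sum g I \<in> A"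
  by (induction I rule: infinite_finite_induct) (auto intro: subring_0 subring_add)

lemma subring_prod: "(\<And>i. i \<in> I \<Longrightarrow> g i \<in> A) \<Longrightarrow> prod g I \<in> A"
  by (induction I rule: infinite_finite_induct) (auto intro: subring_1 subring_mult)

lemma subring_power: "a \<in> A \<Longrightarrow> a ^ n \<in> A"
  by (induction n) (auto intro: subring_1 subring_mult)

lemma coeffs_in_const: "a \<in> A \<Longrightarrow> coeffs_in A [:a:]"
  unfolding coeffs_in_def by (auto simp: coeff_pCons subring_0 split: nat.split)

lemma coeffs_in_pCons: "a \<in> A \<Longrightarrow> coeffs_in A p \<Longrightarrow> coeffs_in A (pCons a p)"
  unfolding coeffs_in_def by (auto simp: coeff_pCons split: nat.split)

lemma coeffs_in_0: "coeffs_in A 0" and coeffs_in_1: "coeffs_in A 1"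
  using coeffs_in_const[OF subring_0] coeffs_in_const[OF subring_1] by (auto simp: one_pCons)

lemma coeffs_in_monom: "a \<in> A \<Longrightarrow> coeffs_in A (monom a n)"
  unfolding coeffs_in_def by (auto simp: subring_0)

lemma coeffs_in_diff: "coeffs_in A p \<Longrightarrow> coeffs_in A q \<Longrightarrow> coeffs_in A (p - q)"
  and coeffs_in_add: "coeffs_in A p \<Longrightarrow> coeffs_in A q \<Longrightarrow> coeffs_in A (p + q)"
  unfolding coeffs_in_def by (auto intro: subring_diff subring_add)

lemma coeffs_in_mult: "coeffs_in A p \<Longrightarrow> coeffs_in A q \<Longrightarrow> coeffs_in A (p * q)"
  unfolding coeffs_in_def coeff_mult by (auto intro: subring_sum subring_mult)

lemma coeffs_in_sum: "(\<And>i. i \<in> I \<Longrightarrow> coeffs_in A (g i)) \<Longrightarrow> coeffs_in A (sum g I)"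
  by (induction I rule: infinite_finite_induct) (auto intro: coeffs_in_0 coeffs_in_add)

end

section \<open>Extending homomorphisms to an algebraically closed field\<close>

text \<open>
  The ideal \<open>Z\<close> stands for equality in a quotient of \<open>'a\<close>: the function field of a variety is
  not a type, but it is a quotient of a subring of the ring of all functions.
\<close>

locale partial_hom =
  fixes Z A :: "'a::comm_ring_1 set" and \<phi> :: "'a \<Rightarrow> 'k::alg_closed_field"
  assumes Z: "ring_ideal Z" and A: "subring A"
    and hom_1: "\<phi> 1 = 1"
    and hom_diff: "\<And>a b. a \<in> A \<Longrightarrow> b \<in> A \<Longrightarrow> \<phi> (a - b) = \<phi> a - \<phi> b"
    and hom_mult: "\<And>a b. a \<in> A \<Longrightarrow> b \<in> A \<Longrightarrow> \<phi> (a * b) = \<phi> a * \<phi> b"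
    and hom_surj: "\<phi> ` A = UNIV"
    and hom_Z: "\<And>a. a \<in> A \<Longrightarrow> a \<in> Z \<Longrightarrow> \<phi> a = 0"
begin

lemma hom_0: "\<phi> 0 = 0"
  using hom_diff[OF subring_1[OF A] subring_1[OF A]] by simp

lemma hom_uminus: "a \<in> A \<Longrightarrow> \<phi> (- a) = - \<phi> a"
  using hom_diff[OF subring_0[OF A]] hom_0 by fastforce

lemma hom_add: "a \<in> A \<Longrightarrow> b \<in> A \<Longrightarrow> \<phi> (a + b) = \<phi> a + \<phi> b"
  using hom_diff[OF _ subring_uminus[OF A]] hom_uminus by fastforce

lemma hom_sum: "(\<And>i. i \<in> I \<Longrightarrow> g i \<in> A) \<Longrightarrow> \<phi> (sum g I) = (\<Sum>i\<in>I. \<phi> (g i))"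
  by (induction I rule: infinite_finite_induct) (auto simp: hom_0 hom_add subring_sum[OF A])

lemma hom_prod: "(\<And>i. i \<in> I \<Longrightarrow> g i \<in> A) \<Longrightarrow> \<phi> (prod g I) = (\<Prod>i\<in>I. \<phi> (g i))"
  by (induction I rule: infinite_finite_induct) (auto simp: hom_1 hom_mult subring_prod[OF A])

lemma hom_power: "a \<in> A \<Longrightarrow> \<phi> (a ^ n) = \<phi> a ^ n"
  by (induction n) (auto simp: hom_1 hom_mult subring_power[OF A])

lemma hom_cong: "a \<in> A \<Longrightarrow> b \<in> A \<Longrightarrow> a - b \<in> Z \<Longrightarrow> \<phi> a = \<phi> b"
  using hom_Z[OF subring_diff[OF A]] hom_diff by fastforce

lemma coeff_map: "coeff (map_poly \<phi> p) i = \<phi> (coeff p i)"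
  by (simp add: coeff_map_poly hom_0)

lemma map_diff: "coeffs_in A p \<Longrightarrow> coeffs_in A q \<Longrightarrow> map_poly \<phi> (p - q) = map_poly \<phi> p - map_poly \<phi> q"
  by (rule poly_eqI) (auto simp: coeff_map coeffs_in_def hom_diff)

lemma map_mult:
  assumes "coeffs_in A p" "coeffs_in A q"
  shows "map_poly \<phi> (p * q) = map_poly \<phi> p * map_poly \<phi> q"
proof (rule poly_eqI)
  fix n
  have "\<phi> (\<Sum>i\<le>n. coeff p i * coeff q (n - i)) = (\<Sum>i\<le>n. \<phi> (coeff p i) * \<phi> (coeff q (n - i)))"
    using assms by (subst hom_sum) (auto simp: coeffs_in_def hom_mult subring_mult[OF A])
  then show "coeff (map_poly \<phi> (p * q)) n = coeff (map_poly \<phi> p * map_poly \<phi> q) n"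
    by (simp add: coeff_map coeff_mult)
qed

lemma map_const: "map_poly \<phi> [:a:] = [:\<phi> a:]"
  by (rule poly_eqI) (auto simp: coeff_map coeff_pCons hom_0 split: nat.split)

text \<open>Surjectivity of \<open>\<phi>\<close> makes up for the lack of division in
  \<open>A\<close>: quotients and inverses are formed over the field and lifted back.\<close>

lemma lift_poly: obtains p where "coeffs_in A p" "map_poly \<phi> p = r"
proof -
  define \<sigma> where "\<sigma> c = (SOME a. a \<in> A \<and> \<phi> a = c)" for c
  have \<sigma>: "\<sigma> c \<in> A \<and> \<phi> (\<sigma> c) = c" for c
    unfolding \<sigma>_def by (rule someI_ex) (metis hom_surj UNIV_I imageE)
  define p where "p = (\<Sum>i\<le>degree r. monom (\<sigma> (coeff r i)) i)"
  have "coeffs_in A p"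
    unfolding p_def by (intro coeffs_in_sum[OF A] coeffs_in_monom[OF A]) (auto simp: \<sigma>)
  moreover have "coeff p i = (if i \<le> degree r then \<sigma> (coeff r i) else 0)" for i
    unfolding p_def by (auto simp: coeff_sum)
  hence "map_poly \<phi> p = r"
    by (intro poly_eqI) (auto simp: coeff_map \<sigma> hom_0 coeff_eq_0)
  ultimately show ?thesis by (rule that)
qed

text \<open>The kernel of evaluation at \<open>x\<close> modulo \<open>Z\<close>. Its image under
  \<open>map_poly \<phi>\<close> is the ideal of conditions on a value for \<open>x\<close>.\<close>

definition relations :: "'a \<Rightarrow> 'a poly set" where
  "relations x = {p. coeffs_in A p \<and> poly p x \<in> Z}"

text \<open>The value on an element of \<open>A[x] + Z\<close> is read off a polynomial
  representative; two representatives differ by a relation, which vanishes at \<open>c\<close>.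
  Including \<open>Z\<close> in the domain lets later arguments work modulo \<open>Z\<close> without
  leaving it.\<close>

lemma extend_to_root:
  assumes root: "\<And>p. p \<in> relations x \<Longrightarrow> poly (map_poly \<phi> p) c = 0"
  obtains A' \<phi>' where "partial_hom Z A' \<phi>'" "A \<subseteq> A'" "Z \<subseteq> A'" "\<And>a. a \<in> A \<Longrightarrow> \<phi>' a = \<phi> a"
    "x \<in> A'" "\<phi>' x = c"
proof -
  define A' where "A' = {b. \<exists>p. coeffs_in A p \<and> b - poly p x \<in> Z}"
  define \<phi>' where "\<phi>' b = poly (map_poly \<phi> (SOME p. coeffs_in A p \<and> b - poly p x \<in> Z)) c" for b
  have val: "\<phi>' b = poly (map_poly \<phi> p) c" if p: "coeffs_in A p" "b - poly p x \<in> Z" for b p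
  proof -
    define q where "q = (SOME p. coeffs_in A p \<and> b - poly p x \<in> Z)"
    have q: "coeffs_in A q \<and> b - poly q x \<in> Z"
      unfolding q_def by (rule someI[of _ p]) (use p in auto)
    have "poly (q - p) x \<in> Z"
      using ring_ideal_diff[OF Z p(2), of "b - poly q x"] q by simp
    hence "q - p \<in> relations x"
      unfolding relations_def using q p coeffs_in_diff[OF A] by auto
    from root[OF this] show ?thesis
      unfolding \<phi>'_def q_def[symmetric] using q p by (simp add: map_diff)
  qed
  have Z0: "0 \<in> Z" using Z by (simp add: ring_ideal_def)
  have const: "a \<in> A' \<and> \<phi>' a = \<phi> a" if "a \<in> A" for a
    using val[of "[:a:]" a] coeffs_in_const[OF A that] Z0
    by (auto simp: A'_def map_const intro!: exI[of _ "[:a:]"])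
  have xA: "coeffs_in A [:0, 1:]" "x - poly [:0, 1:] x \<in> Z"
    using coeffs_in_pCons[OF A subring_0[OF A] coeffs_in_1[OF A]] Z0 by (auto simp: one_pCons)
  have diff: "a - b \<in> A' \<and> \<phi>' (a - b) = \<phi>' a - \<phi>' b" if "a \<in> A'" "b \<in> A'" for a b
  proof -
    from that obtain p q where pq: "coeffs_in A p" "a - poly p x \<in> Z" "coeffs_in A q" "b - poly q x \<in> Z"
      unfolding A'_def by auto
    have "(a - b) - poly (p - q) x \<in> Z"
      using ring_ideal_diff[OF Z pq(2,4)] by (simp add: algebra_simps)
    moreover have "coeffs_in A (p - q)" using coeffs_in_diff[OF A] pq by auto
    ultimately show ?thesis
      using val[of "p - q" "a - b"] val[OF pq(1,2)] val[OF pq(3,4)] map_diff[OF pq(1,3)]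
      by (auto simp: A'_def)
  qed
  have mult: "a * b \<in> A' \<and> \<phi>' (a * b) = \<phi>' a * \<phi>' b" if "a \<in> A'" "b \<in> A'" for a b
  proof -
    from that obtain p q where pq: "coeffs_in A p" "a - poly p x \<in> Z" "coeffs_in A q" "b - poly q x \<in> Z"
      unfolding A'_def by auto
    have "(a - poly p x) * b + poly p x * (b - poly q x) \<in> Z"
      using Z ring_ideal_mult2[OF Z pq(2)] pq(4) by (auto simp: ring_ideal_def)
    hence "a * b - poly (p * q) x \<in> Z" by (simp add: algebra_simps)
    moreover have "coeffs_in A (p * q)" using coeffs_in_mult[OF A] pq by auto
    ultimately show ?thesis
      using val[of "p * q" "a * b"] val[OF pq(1,2)] val[OF pq(3,4)] map_mult[OF pq(1,3)]
      by (auto simp: A'_def)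
  qed
  have "partial_hom Z A' \<phi>'"
  proof
    show "ring_ideal Z" by (rule Z)
    show "subring A'"
      unfolding subring_def using const[OF subring_1[OF A]] diff mult by auto
    show "\<phi>' 1 = 1" using const[OF subring_1[OF A]] hom_1 by auto
    have "UNIV \<subseteq> \<phi>' ` A'"
    proof
      fix c
      obtain a where "a \<in> A" "\<phi> a = c" using hom_surj by (metis UNIV_I imageE)
      then show "c \<in> \<phi>' ` A'" using const[of a] by (metis imageI)
    qed
    then show "\<phi>' ` A' = UNIV" by blast
    show "\<phi>' a = 0" if "a \<in> A'" "a \<in> Z" for a
      using val[OF coeffs_in_0[OF A], of a] that by auto
  qed (use diff mult in auto)
  moreover have "x \<in> A'" "\<phi>' x = c"
    using xA val[OF xA] by (auto simp: A'_def map_poly_pCons hom_0 hom_1 intro!: exI[of _ "[:0,1:]"])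
  moreover have "Z \<subseteq> A'" unfolding A'_def using coeffs_in_0[OF A] by force
  ultimately show ?thesis using that const by blast
qed

lemma relations_ideal:
  shows "p \<in> relations x \<Longrightarrow> q \<in> relations x \<Longrightarrow> p - q \<in> relations x"
    and "p \<in> relations x \<Longrightarrow> coeffs_in A q \<Longrightarrow> q * p \<in> relations x"
  unfolding relations_def using coeffs_in_diff[OF A] coeffs_in_mult[OF A] ring_ideal_diff[OF Z] Z
  by (auto simp: ring_ideal_def)

text \<open>The images of the relations form an ideal in polynomials in one variable over a field.
  If it omits 1, it is zero or generated by a nonconstant polynomial, which has a root.\<close>

lemma common_root:
  assumes no1: "\<And>p. p \<in> relations x \<Longrightarrow> map_poly \<phi> p \<noteq> 1"
  obtains c where "\<And>p. p \<in> relations x \<Longrightarrow> poly (map_poly \<phi> p) c = 0"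
proof (cases "\<exists>p\<in>relations x. map_poly \<phi> p \<noteq> 0")
  case False
  then show ?thesis using that[of 0] by auto
next
  case True
  then obtain g where g: "g \<in> relations x" "map_poly \<phi> g \<noteq> 0"
    and min: "\<And>p. p \<in> relations x \<Longrightarrow> map_poly \<phi> p \<noteq> 0 \<Longrightarrow> degree (map_poly \<phi> g) \<le> degree (map_poly \<phi> p)"
    using ex_has_least_nat[of "\<lambda>p. p \<in> relations x \<and> map_poly \<phi> p \<noteq> 0" _ "\<lambda>p. degree (map_poly \<phi> p)"]
    by blast
  have "degree (map_poly \<phi> g) > 0"
  proof (rule ccontr)
    assume "\<not> degree (map_poly \<phi> g) > 0"
    then obtain e where e: "map_poly \<phi> g = [:e:]" by (metis degree_eq_zeroE neq0_conv)
    with g have "e \<noteq> 0" by auto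
    \<comment> \<open>A nonzero constant image could be rescaled to 1 by a lift of its
      inverse.\<close>
    obtain q where q: "coeffs_in A q" "map_poly \<phi> q = [:inverse e:]" by (rule lift_poly)
    from no1[OF relations_ideal(2)[OF g(1) q(1)]] show False
      using q g e \<open>e \<noteq> 0\<close> by (simp add: map_mult relations_def one_pCons)
  qed
  then obtain c where c: "poly (map_poly \<phi> g) c = 0" using alg_closed_imp_poly_has_root by blast
  have "poly (map_poly \<phi> p) c = 0" if p: "p \<in> relations x" for p
  proof -
    obtain q where q: "coeffs_in A q" "map_poly \<phi> q = map_poly \<phi> p div map_poly \<phi> g" by (rule lift_poly)
    have "p - q * g \<in> relations x" by (intro relations_ideal p g q)
    moreover have *: "map_poly \<phi> (p - q * g) = map_poly \<phi> p mod map_poly \<phi> g"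
      using p q g relations_ideal(2)[OF g(1) q(1)]
      by (simp add: map_diff map_mult relations_def minus_div_mult_eq_mod)
    ultimately have "map_poly \<phi> p mod map_poly \<phi> g = 0"
      using min degree_mod_less[OF g(2)] by (metis not_le)
    then show ?thesis using c by (metis add_0_right div_mult_mod_eq mult_zero_right poly_mult)
  qed
  then show ?thesis by (rule that)
qed

text \<open>If both specialisations were obstructed, the longer obstruction could be shortened by the reversed one.\<close>

lemma obstruction_shorten:
  assumes xy: "x * y - 1 \<in> Z"
    and p: "p \<in> relations x" "map_poly \<phi> p = 1"
    and q: "q \<in> relations y" "map_poly \<phi> q = 1" "degree q \<le> degree p" "0 < degree q"
  obtains p' where "p' \<in> relations x" "map_poly \<phi> p' = 1" "degree p' < degree p"
proof -
  define m n where "m = degree q" and "n = degree p"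
  define w where "w = coeff q 0"
  \<comment> \<open>The reversed polynomial \<open>T^m q(1/T)\<close>: since \<open>y\<close>
    inverts \<open>x\<close> modulo \<open>Z\<close>, it is a relation for \<open>x\<close>.\<close>
  define r where "r = (\<Sum>i\<le>m. monom (coeff q i) (m - i))"
  have cq: "coeff q i \<in> A" and cp: "coeff p i \<in> A" for i
    using p q by (auto simp: relations_def coeffs_in_def)
  have r_in: "coeffs_in A r"
    unfolding r_def by (intro coeffs_in_sum[OF A] coeffs_in_monom[OF A] cq)
  have coeff_r: "coeff r k = (if k \<le> m then coeff q (m - k) else 0)" for k
  proof -
    have "coeff r k = (\<Sum>i\<le>m. if i = m - k \<and> k \<le> m then coeff q i else 0)"
      unfolding r_def coeff_sum by (rule sum.cong) auto
    also have "\<dots> = (if k \<le> m then coeff q (m - k) else 0)" by auto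
    finally show ?thesis .
  qed
  have pw: "x ^ i * y ^ i - 1 \<in> Z" for i
  proof (induction i)
    case 0 then show ?case using Z by (simp add: ring_ideal_def)
  next
    case (Suc i)
    have "x ^ i * y ^ i * (x * y - 1) + (x ^ i * y ^ i - 1) \<in> Z"
      using Suc xy Z unfolding ring_ideal_def by blast
    then show ?case by (simp add: algebra_simps)
  qed
  have "x ^ m * poly q y - poly r x = (\<Sum>i\<le>m. coeff q i * x ^ (m - i) * (x ^ i * y ^ i - 1))"
  proof -
    have "x ^ m * (coeff q i * y ^ i) - coeff q i * x ^ (m - i) = coeff q i * x ^ (m - i) * (x ^ i * y ^ i - 1)"
      if "i \<le> m" for i
    proof -
      have "x ^ m = x ^ (m - i) * x ^ i" using that by (simp flip: power_add)
      then show ?thesis by (simp add: algebra_simps)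
    qed
    then show ?thesis
      unfolding r_def poly_sum poly_monom poly_altdef[of q] m_def[symmetric] sum_distrib_left sum_subtractf[symmetric]
      by (intro sum.cong) auto
  qed
  also have "\<dots> \<in> Z"
    using pw Z by (intro ring_ideal_sum[OF Z]) (auto simp: ring_ideal_def)
  finally have "x ^ m * poly q y - poly r x \<in> Z" .
  moreover have "x ^ m * poly q y \<in> Z" using q Z by (auto simp: relations_def ring_ideal_def)
  ultimately have "poly r x \<in> Z" using ring_ideal_diff[OF Z, of "x ^ m * poly q y"] by fastforce
  hence r: "r \<in> relations x" using r_in by (simp add: relations_def)
  \<comment> \<open>The leading coefficient of \<open>r\<close> is \<open>w\<close>, so
    \<open>b * r\<close> and \<open>[:w:] * p\<close> have the same coefficient at \<open>n\<close>.
    The image of \<open>p\<close> is 1 and \<open>n\<close> is positive, so \<open>\<phi>\<close>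
    kills the leading coefficient of \<open>p\<close> and hence \<open>b\<close>; as
    \<open>\<phi> w = 1\<close>, the image of \<open>p'\<close> is still 1.\<close>
  define b where "b = monom (coeff p n) (n - m)"
  define p' where "p' = [:w:] * p - b * r"
  have p'_rel: "p' \<in> relations x"
    unfolding p'_def b_def w_def
    by (intro relations_ideal p r coeffs_in_const[OF A] coeffs_in_monom[OF A] cp cq)
  have "map_poly \<phi> b = 0"
  proof -
    have "\<phi> (coeff p n) = 0"
      using arg_cong[OF p(2), of "\<lambda>u. coeff u n"] q by (simp add: coeff_map n_def m_def)
    then show ?thesis by (intro poly_eqI) (auto simp: coeff_map b_def hom_0)
  qed
  moreover have "\<phi> w = 1"
    using arg_cong[OF q(2), of "\<lambda>u. coeff u 0"] by (simp add: coeff_map w_def)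
  ultimately have "map_poly \<phi> p' = 1"
    unfolding p'_def
    by (subst map_diff)
      (use p r cp cq in \<open>auto simp: map_mult map_const relations_def b_def w_def hom_1
        coeffs_in_const[OF A] coeffs_in_monom[OF A] simp del: mult_pCons_left
        intro!: coeffs_in_mult[OF A]\<close>)
  moreover have "degree p' < n"
  proof -
    have "coeff p' k = 0" if "k \<ge> n" for k
    proof -
      have bk: "coeff (b * r) k = coeff p n * coeff r (k - (n - m))"
        using that unfolding b_def by (simp add: coeff_monom_mult)
      show ?thesis
      proof (cases "k = n")
        case True
        then show ?thesis unfolding p'_def using bk q(3) by (simp add: coeff_r w_def m_def n_def algebra_simps)
      next
        case False
        then show ?thesis unfolding p'_def using bk that q(3) by (auto simp: coeff_r m_def n_def coeff_eq_0)
      qed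
    qed
    then show ?thesis using q(3,4) by (metis degree_0 leading_coeff_0_iff m_def n_def not_le order.strict_trans2)
  qed
  ultimately show ?thesis using that p'_rel by (simp add: n_def)
qed

text \<open>One step of the extension theorem for places: an element invertible modulo
  \<open>Z\<close> or its inverse receives a finite value. Shortest obstructions on both sides
  contradict \<open>obstruction_shorten\<close>, applied so that the longer one comes first.\<close>

lemma extend_or_inverse:
  assumes xy: "x * y - 1 \<in> Z"
  obtains A' \<phi>' where "partial_hom Z A' \<phi>'" "A \<subseteq> A'" "Z \<subseteq> A'" "\<And>a. a \<in> A \<Longrightarrow> \<phi>' a = \<phi> a"
    "x \<in> A' \<or> y \<in> A'"
proof -
  have "\<not> ((\<exists>p\<in>relations x. map_poly \<phi> p = 1) \<and> (\<exists>q\<in>relations y. map_poly \<phi> q = 1))"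
  proof
    assume *: "(\<exists>p\<in>relations x. map_poly \<phi> p = 1) \<and> (\<exists>q\<in>relations y. map_poly \<phi> q = 1)"
    obtain p where p: "p \<in> relations x" "map_poly \<phi> p = 1"
      and pmin: "\<And>p'. p' \<in> relations x \<Longrightarrow> map_poly \<phi> p' = 1 \<Longrightarrow> degree p \<le> degree p'"
      using * ex_has_least_nat[of "\<lambda>p. p \<in> relations x \<and> map_poly \<phi> p = 1" _ degree] by blast
    obtain q where q: "q \<in> relations y" "map_poly \<phi> q = 1"
      and qmin: "\<And>p'. p' \<in> relations y \<Longrightarrow> map_poly \<phi> p' = 1 \<Longrightarrow> degree q \<le> degree p'"
      using * ex_has_least_nat[of "\<lambda>p. p \<in> relations y \<and> map_poly \<phi> p = 1" _ degree] by blast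
    \<comment> \<open>A constant relation lies in \<open>A\<close> and in \<open>Z\<close>, so
      \<open>\<phi>\<close> sends it to 0 and not to 1.\<close>
    have pos: "degree r > 0" if r: "r \<in> relations z" "map_poly \<phi> r = 1" for r z
    proof (rule ccontr)
      assume "\<not> degree r > 0"
      then obtain e where e: "r = [:e:]" by (metis degree_eq_zeroE neq0_conv)
      have "e \<in> A" "e \<in> Z" using r e by (auto simp: relations_def coeffs_in_def coeff_pCons split: nat.splits)
      hence "\<phi> e = 0" by (rule hom_Z)
      then show False using r e by (simp add: map_const)
    qed
    have yx: "y * x - 1 \<in> Z" using xy by (simp add: mult.commute)
    show False
    proof (cases "degree q \<le> degree p")
      case True
      from obstruction_shorten[OF xy p q True pos[OF q]] pmin show False by (metis not_le)
    next
      case False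
      from obstruction_shorten[OF yx q p _ pos[OF p]] False qmin show False by (metis not_le nat_le_linear)
    qed
  qed
  then consider "\<And>p. p \<in> relations x \<Longrightarrow> map_poly \<phi> p \<noteq> 1" | "\<And>p. p \<in> relations y \<Longrightarrow> map_poly \<phi> p \<noteq> 1"
    by blast
  then show ?thesis
  proof cases
    case 1
    then obtain c where "\<And>p. p \<in> relations x \<Longrightarrow> poly (map_poly \<phi> p) c = 0" using common_root by blast
    from extend_to_root[OF this] show ?thesis using that by metis
  next
    case 2
    then obtain c where "\<And>p. p \<in> relations y \<Longrightarrow> poly (map_poly \<phi> p) c = 0" using common_root by blast
    from extend_to_root[OF this] show ?thesis using that by metis
  qed
qed

end

lemma partial_hom_extend_all:
  fixes Z :: "'a::comm_ring_1 set" and \<phi> :: "'a \<Rightarrow> 'k::alg_closed_field"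
  assumes "finite S" "partial_hom Z A \<phi>" "\<And>i. i \<in> S \<Longrightarrow> x i * y i - 1 \<in> Z"
  shows "\<exists>A' \<phi>'. partial_hom Z A' \<phi>' \<and> A \<subseteq> A' \<and> Z \<subseteq> A' \<and> (\<forall>a\<in>A. \<phi>' a = \<phi> a) \<and>
           (\<forall>i\<in>S. x i \<in> A' \<or> y i \<in> A')"
  using assms(1,3)
proof (induction S rule: finite_induct)
  case empty
  have "ring_ideal Z" using assms(2) by (simp add: partial_hom_def)
  \<comment> \<open>With no pair to settle, one trivial extension by the pair 1, 1 is still made,
    because the conclusion demands \<open>Z \<subseteq> A'\<close>.\<close>
  hence "1 * 1 - 1 \<in> Z" by (simp add: ring_ideal_def)
  from partial_hom.extend_or_inverse[OF assms(2) this] show ?case by (metis empty_iff)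
next
  case (insert i S)
  then obtain A1 \<phi>1 where 1: "partial_hom Z A1 \<phi>1" "A \<subseteq> A1" "Z \<subseteq> A1" "\<forall>a\<in>A. \<phi>1 a = \<phi> a"
    "\<forall>i\<in>S. x i \<in> A1 \<or> y i \<in> A1" by auto
  obtain A2 \<phi>2 where 2: "partial_hom Z A2 \<phi>2" "A1 \<subseteq> A2" "Z \<subseteq> A2" "\<And>a. a \<in> A1 \<Longrightarrow> \<phi>2 a = \<phi>1 a"
    "x i \<in> A2 \<or> y i \<in> A2"
    using partial_hom.extend_or_inverse[OF 1(1) insert.prems[of i, OF insertI1]] by metis
  have "\<forall>j\<in>insert i S. x j \<in> A2 \<or> y j \<in> A2" using 1 2 by auto
  then show ?case using 1 2 by (intro exI[of _ A2] exI[of _ \<phi>2]) auto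
qed

text \<open>
  This is the existence of the centre of a place on projective space, with the \<open>t i\<close> as
  homogeneous coordinates and \<open>u i\<close> as their inverses.
\<close>

lemma partial_hom_extend_ratios:
  fixes Z :: "'a::comm_ring_1 set" and \<phi> :: "'a \<Rightarrow> 'k::alg_closed_field"
  assumes hom: "partial_hom Z A \<phi>" and S: "finite S" "S \<noteq> {}"
    and inv: "\<And>i. i \<in> S \<Longrightarrow> t i * u i - 1 \<in> Z"
  obtains A' \<phi>' j where "partial_hom Z A' \<phi>'" "A \<subseteq> A'" "Z \<subseteq> A'" "\<And>a. a \<in> A \<Longrightarrow> \<phi>' a = \<phi> a"
    "j \<in> S" "\<And>i. i \<in> S \<Longrightarrow> t i * u j \<in> A'"
proof -
  interpret partial_hom Z A \<phi> by (rule hom)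
  have "t i * u j * (t j * u i) - 1 \<in> Z" if "i \<in> S" "j \<in> S" for i j
  proof -
    have "(t i * u i - 1) * (t j * u j) + (t j * u j - 1) \<in> Z"
      using inv[OF that(1)] inv[OF that(2)] Z ring_ideal_mult2[OF Z] by (auto simp: ring_ideal_def)
    then show ?thesis by (simp add: algebra_simps)
  qed
  hence "\<exists>A' \<phi>'. partial_hom Z A' \<phi>' \<and> A \<subseteq> A' \<and> Z \<subseteq> A' \<and> (\<forall>a\<in>A. \<phi>' a = \<phi> a) \<and>
      (\<forall>p\<in>S \<times> S. t (fst p) * u (snd p) \<in> A' \<or> t (snd p) * u (fst p) \<in> A')"
    using S by (intro partial_hom_extend_all hom) auto
  then obtain A' \<phi>' where ext: "partial_hom Z A' \<phi>'" "A \<subseteq> A'" "Z \<subseteq> A'" "\<forall>a\<in>A. \<phi>' a = \<phi> a"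
    and "\<forall>p\<in>S \<times> S. t (fst p) * u (snd p) \<in> A' \<or> t (snd p) * u (fst p) \<in> A'"
    by blast
  then have tot: "\<And>i j. i \<in> S \<Longrightarrow> j \<in> S \<Longrightarrow> t i * u j \<in> A' \<or> t j * u i \<in> A'"
    by force
  have A': "subring A'" using ext by (simp add: partial_hom_def)
  \<comment> \<open>Inserting the factor \<open>t j * u j\<close>, which is 1 modulo
    \<open>Z\<close>, changes the product only by an element of \<open>A'\<close>.\<close>
  have trans: "t i * u k \<in> A'" if "t i * u j \<in> A'" "t j * u k \<in> A'" "j \<in> S" for i j k
  proof -
    have "t i * u k * (t j * u j - 1) \<in> Z" using inv[OF that(3)] Z by (simp add: ring_ideal_def)
    hence "(t i * u j) * (t j * u k) - t i * u k * (t j * u j - 1) \<in> A'"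
      using subring_diff[OF A' subring_mult[OF A' that(1,2)]] ext by blast
    moreover have "(t i * u j) * (t j * u k) - t i * u k * (t j * u j - 1) = t i * u k"
      by (simp add: algebra_simps)
    ultimately show ?thesis by simp
  qed
  \<comment> \<open>Membership of \<open>t i * u j\<close> in \<open>A'\<close> is a total preorder
    on the indices; a largest index \<open>j\<close> is the coordinate to divide by.\<close>
  have "\<exists>j\<in>F. \<forall>i\<in>F. t i * u j \<in> A'" if "finite F" "F \<noteq> {}" "F \<subseteq> S" for F
    using that
  proof (induction F rule: finite_ne_induct)
    case (singleton x) then show ?case using tot by blast
  next
    case (insert x F)
    then obtain j where j: "j \<in> F" "\<forall>i\<in>F. t i * u j \<in> A'" by auto
    show ?case
    proof (cases "t x * u j \<in> A'")
      case True then show ?thesis using j by auto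
    next
      case False
      hence "t j * u x \<in> A'" "t x * u x \<in> A'" using tot insert.prems j by blast+
      then show ?thesis using trans[of _ j x] j insert.prems by blast
    qed
  qed
  from this[OF S(1,2)] show ?thesis using that ext by blast
qed

section \<open>Homogeneous polynomials\<close>

lemma fun_sum_apply: "(sum g I :: 'b \<Rightarrow> 'a::comm_monoid_add) x = (\<Sum>i\<in>I. g i x)"
  by (induction I rule: infinite_finite_induct) auto

lemma fun_prod_apply: "(prod g I :: 'b \<Rightarrow> 'a::comm_monoid_mult) x = (\<Prod>i\<in>I. g i x)"
  by (induction I rule: infinite_finite_induct) auto

lemma fun_power_apply: "((g :: 'b \<Rightarrow> 'a::comm_semiring_1) ^ n) x = g x ^ n"
  by (induction n) auto

lemma hom_poly_0: "hom_poly n d (\<lambda>x. 0)"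
  unfolding hom_poly_def by (intro exI[of _ "{}"]) auto

lemma hom_poly_monomial: "hom_poly n (\<Sum>i\<le>n. \<alpha> i) (\<lambda>x. c * (\<Prod>i\<le>n. x i ^ \<alpha> i))"
  unfolding hom_poly_def by (intro exI[of _ "{\<alpha>}"] exI[of _ "\<lambda>_. c"]) auto

lemma hom_poly_expand:
  assumes "hom_poly n d F"
  obtains A c where "finite A" "\<And>\<alpha>. \<alpha> \<in> A \<Longrightarrow> (\<Sum>i\<le>n. \<alpha> i) = d"
    "\<And>x. F x = (\<Sum>\<alpha>\<in>A. c \<alpha> * (\<Prod>i\<le>n. x i ^ (\<alpha> i :: nat)))"
  using assms unfolding hom_poly_def by auto

lemma hom_poly_add:
  assumes "hom_poly n d F" "hom_poly n d F'"
  shows "hom_poly n d (\<lambda>x. F x + F' x)"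
proof -
  obtain A c where A: "finite A" "\<And>\<alpha>. \<alpha> \<in> A \<Longrightarrow> (\<Sum>i\<le>n. \<alpha> i) = d"
    and F: "F = (\<lambda>x. (\<Sum>\<alpha>\<in>A. c \<alpha> * (\<Prod>i\<le>n. x i ^ (\<alpha> i :: nat))))"
    using assms(1) unfolding hom_poly_def by blast
  obtain A' c' where A': "finite A'" "\<And>\<alpha>. \<alpha> \<in> A' \<Longrightarrow> (\<Sum>i\<le>n. \<alpha> i) = d"
    and F': "F' = (\<lambda>x. (\<Sum>\<alpha>\<in>A'. c' \<alpha> * (\<Prod>i\<le>n. x i ^ (\<alpha> i :: nat))))"
    using assms(2) unfolding hom_poly_def by blast
  define e where "e \<alpha> = (if \<alpha> \<in> A then c \<alpha> else 0) + (if \<alpha> \<in> A' then c' \<alpha> else 0)" for \<alpha>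
  have "(\<lambda>x. F x + F' x) = (\<lambda>x. \<Sum>\<alpha>\<in>A \<union> A'. e \<alpha> * (\<Prod>i\<le>n. x i ^ \<alpha> i))"
  proof
    fix x :: "nat \<Rightarrow> 'a"
    define M where "M \<alpha> = (\<Prod>i\<le>n. x i ^ \<alpha> i)" for \<alpha> :: "nat \<Rightarrow> nat"
    have "F x = (\<Sum>\<alpha>\<in>A \<union> A'. (if \<alpha> \<in> A then c \<alpha> else 0) * M \<alpha>)"
      unfolding F M_def[symmetric] by (rule sum.mono_neutral_cong_left) (use A A' in auto)
    moreover have "F' x = (\<Sum>\<alpha>\<in>A \<union> A'. (if \<alpha> \<in> A' then c' \<alpha> else 0) * M \<alpha>)"
      unfolding F' M_def[symmetric] by (rule sum.mono_neutral_cong_left) (use A A' in auto)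
    ultimately show "F x + F' x = (\<Sum>\<alpha>\<in>A \<union> A'. e \<alpha> * (\<Prod>i\<le>n. x i ^ \<alpha> i))"
      by (simp only: M_def[symmetric] e_def distrib_right sum.distrib)
  qed
  then show ?thesis unfolding hom_poly_def using A A'
    by (intro exI[of _ "A \<union> A'"] exI[of _ e]) auto
qed

lemma hom_poly_sum:
  "(\<And>j. j \<in> J \<Longrightarrow> hom_poly n d (F j)) \<Longrightarrow> hom_poly n d (\<lambda>x. \<Sum>j\<in>J. F j x)"
  by (induction J rule: infinite_finite_induct) (auto intro: hom_poly_0 hom_poly_add)

lemma hom_poly_mono:
  assumes "hom_poly n d F" "n \<le> m"
  shows "hom_poly m d F"
proof -
  obtain A c where A: "\<And>\<alpha>. \<alpha> \<in> A \<Longrightarrow> (\<Sum>i\<le>n. \<alpha> i) = d"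
    "\<And>x. F x = (\<Sum>\<alpha>\<in>A. c \<alpha> * (\<Prod>i\<le>n. x i ^ (\<alpha> i :: nat)))"
    using assms hom_poly_expand by metis
  have "hom_poly m d (\<lambda>x. c \<alpha> * (\<Prod>i\<le>n. x i ^ \<alpha> i))" if "\<alpha> \<in> A" for \<alpha>
  proof -
    define \<beta> where "\<beta> i = (if i \<le> n then \<alpha> i else 0)" for i
    have "(\<Prod>i\<le>n. x i ^ \<alpha> i) = (\<Prod>i\<le>m. x i ^ \<beta> i)" for x :: "nat \<Rightarrow> 'a"
      by (rule prod.mono_neutral_cong_left) (use assms in \<open>auto simp: \<beta>_def\<close>)
    moreover have "(\<Sum>i\<le>m. \<beta> i) = (\<Sum>i\<le>n. \<alpha> i)"
      by (rule sum.mono_neutral_cong_right) (use assms in \<open>auto simp: \<beta>_def\<close>)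
    ultimately show ?thesis using hom_poly_monomial[where n=m and \<alpha>=\<beta> and c="c \<alpha>"] A(1)[OF that] by simp
  qed
  moreover have "F = (\<lambda>x. \<Sum>\<alpha>\<in>A. c \<alpha> * (\<Prod>i\<le>n. x i ^ \<alpha> i))" using A by auto
  ultimately show ?thesis by (simp add: hom_poly_sum)
qed

lemma hom_poly_mult:
  assumes "hom_poly n d F" "hom_poly n d' F'"
  shows "hom_poly n (d + d') (\<lambda>x. F x * F' x)"
proof -
  obtain A c where A: "finite A" "\<And>\<alpha>. \<alpha> \<in> A \<Longrightarrow> (\<Sum>i\<le>n. \<alpha> i) = d"
    and F: "F = (\<lambda>x. (\<Sum>\<alpha>\<in>A. c \<alpha> * (\<Prod>i\<le>n. x i ^ (\<alpha> i :: nat))))"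
    using assms(1) unfolding hom_poly_def by blast
  obtain A' c' where A': "finite A'" "\<And>\<alpha>. \<alpha> \<in> A' \<Longrightarrow> (\<Sum>i\<le>n. \<alpha> i) = d'"
    and F': "F' = (\<lambda>x. (\<Sum>\<alpha>\<in>A'. c' \<alpha> * (\<Prod>i\<le>n. x i ^ (\<alpha> i :: nat))))"
    using assms(2) unfolding hom_poly_def by blast
  have "hom_poly n (d + d') (\<lambda>x. (c \<alpha> * (\<Prod>i\<le>n. x i ^ \<alpha> i)) * (c' \<beta> * (\<Prod>i\<le>n. x i ^ \<beta> i)))"
    if "\<alpha> \<in> A" "\<beta> \<in> A'" for \<alpha> \<beta>
    using hom_poly_monomial[where n=n and \<alpha>="\<lambda>i. \<alpha> i + \<beta> i" and c="c \<alpha> * c' \<beta>"] A(2)[OF that(1)] A'(2)[OF that(2)]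
    by (simp add: sum.distrib power_add prod.distrib mult_ac)
  then have "hom_poly n (d + d') (\<lambda>x. \<Sum>\<alpha>\<in>A. \<Sum>\<beta>\<in>A'. (c \<alpha> * (\<Prod>i\<le>n. x i ^ \<alpha> i)) * (c' \<beta> * (\<Prod>i\<le>n. x i ^ \<beta> i)))"
    by (intro hom_poly_sum)
  then show ?thesis by (simp add: F F' sum_product)
qed

lemma hom_poly_const: "hom_poly n 0 (\<lambda>x. c)"
  using hom_poly_monomial[of n "\<lambda>_. 0" c] by simp

lemma hom_poly_cmult: "hom_poly n d F \<Longrightarrow> hom_poly n d (\<lambda>x. c * F x)"
  using hom_poly_mult[OF hom_poly_const] by fastforce

lemma hom_poly_diff: "hom_poly n d F \<Longrightarrow> hom_poly n d F' \<Longrightarrow> hom_poly n d (\<lambda>x. F x - F' x)"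
  using hom_poly_add[of n d F "\<lambda>x. - 1 * F' x"] hom_poly_cmult[of n d F' "-1"] by simp

lemma hom_poly_var:
  assumes "i \<le> n" shows "hom_poly n 1 (\<lambda>x. x i :: 'a::field)"
proof -
  have e: "(\<Prod>k\<le>n. x k ^ (if k = i then 1 else 0)) = x i" for x :: "nat \<Rightarrow> 'a"
    using assms prod.delta[of "{..n}" i x] by (simp add: if_distrib cong: if_cong)
  have s: "(\<Sum>k\<le>n. if k = i then 1 else 0) = (1::nat)" using assms by simp
  show ?thesis
    using hom_poly_monomial[where n=n and \<alpha>="\<lambda>k. if k = i then 1 else 0" and c="1::'a"]
    by (simp only: e s mult_1_left)
qed

lemma hom_poly_scale:
  assumes "hom_poly n d F"
  shows "F (\<lambda>i. c * x i) = c ^ d * F x"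
proof -
  obtain A e where A: "\<And>\<alpha>. \<alpha> \<in> A \<Longrightarrow> (\<Sum>i\<le>n. \<alpha> i) = d"
    "\<And>x. F x = (\<Sum>\<alpha>\<in>A. e \<alpha> * (\<Prod>i\<le>n. x i ^ (\<alpha> i :: nat)))"
    using assms hom_poly_expand by metis
  show ?thesis unfolding A(2) sum_distrib_left
  proof (rule sum.cong)
    fix \<alpha> assume "\<alpha> \<in> A"
    then show "e \<alpha> * (\<Prod>i\<le>n. (c * x i) ^ \<alpha> i) = c ^ d * (e \<alpha> * (\<Prod>i\<le>n. x i ^ \<alpha> i))"
      by (simp add: power_mult_distrib prod.distrib power_sum[symmetric] A(1) mult_ac)
  qed simp
qed

text \<open>Substituting functions \<open>t i\<close> for the variables becomes an expression in the
  ring of functions, to which subrings and homomorphisms of that ring apply.\<close>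

lemma hom_poly_compose_sum:
  assumes "hom_poly n d F"
  obtains A c where "(\<lambda>S. F (\<lambda>i. t i S)) = (\<Sum>\<alpha>\<in>A. (\<lambda>_. c \<alpha>) * (\<Prod>i\<le>n. t i ^ (\<alpha> i :: nat)))"
    "\<And>x. F x = (\<Sum>\<alpha>\<in>A. c \<alpha> * (\<Prod>i\<le>n. x i ^ (\<alpha> i :: nat)))"
proof -
  obtain A c where A: "\<And>x. F x = (\<Sum>\<alpha>\<in>A. c \<alpha> * (\<Prod>i\<le>n. x i ^ (\<alpha> i :: nat)))"
    using assms hom_poly_expand by metis
  then have "(\<lambda>S. F (\<lambda>i. t i S)) = (\<Sum>\<alpha>\<in>A. (\<lambda>_. c \<alpha>) * (\<Prod>i\<le>n. t i ^ (\<alpha> i :: nat)))"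
    by (auto simp: fun_eq_iff fun_sum_apply fun_prod_apply fun_power_apply)
  then show ?thesis using A that by blast
qed

lemma hom_poly_in_subring:
  assumes "hom_poly n d F" "subring A" "\<And>c. (\<lambda>_. c) \<in> A" "\<And>i. i \<le> n \<Longrightarrow> t i \<in> A"
  shows "(\<lambda>S. F (\<lambda>i. t i S)) \<in> A"
  using assms
  by (auto elim!: hom_poly_compose_sum[of n d F t] intro!: subring_sum subring_mult subring_prod subring_power)

section \<open>The Zariski topology\<close>

abbreviation pspaces :: "'k::field ppoint set" where "pspaces \<equiv> (\<Union>N. pspace N)"

text \<open>One chosen representative replaces the quantification over all coordinate vectors of a
  point. Vanishing of forms and ratios of forms of equal degree do not depend on the choice.\<close>

definition coords :: "'k ppoint \<Rightarrow> nat \<Rightarrow> 'k" where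
  "coords P = (SOME v. v \<in> P)"

lemma
  assumes "P \<in> pspaces"
  shows coords_in: "coords P \<in> P" and ppoint_of_coords: "ppoint_of (coords P) = P"
    and coords_nz: "\<exists>i. coords P i \<noteq> 0"
proof -
  obtain v where v: "P = ppoint_of v" "\<exists>i. v i \<noteq> 0" using assms by (auto simp: pspace_def)
  have "v \<in> P" unfolding v ppoint_of_def by (auto intro!: exI[of _ 1])
  then show 1: "coords P \<in> P" unfolding coords_def using someI[of "\<lambda>v. v \<in> P"] by blast
  then obtain c where c: "c \<noteq> 0" "coords P = (\<lambda>i. c * v i)" unfolding v ppoint_of_def by auto
  then show "\<exists>i. coords P i \<noteq> 0" using v by auto
  show "ppoint_of (coords P) = P"
  proof (intro set_eqI iffI)
    fix w assume "w \<in> ppoint_of (coords P)"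
    then obtain e where "e \<noteq> 0" "w = (\<lambda>i. (e * c) * v i)" unfolding ppoint_of_def c by (auto simp: mult.assoc)
    moreover have "e * c \<noteq> 0" using c \<open>e \<noteq> 0\<close> by simp
    ultimately show "w \<in> P" unfolding v ppoint_of_def by blast
  next
    fix w assume "w \<in> P"
    then obtain e where "e \<noteq> 0" "w = (\<lambda>i. e * v i)" unfolding ppoint_of_def v by auto
    then have "w = (\<lambda>i. (e / c) * coords P i)" "e / c \<noteq> 0" using c by (auto simp: fun_eq_iff)
    then show "w \<in> ppoint_of (coords P)" unfolding ppoint_of_def by blast
  qed
qed

lemma coords_scale: "P \<in> pspaces \<Longrightarrow> v \<in> P \<Longrightarrow> \<exists>c. c \<noteq> 0 \<and> v = (\<lambda>i. c * coords P i)"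
  using ppoint_of_coords unfolding ppoint_of_def by blast

lemma coords_ppoint_of:
  assumes "v i \<noteq> 0" "\<And>k. k > n \<Longrightarrow> v k = 0"
  shows "ppoint_of v \<in> pspace n" "\<exists>c. c \<noteq> 0 \<and> v = (\<lambda>i. c * coords (ppoint_of v) i)"
proof -
  show 1: "ppoint_of v \<in> pspace n" unfolding pspace_def using assms by auto
  have "v \<in> ppoint_of v" unfolding ppoint_of_def by (auto intro!: exI[of _ 1])
  then show "\<exists>c. c \<noteq> 0 \<and> v = (\<lambda>i. c * coords (ppoint_of v) i)" using coords_scale 1 by blast
qed

lemma pspace_coords: "P \<in> pspace n \<Longrightarrow> i > n \<Longrightarrow> coords P i = 0"
proof -
  assume P: "P \<in> pspace n" and i: "i > n"
  then obtain v where v: "P = ppoint_of v" "\<forall>i>n. v i = 0" by (auto simp: pspace_def)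
  moreover have "coords P \<in> P" using P coords_in by blast
  ultimately show ?thesis using i by (auto simp: ppoint_of_def)
qed

lemma ppoint_eqI:
  assumes "P \<in> pspaces" "Q \<in> pspaces" "c \<noteq> 0" "\<And>i. coords P i = c * coords Q i"
  shows "P = Q"
proof -
  have "ppoint_of (coords P) \<subseteq> ppoint_of (coords Q)"
  proof
    fix v assume "v \<in> ppoint_of (coords P)"
    then obtain e where "e \<noteq> 0" "v = (\<lambda>i. e * coords P i)" unfolding ppoint_of_def by blast
    then have "v = (\<lambda>i. (e * c) * coords Q i)" "e * c \<noteq> 0" using assms by (auto simp: fun_eq_iff)
    then show "v \<in> ppoint_of (coords Q)" unfolding ppoint_of_def by blast
  qed
  hence "ppoint_of (coords P) \<subseteq> Q" using ppoint_of_coords[OF assms(2)] by simp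
  moreover have "Q \<subseteq> ppoint_of (coords P)"
  proof
    fix v assume "v \<in> Q"
    then obtain e where "e \<noteq> 0" "v = (\<lambda>i. e * coords Q i)" using coords_scale assms(2) by blast
    then have "v = (\<lambda>i. (e / c) * coords P i)" "e / c \<noteq> 0" using assms by (auto simp: fun_eq_iff)
    then show "v \<in> ppoint_of (coords P)" unfolding ppoint_of_def by blast
  qed
  ultimately show ?thesis using ppoint_of_coords[OF assms(1)] by auto
qed

lemma hom_poly_nz_iff:
  assumes "hom_poly n d F" "P \<in> pspaces" "v \<in> P"
  shows "F v \<noteq> 0 \<longleftrightarrow> F (coords P) \<noteq> 0"
  using coords_scale[OF assms(2,3)] hom_poly_scale[OF assms(1)] by auto

lemma hom_poly_ratio:
  assumes "hom_poly n d F" "hom_poly n d G" "P \<in> pspaces" "v \<in> P"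
  shows "F v / G v = F (coords P) / G (coords P)"
  using coords_scale[OF assms(3,4)] hom_poly_scale[OF assms(1)] hom_poly_scale[OF assms(2)] by auto

definition basic_open :: "((nat \<Rightarrow> 'k::field) \<Rightarrow> 'k) \<Rightarrow> 'k ppoint set" where
  "basic_open F = {P \<in> pspaces. F (coords P) \<noteq> 0}"

lemma basic_open_eq: "hom_poly n d F \<Longrightarrow> {P \<in> pspaces. \<forall>v\<in>P. F v \<noteq> 0} = basic_open F"
  unfolding basic_open_def using hom_poly_nz_iff coords_in by blast

abbreviation open_in :: "'k::field ppoint set \<Rightarrow> 'k ppoint set \<Rightarrow> bool" where
  "open_in X U \<equiv> openin (subtopology zariski X) U"

lemma topspace_zariski: "topspace zariski = pspaces"
proof -
  let ?S = "{{P \<in> pspaces. \<forall>v\<in>P. F v \<noteq> 0} | F :: (nat \<Rightarrow> 'a) \<Rightarrow> 'a. \<exists>n d. hom_poly n d F}"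
  have 1: "hom_poly 0 0 (\<lambda>_::nat \<Rightarrow> 'a. 1)" by (rule hom_poly_const)
  have "pspaces = {P \<in> pspaces. \<forall>v\<in>P. (\<lambda>_::nat \<Rightarrow> 'a. 1::'a) v \<noteq> 0}" by auto
  with 1 have "pspaces \<in> ?S"
    by (intro CollectI exI[of _ "\<lambda>_::nat \<Rightarrow> 'a. 1::'a"] conjI exI)
  then have "pspaces \<subseteq> \<Union>?S" by (rule Union_upper)
  moreover have "\<Union>?S \<subseteq> pspaces" by blast
  ultimately have "\<Union>?S = pspaces" by (rule equalityI[rotated])
  then show ?thesis unfolding zariski_def topology_generated_by_topspace .
qed

lemma openin_basic:
  assumes "hom_poly n d F" shows "openin zariski (basic_open F)"
  unfolding zariski_def basic_open_eq[OF assms, symmetric]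
  by (rule topology_generated_by_Basis) (use assms in blast)

text \<open>The generating sets form a base: the nonvanishing loci of \<open>F\<close> and
  \<open>F'\<close> intersect in that of their product.\<close>

lemma openin_zariski_basic:
  assumes "openin zariski U" "P \<in> U"
  obtains n d F where "hom_poly n d F" "P \<in> basic_open F" "basic_open F \<subseteq> U"
proof -
  have "generate_topology_on {{P \<in> pspaces. \<forall>v\<in>P. F v \<noteq> 0} | F. \<exists>n d. hom_poly n d F} U"
    using assms(1) unfolding zariski_def by (rule openin_topology_generated_by)
  then have "\<forall>P\<in>U. \<exists>n d F. hom_poly n d F \<and> P \<in> basic_open F \<and> basic_open F \<subseteq> U"
  proof induction
    case (Int a b)
    show ?case
    proof
      fix P assume "P \<in> a \<inter> b"
      then obtain n d F n' d' F' where F: "hom_poly n d F" "P \<in> basic_open F" "basic_open F \<subseteq> a"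
        "hom_poly n' d' F'" "P \<in> basic_open F'" "basic_open F' \<subseteq> b" using Int by blast
      have "hom_poly (max n n') (d + d') (\<lambda>x. F x * F' x)"
        by (intro hom_poly_mult hom_poly_mono[OF F(1)] hom_poly_mono[OF F(4)]) auto
      moreover have "basic_open (\<lambda>x. F x * F' x) = basic_open F \<inter> basic_open F'"
        unfolding basic_open_def by auto
      ultimately show "\<exists>n d F. hom_poly n d F \<and> P \<in> basic_open F \<and> basic_open F \<subseteq> a \<inter> b"
        using F by blast
    qed
  next
    case (UN K) then show ?case by blast
  next
    case (Basis s) then show ?case using basic_open_eq by fastforce
  qed auto
  then show ?thesis using assms(2) that by blast
qed

lemma closedin_zariski_sep:
  assumes "closedin zariski C" "P \<in> pspaces" "P \<notin> C"
  obtains n d F where "hom_poly n d F" "F (coords P) \<noteq> 0" "\<And>Q. Q \<in> C \<Longrightarrow> F (coords Q) = 0"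
proof -
  have "openin zariski (pspaces - C)" "P \<in> pspaces - C"
    using assms by (auto simp: closedin_def topspace_zariski)
  then obtain n d F where F: "hom_poly n d F" "P \<in> basic_open F" "basic_open F \<subseteq> pspaces - C"
    by (rule openin_zariski_basic)
  have "C \<subseteq> pspaces" using assms closedin_subset topspace_zariski by blast
  then have "F (coords Q) = 0" if "Q \<in> C" for Q using F(3) that unfolding basic_open_def by blast
  with F show ?thesis using that by (auto simp: basic_open_def)
qed

lemma openin_sub_zariski_basic:
  assumes "open_in X U" "P \<in> U"
  obtains n d F where "hom_poly n d F" "F (coords P) \<noteq> 0" "X \<inter> basic_open F \<subseteq> U"
proof -
  obtain T where T: "openin zariski T" "U = T \<inter> X" using assms by (auto simp: openin_subtopology)
  have P: "P \<in> T" using T assms(2) by simp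
  obtain n d F where F: "hom_poly n d F" "P \<in> basic_open F" "basic_open F \<subseteq> T"
    by (rule openin_zariski_basic[OF T(1) P])
  from F(2) have "F (coords P) \<noteq> 0" by (simp add: basic_open_def)
  moreover from F(3) T(2) have "X \<inter> basic_open F \<subseteq> U" by auto
  ultimately show ?thesis by (rule that[OF F(1)])
qed

lemma openin_sub_basic: "hom_poly n d F \<Longrightarrow> open_in X (X \<inter> basic_open F)"
  using openin_basic by (auto simp: openin_subtopology)

lemma openin_sub_zariski_subset:
  assumes "open_in X U" shows "U \<subseteq> X" "U \<subseteq> pspaces"
  using openin_subset[OF assms] by (auto simp: topspace_zariski)

lemma openin_sub_zariskiI:
  assumes "\<And>P. P \<in> U \<Longrightarrow> \<exists>V. open_in X V \<and> P \<in> V \<and> V \<subseteq> U"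
  shows "open_in X U"
  using assms by (subst openin_subopen) blast

lemma closedin_point:
  assumes "P \<in> pspaces" shows "closedin zariski {P}"
proof -
  have "openin zariski (pspaces - {P})"
  proof (subst openin_subopen, intro ballI)
    fix Q assume Q: "Q \<in> pspaces - {P}"
    \<comment> \<open>If all 2 by 2 minors vanish, the coordinate vectors are proportional and the
      points equal. A nonzero minor, with the coordinates of \<open>P\<close> held fixed, is a
      linear form that vanishes at \<open>P\<close> and not at \<open>Q\<close>.\<close>
    have "\<exists>i j. coords P i * coords Q j \<noteq> coords P j * coords Q i"
    proof (rule ccontr)
      assume *: "\<not> ?thesis"
      obtain j where j: "coords P j \<noteq> 0" using coords_nz assms by blast
      obtain i where i: "coords Q i \<noteq> 0" using coords_nz Q by blast
      have "coords Q j \<noteq> 0" using * i j by (metis mult_eq_0_iff)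
      then have pr: "coords Q k = coords Q j / coords P j * coords P k" for k
        using * j by (simp add: field_simps)
      have "coords Q j / coords P j \<noteq> 0" using j \<open>coords Q j \<noteq> 0\<close> by simp
      with Q assms have "Q = P" using ppoint_eqI[of Q P, OF _ _ _ pr] by blast
      then show False using Q by blast
    qed
    then obtain i j where ij: "coords P i * coords Q j \<noteq> coords P j * coords Q i" by blast
    define F where "F x = coords P i * x j - coords P j * x i" for x
    have F: "hom_poly (max i j) 1 F"
      unfolding F_def by (intro hom_poly_diff hom_poly_cmult hom_poly_var) auto
    have "Q \<in> basic_open F" "P \<notin> basic_open F" using ij Q by (auto simp: basic_open_def F_def)
    then have "Q \<in> basic_open F \<and> basic_open F \<subseteq> pspaces - {P}" by (auto simp: basic_open_def)
    then show "\<exists>T. openin zariski T \<and> Q \<in> T \<and> T \<subseteq> pspaces - {P}"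
      using openin_basic[OF F] by blast
  qed
  then show ?thesis using assms by (simp add: closedin_def topspace_zariski)
qed

section \<open>Irreducible sets\<close>

lemma irreducible_open_inter:
  assumes "irreducible_set T Z" "openin (subtopology T Z) U" "openin (subtopology T Z) V" "U \<noteq> {}" "V \<noteq> {}"
  shows "U \<inter> V \<noteq> {}"
proof
  assume e: "U \<inter> V = {}"
  obtain U' V' where UV: "openin T U'" "U = U' \<inter> Z" "openin T V'" "V = V' \<inter> Z"
    using assms by (auto simp: openin_subtopology)
  have "Z \<subseteq> topspace T" using assms by (auto simp: irreducible_set_def)
  then have "Z \<subseteq> (topspace T - U') \<union> (topspace T - V')" using e UV by auto
  then have "Z \<subseteq> topspace T - U' \<or> Z \<subseteq> topspace T - V'"
    using assms(1) UV by (meson irreducible_set_def closedin_diff closedin_topspace)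
  then show False using UV assms by auto
qed

lemma irreducible_closure: "irreducible_set T Z \<Longrightarrow> irreducible_set T (T closure_of Z)"
  unfolding irreducible_set_def
  by (metis closure_of_minimal closure_of_subset closure_of_subset_topspace subset_empty subset_trans)

lemma irreducible_image:
  assumes "irreducible_set T Z" "continuous_map (subtopology T Z) T' \<phi>"
  shows "irreducible_set T' (\<phi> ` Z)"
  unfolding irreducible_set_def
proof (intro conjI allI impI)
  have Z: "Z \<subseteq> topspace T" "Z \<noteq> {}" using assms by (auto simp: irreducible_set_def)
  have top: "topspace (subtopology T Z) = Z" using Z by auto
  show "\<phi> ` Z \<subseteq> topspace T'" using continuous_map_image_subset_topspace[OF assms(2)] top by simp
  show "\<phi> ` Z \<noteq> {}" using Z by auto
  fix A B assume AB: "closedin T' A" "closedin T' B" "\<phi> ` Z \<subseteq> A \<union> B"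
  have "closedin (subtopology T Z) {x \<in> Z. \<phi> x \<in> A}" "closedin (subtopology T Z) {x \<in> Z. \<phi> x \<in> B}"
    using closedin_continuous_map_preimage[OF assms(2) AB(1)]
      closedin_continuous_map_preimage[OF assms(2) AB(2)] unfolding top by blast+
  then obtain A' B' where A': "closedin T A'" "{x \<in> Z. \<phi> x \<in> A} = A' \<inter> Z"
    and B': "closedin T B'" "{x \<in> Z. \<phi> x \<in> B} = B' \<inter> Z" by (auto simp: closedin_subtopology)
  have "Z \<subseteq> A' \<union> B'" using AB A' B' by blast
  then have "Z \<subseteq> A' \<or> Z \<subseteq> B'" using assms(1) A' B' by (auto simp: irreducible_set_def)
  then show "\<phi> ` Z \<subseteq> A \<or> \<phi> ` Z \<subseteq> B" using A' B' by blast
qed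

lemma irreducible_open:
  assumes "irreducible_set T Z" "openin (subtopology T Z) U" "U \<noteq> {}"
  shows "irreducible_set T U" "Z \<subseteq> T closure_of U"
proof -
  obtain V where V: "openin T V" "U = V \<inter> Z" using assms by (auto simp: openin_subtopology)
  have dense: "Z \<subseteq> A" if "closedin T A" "U \<subseteq> A" for A
  proof -
    have "Z \<subseteq> topspace T" using assms by (auto simp: irreducible_set_def)
    then have "Z \<subseteq> A \<union> (topspace T - V)" using V that by auto
    then have "Z \<subseteq> A \<or> Z \<subseteq> topspace T - V" using assms(1) V that
      by (meson irreducible_set_def closedin_diff closedin_topspace)
    then show ?thesis using V assms by auto
  qed
  show "Z \<subseteq> T closure_of U"
    using dense[of "T closure_of U"] assms V closure_of_subset[of U T]
    by (auto simp: irreducible_set_def)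
  show "irreducible_set T U" unfolding irreducible_set_def
  proof (intro conjI allI impI)
    show "U \<subseteq> topspace T" using assms V by (auto simp: irreducible_set_def)
    show "U \<noteq> {}" by fact
    fix A B assume AB: "closedin T A" "closedin T B" "U \<subseteq> A \<union> B"
    then have "Z \<subseteq> A \<union> B" using dense[of "A \<union> B"] by auto
    then have "Z \<subseteq> A \<or> Z \<subseteq> B" using assms(1) AB by (auto simp: irreducible_set_def)
    then show "U \<subseteq> A \<or> U \<subseteq> B" using V by auto
  qed
qed

lemma irreducible_point: "P \<in> pspaces \<Longrightarrow> irreducible_set zariski {P}"
  unfolding irreducible_set_def by (auto simp: topspace_zariski)

lemma finite_irreducible_point:
  assumes "irreducible_set zariski Z" "finite Z"
  obtains P where "Z = {P}"
proof -
  have "finite W \<Longrightarrow> W \<subseteq> Z \<Longrightarrow> closedin zariski W" for W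
  proof (induction W rule: finite_induct)
    case (insert x W)
    have "x \<in> pspaces" using assms insert.prems unfolding irreducible_set_def topspace_zariski by blast
    then have "closedin zariski {x}" by (rule closedin_point)
    then show ?case using insert closedin_Un[of zariski "{x}" W] by auto
  qed auto
  then have cl: "W \<subseteq> Z \<Longrightarrow> closedin zariski W" for W using assms finite_subset by blast
  obtain P where P: "P \<in> Z" using assms by (auto simp: irreducible_set_def)
  have "Z \<subseteq> {P} \<union> (Z - {P})" by auto
  moreover have "closedin zariski {P}" "closedin zariski (Z - {P})" using cl P by auto
  ultimately have "Z \<subseteq> {P} \<or> Z \<subseteq> Z - {P}" using assms(1) unfolding irreducible_set_def by blast
  then show ?thesis using P that by blast
qed

section \<open>Regular functions and morphisms\<close>

definition ratio_on ::
    "'k::field ppoint set \<Rightarrow> ('k ppoint \<Rightarrow> 'k) \<Rightarrow> ((nat \<Rightarrow> 'k) \<Rightarrow> 'k) \<Rightarrow> ((nat \<Rightarrow> 'k) \<Rightarrow> 'k) \<Rightarrow> bool" where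
  "ratio_on V h F G \<longleftrightarrow> (\<forall>Q\<in>V. G (coords Q) \<noteq> 0 \<and> h Q = F (coords Q) / G (coords Q))"

lemma ratio_onD:
  "ratio_on V h F G \<Longrightarrow> Q \<in> V \<Longrightarrow> G (coords Q) \<noteq> 0"
  "ratio_on V h F G \<Longrightarrow> Q \<in> V \<Longrightarrow> h Q = F (coords Q) / G (coords Q)"
  by (simp_all add: ratio_on_def)

lemma ratio_on_mono: "ratio_on V h F G \<Longrightarrow> W \<subseteq> V \<Longrightarrow> ratio_on W h F G"
  by (auto simp: ratio_on_def)

lemma ratio_on_eq:
  assumes "V \<subseteq> pspaces" "hom_poly n d F" "hom_poly n d G"
  shows "(\<forall>Q\<in>V. \<forall>v\<in>Q. G v \<noteq> 0 \<and> h Q = F v / G v) \<longleftrightarrow> ratio_on V h F G"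
  unfolding ratio_on_def
  using hom_poly_nz_iff[OF assms(3)] hom_poly_ratio[OF assms(2,3)] coords_in assms(1) by (metis subsetD)

lemma regular_local:
  assumes "h \<in> regular_fns X U" "P \<in> U"
  obtains V n d F G where "open_in X V" "P \<in> V" "V \<subseteq> U" "hom_poly n d F" "hom_poly n d G" "ratio_on V h F G"
proof -
  obtain V n d F G where V: "open_in X V" "P \<in> V" "V \<subseteq> U" "hom_poly n d F" "hom_poly n d G"
    and r: "\<forall>Q\<in>V. \<forall>v\<in>Q. G v \<noteq> 0 \<and> h Q = F v / G v"
    using assms unfolding regular_fns_def mem_Collect_eq by meson
  then show ?thesis
    using that ratio_on_eq[OF openin_sub_zariski_subset(2)[OF V(1)] V(4,5)] by blast
qed

lemma regular_fns_open: "h \<in> regular_fns X U \<Longrightarrow> open_in X U"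
  by (simp add: regular_fns_def)

lemma regular_fnsI:
  assumes "\<And>P. P \<in> U \<Longrightarrow> \<exists>V. P \<in> V \<and> V \<subseteq> U \<and> h \<in> regular_fns X V"
  shows "h \<in> regular_fns X U"
  unfolding regular_fns_def mem_Collect_eq
proof (intro conjI ballI)
  show "open_in X U"
  proof (rule openin_sub_zariskiI)
    fix P assume "P \<in> U"
    from assms[OF this] obtain V where V: "P \<in> V" "V \<subseteq> U" "h \<in> regular_fns X V" by blast
    then show "\<exists>V. open_in X V \<and> P \<in> V \<and> V \<subseteq> U" using regular_fns_open[OF V(3)] by blast
  qed
  fix P assume "P \<in> U"
  then obtain V where V: "P \<in> V" "V \<subseteq> U" "h \<in> regular_fns X V" using assms by blast
  then obtain V' where "open_in X V'" "P \<in> V'" "V' \<subseteq> V"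
    "\<exists>n d F G. hom_poly n d F \<and> hom_poly n d G \<and> (\<forall>Q\<in>V'. \<forall>v\<in>Q. G v \<noteq> 0 \<and> h Q = F v / G v)"
    unfolding regular_fns_def mem_Collect_eq by meson
  with V(2) show "\<exists>V. open_in X V \<and> P \<in> V \<and> V \<subseteq> U \<and>
      (\<exists>n d F G. hom_poly n d F \<and> hom_poly n d G \<and> (\<forall>Q\<in>V. \<forall>v\<in>Q. G v \<noteq> 0 \<and> h Q = F v / G v))"
    by (intro exI[of _ V'] conjI) (assumption | rule subset_trans)+
qed

lemma regular_ratio:
  assumes "hom_poly n d F" "hom_poly n d G" "open_in X U" "ratio_on U h F G"
  shows "h \<in> regular_fns X U"
  unfolding regular_fns_def mem_Collect_eq
  using assms ratio_on_eq[OF openin_sub_zariski_subset(2)[OF assms(3)] assms(1,2), of h]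
  by (intro conjI ballI exI[of _ U] exI[of _ n] exI[of _ d] exI[of _ F] exI[of _ G]) simp_all

lemma regular_restrict:
  assumes "h \<in> regular_fns X U" "open_in X U'" "U' \<subseteq> U"
  shows "h \<in> regular_fns X U'"
proof (rule regular_fnsI)
  fix P assume P: "P \<in> U'"
  then have "P \<in> U" using assms by blast
  with assms(1) obtain V n d F G where V: "open_in X V" "P \<in> V" "hom_poly n d F" "hom_poly n d G" "ratio_on V h F G"
    by (rule regular_local)
  have "h \<in> regular_fns X (V \<inter> U')"
    using V assms(2) by (intro regular_ratio[OF V(3,4)]) (auto intro: ratio_on_mono)
  then show "\<exists>V. P \<in> V \<and> V \<subseteq> U' \<and> h \<in> regular_fns X V"
    using V(2) P by (intro exI[of _ "V \<inter> U'"]) simp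
qed

lemma regular_const: "open_in X U \<Longrightarrow> (\<lambda>_. c) \<in> regular_fns X U"
  using regular_ratio[OF hom_poly_const[of 0 c] hom_poly_const[of 0 1]] by (simp add: ratio_on_def)

lemma regular_common_denominator:
  assumes h: "h \<in> regular_fns X U" "h' \<in> regular_fns X U" and P: "P \<in> U"
  obtains V n d F F' G where "open_in X V" "P \<in> V" "V \<subseteq> U" "hom_poly n d F" "hom_poly n d F'" "hom_poly n d G"
    "ratio_on V h F G" "ratio_on V h' F' G"
proof -
  obtain V n d F G where V: "open_in X V" "P \<in> V" "V \<subseteq> U" "hom_poly n d F" "hom_poly n d G" "ratio_on V h F G"
    by (rule regular_local[OF h(1) P])
  obtain V' n' d' F' G' where V': "open_in X V'" "P \<in> V'" "V' \<subseteq> U" "hom_poly n' d' F'" "hom_poly n' d' G'"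
    "ratio_on V' h' F' G'"
    by (rule regular_local[OF h(2) P])
  have mono: "n \<le> max n n'" "n' \<le> max n n'" by auto
  note m = hom_poly_mono[OF V(4) mono(1)] hom_poly_mono[OF V(5) mono(1)]
    hom_poly_mono[OF V'(4) mono(2)] hom_poly_mono[OF V'(5) mono(2)]
  show ?thesis
  proof (rule that[OF _ _ _ hom_poly_mult[OF m(1,4)] hom_poly_mult[OF m(2,3)] hom_poly_mult[OF m(2,4)]])
    show "open_in X (V \<inter> V')" using V V' by blast
  qed (use V V' in \<open>auto simp: ratio_on_def\<close>)
qed

lemma regular_add:
  assumes "h \<in> regular_fns X U" "h' \<in> regular_fns X U"
  shows "(\<lambda>Q. h Q + h' Q) \<in> regular_fns X U"
proof (rule regular_fnsI)
  fix P assume "P \<in> U"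
  with assms obtain V n d F F' G where V: "open_in X V" "P \<in> V" "V \<subseteq> U"
    "hom_poly n d F" "hom_poly n d F'" "hom_poly n d G" "ratio_on V h F G" "ratio_on V h' F' G"
    by (rule regular_common_denominator)
  have "(\<lambda>Q. h Q + h' Q) \<in> regular_fns X V"
    by (rule regular_ratio[OF hom_poly_add[OF V(4,5)] V(6,1)])
      (use V(7,8) in \<open>simp add: ratio_on_def add_divide_distrib\<close>)
  then show "\<exists>V. P \<in> V \<and> V \<subseteq> U \<and> (\<lambda>Q. h Q + h' Q) \<in> regular_fns X V" using V(2,3) by blast
qed

lemma regular_mult:
  assumes "h \<in> regular_fns X U" "h' \<in> regular_fns X U"
  shows "(\<lambda>Q. h Q * h' Q) \<in> regular_fns X U"
proof (rule regular_fnsI)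
  fix P assume "P \<in> U"
  with assms obtain V n d F F' G where V: "open_in X V" "P \<in> V" "V \<subseteq> U"
    "hom_poly n d F" "hom_poly n d F'" "hom_poly n d G" "ratio_on V h F G" "ratio_on V h' F' G"
    by (rule regular_common_denominator)
  have "(\<lambda>Q. h Q * h' Q) \<in> regular_fns X V"
    by (rule regular_ratio[OF hom_poly_mult[OF V(4,5)] hom_poly_mult[OF V(6,6)] V(1)])
      (use V(7,8) in \<open>simp add: ratio_on_def\<close>)
  then show "\<exists>V. P \<in> V \<and> V \<subseteq> U \<and> (\<lambda>Q. h Q * h' Q) \<in> regular_fns X V" using V(2,3) by blast
qed

lemma regular_divide:
  assumes "h \<in> regular_fns X U" "h' \<in> regular_fns X U" "\<And>Q. Q \<in> U \<Longrightarrow> h' Q \<noteq> 0"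
  shows "(\<lambda>Q. h Q / h' Q) \<in> regular_fns X U"
proof (rule regular_fnsI)
  fix P assume "P \<in> U"
  with assms(1,2) obtain V n d F F' G where V: "open_in X V" "P \<in> V" "V \<subseteq> U"
    "hom_poly n d F" "hom_poly n d F'" "hom_poly n d G" "ratio_on V h F G" "ratio_on V h' F' G"
    by (rule regular_common_denominator)
  have "h' Q \<noteq> 0" if "Q \<in> V" for Q using assms(3) V(3) that by blast
  then have "(\<lambda>Q. h Q / h' Q) \<in> regular_fns X V"
    by (intro regular_ratio[OF V(4,5,1)]) (use V(7,8) in \<open>auto simp: ratio_on_def\<close>)
  then show "\<exists>V. P \<in> V \<and> V \<subseteq> U \<and> (\<lambda>Q. h Q / h' Q) \<in> regular_fns X V" using V(2,3) by blast
qed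

lemma regular_diff:
  assumes "h \<in> regular_fns X U" "h' \<in> regular_fns X U"
  shows "(\<lambda>Q. h Q - h' Q) \<in> regular_fns X U"
  using regular_add[OF assms(1) regular_mult[OF regular_const[OF regular_fns_open[OF assms(1)], of "-1"] assms(2)]]
  by simp

lemma regular_fns_subring:
  assumes "open_in X U" shows "subring (regular_fns X U)"
  unfolding subring_def
proof (intro conjI ballI)
  show "1 \<in> regular_fns X U" using regular_const[OF assms, of 1] by (simp add: one_fun_def)
  fix a b assume ab: "a \<in> regular_fns X U" "b \<in> regular_fns X U"
  show "a - b \<in> regular_fns X U" using regular_diff[OF ab] by (simp add: fun_diff_def)
  show "a * b \<in> regular_fns X U" using regular_mult[OF ab] by (simp add: times_fun_def)
qed

lemma regular_cong:
  assumes "h \<in> regular_fns X U" "\<And>Q. Q \<in> U \<Longrightarrow> h' Q = h Q"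
  shows "h' \<in> regular_fns X U"
proof (rule regular_fnsI)
  fix P assume "P \<in> U"
  with assms(1) obtain V n d F G where V: "open_in X V" "P \<in> V" "V \<subseteq> U" "hom_poly n d F" "hom_poly n d G" "ratio_on V h F G"
    by (rule regular_local)
  have "h' \<in> regular_fns X V"
    by (rule regular_ratio[OF V(4,5,1)]) (use V(3,6) assms(2) in \<open>auto simp: ratio_on_def\<close>)
  then show "\<exists>V. P \<in> V \<and> V \<subseteq> U \<and> h' \<in> regular_fns X V" using V(2,3) by blast
qed

lemma regular_hom_poly:
  assumes "hom_poly n d F" "open_in X U" "\<And>i. i \<le> n \<Longrightarrow> t i \<in> regular_fns X U"
  shows "(\<lambda>S. F (\<lambda>i. t i S)) \<in> regular_fns X U"
  using hom_poly_in_subring[OF assms(1) regular_fns_subring[OF assms(2)] regular_const[OF assms(2)]] assms(3)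
  by blast

lemma regular_nz_open:
  assumes "h \<in> regular_fns X U" shows "open_in X {Q \<in> U. h Q \<noteq> 0}"
proof (rule openin_sub_zariskiI)
  fix P assume P: "P \<in> {Q \<in> U. h Q \<noteq> 0}"
  then have PU: "P \<in> U" by simp
  from assms PU obtain V n d F G where V: "open_in X V" "P \<in> V" "V \<subseteq> U"
    "hom_poly n d F" "hom_poly n d G" "ratio_on V h F G" by (rule regular_local)
  let ?W = "V \<inter> (X \<inter> basic_open F)"
  have "open_in X ?W" using V openin_sub_basic by blast
  moreover have "P \<in> ?W" using V P openin_sub_zariski_subset[OF V(1)] by (auto simp: basic_open_def ratio_on_def)
  moreover have "?W \<subseteq> {Q \<in> U. h Q \<noteq> 0}" using V(3,6) by (auto simp: basic_open_def ratio_on_def)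
  ultimately show "\<exists>V. open_in X V \<and> P \<in> V \<and> V \<subseteq> {Q \<in> U. h Q \<noteq> 0}" by blast
qed

text \<open>The locus where \<open>h\<close> and \<open>h'\<close> differ is open. If nonempty, it
  would meet \<open>V\<close> by irreducibility.\<close>

lemma regular_identity:
  assumes irr: "irreducible_set zariski X" and h: "h \<in> regular_fns X U" "h' \<in> regular_fns X U"
    and V: "open_in X V" "V \<noteq> {}" "\<And>Q. Q \<in> V \<Longrightarrow> Q \<in> U \<Longrightarrow> h Q = h' Q"
    and Q: "Q \<in> U"
  shows "h Q = h' Q"
proof (rule ccontr)
  assume "h Q \<noteq> h' Q"
  then have "{Q \<in> U. h Q - h' Q \<noteq> 0} \<noteq> {}" using Q by auto
  from irreducible_open_inter[OF irr regular_nz_open[OF regular_diff[OF h]] V(1) this V(2)]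
  show False using V(3) by auto
qed

section \<open>Germs along an irreducible set and at the generic point\<close>

lemma nbhd_inter:
  assumes "irreducible_set zariski Z" "Z \<subseteq> X" "nbhd X Z U" "nbhd X Z V"
  shows "nbhd X Z (U \<inter> V)"
proof -
  have "open_in Z (W \<inter> Z)" if W: "open_in X W" for W
  proof -
    obtain T where "openin zariski T" "W = T \<inter> X" using W by (auto simp: openin_subtopology)
    then show ?thesis using assms(2) by (auto simp: openin_subtopology intro!: exI[of _ T])
  qed
  note sub = this
  have UV: "open_in X U" "open_in X V" "U \<inter> Z \<noteq> {}" "V \<inter> Z \<noteq> {}"
    using assms(3,4) by (simp_all add: nbhd_def)
  \<comment> \<open>Irreducibility of \<open>Z\<close> makes the two open sets meet inside
    \<open>Z\<close>, as a neighbourhood of its generic point requires.\<close>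
  have "(U \<inter> Z) \<inter> (V \<inter> Z) \<noteq> {}"
    by (rule irreducible_open_inter[OF assms(1) sub[OF UV(1)] sub[OF UV(2)] UV(3,4)])
  then show ?thesis using assms unfolding nbhd_def by auto
qed

lemma germ_fns_const: "\<exists>U. nbhd X Z U \<Longrightarrow> (\<lambda>_. c) \<in> germ_fns X Z"
  unfolding germ_fns_def nbhd_def using regular_const[of X _ c] by fast

lemma nbhd_whole:
  assumes "irreducible_set zariski Z" "Z \<subseteq> X" "X \<subseteq> pspaces" shows "nbhd X Z X"
  using assms unfolding nbhd_def irreducible_set_def
  by (metis Int_absorb1 inf_commute openin_topspace topspace_subtopology topspace_zariski)

lemma germ_fns_subring:
  assumes "irreducible_set zariski Z" "Z \<subseteq> X" "X \<subseteq> pspaces" shows "subring (germ_fns X Z)"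
proof -
  have "h - h' \<in> germ_fns X Z \<and> h * h' \<in> germ_fns X Z" if hh: "h \<in> germ_fns X Z" "h' \<in> germ_fns X Z" for h h'
  proof -
    obtain U U' where U: "nbhd X Z U" "h \<in> regular_fns X U" "nbhd X Z U'" "h' \<in> regular_fns X U'"
      using hh unfolding germ_fns_def by blast
    have n: "nbhd X Z (U \<inter> U')" using nbhd_inter[OF assms(1,2)] U by blast
    then have o: "open_in X (U \<inter> U')" by (simp add: nbhd_def)
    have "h \<in> regular_fns X (U \<inter> U')" "h' \<in> regular_fns X (U \<inter> U')"
      using U o regular_restrict by (metis inf_le1 inf_le2)+
    then show ?thesis using n subring_diff[OF regular_fns_subring[OF o]] subring_mult[OF regular_fns_subring[OF o]]
      unfolding germ_fns_def by blast
  qed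
  then show ?thesis
    unfolding subring_def using germ_fns_const[of X Z 1] nbhd_whole[OF assms] by (auto simp: one_fun_def)
qed

text \<open>The ideal modulo which all places below are taken: germs at the generic point modulo it
  are the function field. It also absorbs products with functions that are not regular, such as
  pointwise inverses of coordinates.\<close>

definition generic_zero :: "'k::field ppoint set \<Rightarrow> ('k ppoint \<Rightarrow> 'k) set" where
  "generic_zero X = {h. \<exists>U. open_in X U \<and> U \<noteq> {} \<and> (\<forall>Q\<in>U. h Q = 0)}"

lemma generic_zero_ideal:
  assumes "irreducible_set zariski X" shows "ring_ideal (generic_zero X)"
  unfolding ring_ideal_def
proof (intro conjI ballI allI)
  have "open_in X X" "X \<noteq> {}"
    using assms unfolding irreducible_set_def by (metis Int_absorb1 openin_topspace topspace_subtopology, blast)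
  then show "0 \<in> generic_zero X" unfolding generic_zero_def by auto
next
  fix a b assume "a \<in> generic_zero X" "b \<in> generic_zero X"
  then obtain U V where "open_in X U" "U \<noteq> {}" "\<forall>Q\<in>U. a Q = 0"
    "open_in X V" "V \<noteq> {}" "\<forall>Q\<in>V. b Q = 0" unfolding generic_zero_def by blast
  then show "a + b \<in> generic_zero X" unfolding generic_zero_def
    using irreducible_open_inter[OF assms, of U V] by (auto intro!: exI[of _ "U \<inter> V"])
next
  fix a c assume "a \<in> generic_zero X"
  then show "c * a \<in> generic_zero X" unfolding generic_zero_def by auto
qed

lemma germ_eq_generic: "X \<subseteq> pspaces \<Longrightarrow> germ_eq X X h h' \<longleftrightarrow> h - h' \<in> generic_zero X"
proof -
  have "U \<inter> X = U" if "open_in X U" for U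
    using openin_sub_zariski_subset[OF that] by auto
  then show ?thesis unfolding germ_eq_def generic_zero_def nbhd_def by auto
qed

section \<open>Morphisms: preimages, composition, restriction and change of target\<close>

lemma morphism_cont: "morphism \<phi> X Y \<Longrightarrow> continuous_map (subtopology zariski X) (subtopology zariski Y) \<phi>"
  by (simp add: morphism_def)

lemma morphism_regular: "morphism \<phi> X Y \<Longrightarrow> h \<in> regular_fns Y V \<Longrightarrow> h \<circ> \<phi> \<in> regular_fns X (X \<inter> \<phi> -` V)"
  by (simp add: morphism_def)

lemma morphism_in: "morphism \<phi> X Y \<Longrightarrow> X \<subseteq> pspaces \<Longrightarrow> P \<in> X \<Longrightarrow> \<phi> P \<in> Y"
  using continuous_map_image_subset_topspace[OF morphism_cont, of \<phi> X Y]
  by (auto simp: topspace_zariski image_subset_iff)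

lemma morphism_preimage:
  assumes "morphism \<phi> X Y" "X \<subseteq> pspaces" "open_in Y V"
  shows "open_in X (X \<inter> \<phi> -` V)"
proof -
  have "{x \<in> topspace (subtopology zariski X). \<phi> x \<in> V} = X \<inter> \<phi> -` V"
    using assms by (auto simp: topspace_zariski)
  then show ?thesis using openin_continuous_map_preimage[OF morphism_cont[OF assms(1)] assms(3)] by simp
qed

lemma morphism_preimage_closed:
  assumes "morphism \<phi> X Y" "X \<subseteq> pspaces" "closedin zariski C"
  shows "closedin (subtopology zariski X) (X \<inter> \<phi> -` C)"
proof -
  have "closedin (subtopology zariski Y) (Y \<inter> C)" using assms(3) by (auto simp: closedin_subtopology)
  moreover have "{x \<in> topspace (subtopology zariski X). \<phi> x \<in> Y \<inter> C} = X \<inter> \<phi> -` C"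
    using assms morphism_in[OF assms(1,2)] by (auto simp: topspace_zariski)
  ultimately show ?thesis
    using closedin_continuous_map_preimage[OF morphism_cont[OF assms(1)], of "Y \<inter> C"] by simp
qed

lemma morphism_compose:
  assumes "morphism \<phi> X Y" "morphism \<chi> Y W" "X \<subseteq> pspaces"
  shows "morphism (\<chi> \<circ> \<phi>) X W"
  unfolding morphism_def
proof (intro conjI allI ballI)
  show "continuous_map (subtopology zariski X) (subtopology zariski W) (\<chi> \<circ> \<phi>)"
    using assms morphism_cont continuous_map_compose by blast
  fix V h assume "h \<in> regular_fns W V"
  then have "h \<circ> \<chi> \<circ> \<phi> \<in> regular_fns X (X \<inter> \<phi> -` (Y \<inter> \<chi> -` V))" using assms morphism_regular by blast
  moreover have "X \<inter> \<phi> -` (Y \<inter> \<chi> -` V) = X \<inter> (\<chi> \<circ> \<phi>) -` V" using morphism_in[OF assms(1,3)] by auto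
  ultimately show "h \<circ> (\<chi> \<circ> \<phi>) \<in> regular_fns X (X \<inter> (\<chi> \<circ> \<phi>) -` V)" by (simp add: comp_assoc)
qed

lemma openin_open_sub:
  assumes "open_in X W"
  shows "open_in W U \<longleftrightarrow> open_in X U \<and> U \<subseteq> W"
proof -
  have "W \<subseteq> X" using openin_sub_zariski_subset[OF assms] by simp
  then have "subtopology zariski W = subtopology (subtopology zariski X) W"
    by (simp add: subtopology_subtopology Int_absorb1)
  then show ?thesis using openin_open_subtopology[OF assms] by simp
qed

lemma regular_fns_open_sub:
  assumes "open_in X W"
  shows "h \<in> regular_fns W U \<longleftrightarrow> h \<in> regular_fns X U \<and> U \<subseteq> W"
proof -
  have eq: "(open_in X V \<and> V \<subseteq> W) \<and> P \<in> V \<and> V \<subseteq> U \<and> R \<longleftrightarrow> open_in X V \<and> P \<in> V \<and> V \<subseteq> U \<and> R"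
    if "U \<subseteq> W" for V P R
    using that by auto
  show ?thesis
    unfolding regular_fns_def mem_Collect_eq openin_open_sub[OF assms]
    by (cases "U \<subseteq> W") (simp_all only: eq simp_thms)
qed

lemma morphism_restrict:
  assumes "morphism \<phi> X Y" "open_in X W"
  shows "morphism \<phi> W Y"
  unfolding morphism_def
proof (intro conjI allI ballI)
  have W: "W \<subseteq> X" "W \<subseteq> pspaces" using openin_sub_zariski_subset[OF assms(2)] by auto
  show "continuous_map (subtopology zariski W) (subtopology zariski Y) \<phi>"
    using continuous_map_from_subtopology[OF morphism_cont[OF assms(1)], of W] W
    by (simp add: subtopology_subtopology Int_absorb1)
  fix V h assume h: "h \<in> regular_fns Y V"
  then have *: "h \<circ> \<phi> \<in> regular_fns X (X \<inter> \<phi> -` V)" using assms morphism_regular by blast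
  have "open_in X (W \<inter> (X \<inter> \<phi> -` V))"
    using regular_fns_open[OF *] assms(2) by blast
  moreover have "W \<inter> \<phi> -` V = W \<inter> (X \<inter> \<phi> -` V)" using W by auto
  ultimately show "h \<circ> \<phi> \<in> regular_fns W (W \<inter> \<phi> -` V)"
    unfolding regular_fns_open_sub[OF assms(2)] using regular_restrict[OF *] by auto
qed

lemma openin_sub_subset:
  assumes "open_in Y V" "W \<subseteq> Y"
  shows "open_in W (W \<inter> V)"
proof -
  obtain T where "openin zariski T" "V = T \<inter> Y" using assms by (auto simp: openin_subtopology)
  then show ?thesis using assms(2) by (auto simp: openin_subtopology intro!: exI[of _ T])
qed

lemma morphism_incl:
  assumes "W \<subseteq> Y" "morphism \<phi> X W" "X \<subseteq> pspaces"
  shows "morphism \<phi> X Y"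
proof -
  have "morphism (\<lambda>x. x) W Y"
    unfolding morphism_def
  proof (intro conjI allI ballI)
    show "continuous_map (subtopology zariski W) (subtopology zariski Y) (\<lambda>x. x)"
      using assms(1) by (auto simp: continuous_map_in_subtopology intro: continuous_map_from_subtopology)
    fix V h assume h: "h \<in> regular_fns Y V"
    have "h \<in> regular_fns W (W \<inter> V)"
    proof (rule regular_fnsI)
      fix P assume P: "P \<in> W \<inter> V"
      then have PV: "P \<in> V" by simp
      from h PV obtain V' n d F G where V: "open_in Y V'" "P \<in> V'" "V' \<subseteq> V"
        "hom_poly n d F" "hom_poly n d G" "ratio_on V' h F G" by (rule regular_local)
      have "h \<in> regular_fns W (W \<inter> V')"
        by (rule regular_ratio[OF V(4,5) openin_sub_subset[OF V(1) assms(1)]])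
          (use V(6) in \<open>auto intro: ratio_on_mono\<close>)
      then show "\<exists>V'. P \<in> V' \<and> V' \<subseteq> W \<inter> V \<and> h \<in> regular_fns W V'" using V P by blast
    qed
    then show "h \<circ> (\<lambda>x. x) \<in> regular_fns W (W \<inter> (\<lambda>x. x) -` V)" by (simp add: comp_def)
  qed
  from morphism_compose[OF assms(2) this assms(3)] show ?thesis by (simp add: comp_def)
qed

lemma morphism_id:
  assumes "X \<subseteq> pspaces" "W \<subseteq> X" shows "morphism (\<lambda>x. x) W X"
proof (rule morphism_incl[OF assms(2)])
  have "h \<in> regular_fns W (W \<inter> V)" if "h \<in> regular_fns W V" for h V
    using that openin_sub_zariski_subset(1)[OF regular_fns_open[OF that]] by (simp add: Int_absorb1)
  then show "morphism (\<lambda>x. x) W W" unfolding morphism_def by (auto simp: comp_def)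
qed (use assms in auto)

lemma coord_ratio_regular:
  "Y \<subseteq> pspaces \<Longrightarrow> (\<lambda>Q. coords Q i / coords Q m) \<in> regular_fns Y (Y \<inter> basic_open (\<lambda>x. x m))"
  by (rule regular_ratio[OF hom_poly_var[of i "max i m"] hom_poly_var[of m "max i m"]
        openin_sub_basic[OF hom_poly_var[OF order.refl]]])
    (auto simp: basic_open_def ratio_on_def)

text \<open>Separatedness, in homogeneous coordinates.\<close>

lemma morphism_identity:
  assumes irr: "irreducible_set zariski X" and W: "open_in X W"
    and \<alpha>: "morphism \<alpha> W Y" and \<beta>: "morphism \<beta> W Y" and Y: "Y \<subseteq> pspaces"
    and V: "open_in X V" "V \<noteq> {}" "\<And>Q. Q \<in> V \<Longrightarrow> Q \<in> W \<Longrightarrow> \<alpha> Q = \<beta> Q"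
    and S: "S \<in> W"
  shows "\<alpha> S = \<beta> S"
proof -
  have Wp: "W \<subseteq> pspaces" using openin_sub_zariski_subset[OF W] by auto
  have in_Y: "\<alpha> Q \<in> Y" "\<beta> Q \<in> Y" if "Q \<in> W" for Q using morphism_in[OF \<alpha> Wp] morphism_in[OF \<beta> Wp] that by auto
  have in_P: "\<alpha> S \<in> pspaces" "\<beta> S \<in> pspaces" using subsetD[OF Y in_Y(1)[OF S]] subsetD[OF Y in_Y(2)[OF S]] .
  obtain m where m: "coords (\<alpha> S) m \<noteq> 0" using coords_nz[OF in_P(1)] by blast
  obtain k where k: "coords (\<beta> S) k \<noteq> 0" using coords_nz[OF in_P(2)] by blast
  let ?Um = "Y \<inter> basic_open (\<lambda>x. x m)" and ?Uk = "Y \<inter> basic_open (\<lambda>x. x k)"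
  define r where "r i j Q = coords Q i / coords Q j" for i j :: nat and Q :: "'a ppoint"
  \<comment> \<open>\<open>\<alpha> S\<close> and \<open>\<beta> S\<close> may lie in different
    charts, so affine coordinates relative to \<open>m\<close> and to \<open>k\<close> are used side
    by side.\<close>
  let ?N = "(W \<inter> \<alpha> -` ?Um) \<inter> (W \<inter> \<beta> -` ?Uk)"
  have reg: "r i m \<circ> \<alpha> \<in> regular_fns X (W \<inter> \<alpha> -` ?Um)" "r i k \<circ> \<beta> \<in> regular_fns X (W \<inter> \<beta> -` ?Uk)" for i
    using morphism_regular[OF \<alpha> coord_ratio_regular[OF Y]] morphism_regular[OF \<beta> coord_ratio_regular[OF Y]]
    unfolding r_def[abs_def] regular_fns_open_sub[OF W] by auto
  have o: "open_in X ?N" using reg[THEN regular_fns_open] by blast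
  have reg': "r i m \<circ> \<alpha> \<in> regular_fns X ?N" "r i k \<circ> \<beta> \<in> regular_fns X ?N" for i
    using reg o regular_restrict by (metis inf_le1, metis inf_le2)
  have SN: "S \<in> ?N" using S m k in_Y in_P by (simp add: basic_open_def)
  \<comment> \<open>Where the two maps agree, this is the change of chart for their common value.
    The identity theorem carries it to \<open>S\<close>, where agreement is not yet known.\<close>
  have eq: "(r i m \<circ> \<alpha>) S * (r m k \<circ> \<beta>) S = (r i k \<circ> \<beta>) S" for i
  proof (rule regular_identity[OF irr regular_mult[OF reg'] reg'(2) V(1,2) _ SN])
    fix Q assume Q: "Q \<in> V" "Q \<in> ?N"
    then have "\<alpha> Q = \<beta> Q" using V(3) by auto
    then show "(r i m \<circ> \<alpha>) Q * (r m k \<circ> \<beta>) Q = (r i k \<circ> \<beta>) Q"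
      using Q by (auto simp: r_def basic_open_def)
  qed
  define c where "c = coords (\<alpha> S) m / coords (\<beta> S) m"
  have "coords (\<alpha> S) i * coords (\<beta> S) m = coords (\<beta> S) i * coords (\<alpha> S) m" for i
    using eq[of i] m k by (simp add: r_def field_simps)
  \<comment> \<open>For \<open>i = k\<close> the right-hand side is 1, so the factor with index
    \<open>m\<close> cannot vanish.\<close>
  moreover have "coords (\<beta> S) m \<noteq> 0" using eq[of k] m k by (auto simp: r_def)
  ultimately have "coords (\<alpha> S) i = c * coords (\<beta> S) i" "c \<noteq> 0" for i
    using m by (auto simp: c_def field_simps)
  then show ?thesis using ppoint_eqI[of "\<alpha> S" "\<beta> S" c] in_Y S Y by blast
qed

text \<open>By homogeneity the factor between the vector of the \<open>h i S\<close> and the chosen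
  coordinates of \<open>\<psi> S\<close> cancels in \<open>F / G\<close>. Pullbacks are therefore
  polynomial quotients in the regular functions \<open>h i\<close>.\<close>

lemma morphism_from_coords:
  assumes X: "X \<subseteq> pspace N" and W: "open_in Y W"
    and h: "\<And>i. h i \<in> regular_fns Y W" "\<And>i S. i > N \<Longrightarrow> h i S = 0" "\<And>S. S \<in> W \<Longrightarrow> \<exists>i. h i S \<noteq> 0"
    and \<psi>: "\<And>S. S \<in> W \<Longrightarrow> \<psi> S = ppoint_of (\<lambda>i. h i S)" "\<And>S. S \<in> W \<Longrightarrow> \<psi> S \<in> X"
  shows "morphism \<psi> W X"
proof -
  have Wp: "W \<subseteq> pspaces" using openin_sub_zariski_subset[OF W] by auto
  have sc: "\<exists>c. c \<noteq> 0 \<and> (\<lambda>i. h i S) = (\<lambda>i. c * coords (\<psi> S) i)" if "S \<in> W" for S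
    using coords_ppoint_of(2)[of "\<lambda>i. h i S" _ N] h(2,3) \<psi>(1) that by metis
  have nz: "F (\<lambda>i. h i S) \<noteq> 0 \<longleftrightarrow> F (coords (\<psi> S)) \<noteq> 0" if "S \<in> W" "hom_poly n d F" for S n d F
    using sc[OF that(1)] hom_poly_scale[OF that(2)] by auto
  have ratio: "F (\<lambda>i. h i S) / G (\<lambda>i. h i S) = F (coords (\<psi> S)) / G (coords (\<psi> S))"
    if "S \<in> W" "hom_poly n d F" "hom_poly n d G" for S n d F G
    using sc[OF that(1)] hom_poly_scale[OF that(2)] hom_poly_scale[OF that(3)] by auto
  have pre: "open_in Y (W \<inter> \<psi> -` V)" if V: "open_in X V" for V
  proof (rule openin_sub_zariskiI)
    fix S assume S: "S \<in> W \<inter> \<psi> -` V"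
    then obtain n d F where F: "hom_poly n d F" "F (coords (\<psi> S)) \<noteq> 0" "X \<inter> basic_open F \<subseteq> V"
      using openin_sub_zariski_basic[OF V, of "\<psi> S"] by auto
    have "open_in Y {S \<in> W. F (\<lambda>i. h i S) \<noteq> 0}"
      using regular_nz_open[OF regular_hom_poly[OF F(1) W h(1)]] .
    moreover have "S \<in> {S \<in> W. F (\<lambda>i. h i S) \<noteq> 0}" using S F nz by auto
    moreover have "{S \<in> W. F (\<lambda>i. h i S) \<noteq> 0} \<subseteq> W \<inter> \<psi> -` V"
    proof -
      have in_P: "\<psi> S \<in> pspaces" if "S \<in> W" for S using \<psi>(2)[OF that] X by blast
      have F_nz: "F (coords (\<psi> S)) \<noteq> 0" if "S \<in> W" "F (\<lambda>i. h i S) \<noteq> 0" for S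
        using nz[OF that(1) F(1)] that(2) by simp
      have "{S \<in> W. F (\<lambda>i. h i S) \<noteq> 0} \<subseteq> W \<inter> \<psi> -` (X \<inter> basic_open F)"
      proof (intro subsetI)
        fix S assume "S \<in> {S \<in> W. F (\<lambda>i. h i S) \<noteq> 0}"
        then have "S \<in> W" "F (\<lambda>i. h i S) \<noteq> 0" by simp_all
        then show "S \<in> W \<inter> \<psi> -` (X \<inter> basic_open F)"
          using in_P F_nz \<psi>(2) by (simp add: basic_open_def)
      qed
      then show ?thesis using F(3) by blast
    qed
    ultimately show "\<exists>V'. open_in Y V' \<and> S \<in> V' \<and> V' \<subseteq> W \<inter> \<psi> -` V" by blast
  qed
  show ?thesis unfolding morphism_def
  proof (intro conjI allI ballI)
    show "continuous_map (subtopology zariski W) (subtopology zariski X) \<psi>"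
      unfolding continuous_map_def
    proof (intro conjI allI impI)
      have "X \<subseteq> pspaces" using X by blast
      then show "\<psi> \<in> topspace (subtopology zariski W) \<rightarrow> topspace (subtopology zariski X)"
        using \<psi>(2) by (auto simp: topspace_zariski)
      fix V assume V: "open_in X V"
      have "{x \<in> topspace (subtopology zariski W). \<psi> x \<in> V} = W \<inter> \<psi> -` V"
        using Wp by (auto simp: topspace_zariski)
      then show "open_in W {x \<in> topspace (subtopology zariski W). \<psi> x \<in> V}"
        using pre[OF V] openin_open_sub[OF W] by auto
    qed
    fix V g assume g: "g \<in> regular_fns X V"
    have "g \<circ> \<psi> \<in> regular_fns Y (W \<inter> \<psi> -` V)"
    proof (rule regular_fnsI)
      fix S assume S: "S \<in> W \<inter> \<psi> -` V"
      then have \<psi>S: "\<psi> S \<in> V" by auto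
      from g \<psi>S obtain V' n d F G where V: "open_in X V'" "\<psi> S \<in> V'" "V' \<subseteq> V"
        "hom_poly n d F" "hom_poly n d G" "ratio_on V' g F G" by (rule regular_local)
      have o: "open_in Y (W \<inter> \<psi> -` V')" by (rule pre[OF V(1)])
      have hr: "h i \<in> regular_fns Y (W \<inter> \<psi> -` V')" for i using regular_restrict[OF h(1) o] by auto
      have "(\<lambda>S. F (\<lambda>i. h i S) / G (\<lambda>i. h i S)) \<in> regular_fns Y (W \<inter> \<psi> -` V')"
        by (rule regular_divide[OF regular_hom_poly[OF V(4) o hr] regular_hom_poly[OF V(5) o hr]])
          (use ratio_onD(1)[OF V(6)] nz[OF _ V(5)] in \<open>simp add: vimage_def\<close>)
      then have "g \<circ> \<psi> \<in> regular_fns Y (W \<inter> \<psi> -` V')"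
        by (rule regular_cong) (use ratio[OF _ V(4,5)] ratio_onD(2)[OF V(6)] in auto)
      moreover have "S \<in> W \<inter> \<psi> -` V'" "W \<inter> \<psi> -` V' \<subseteq> W \<inter> \<psi> -` V" using V(2,3) S by auto
      ultimately show "\<exists>V'. S \<in> V' \<and> V' \<subseteq> W \<inter> \<psi> -` V \<and> g \<circ> \<psi> \<in> regular_fns Y V'"
        by (intro exI[of _ "W \<inter> \<psi> -` V'"] conjI)
    qed
    then show "g \<circ> \<psi> \<in> regular_fns W (W \<inter> \<psi> -` V)" unfolding regular_fns_open_sub[OF W] by auto
  qed
qed

section \<open>Centres of places on projective varieties\<close>

lemma partial_hom_hom_poly:
  fixes A :: "('b \<Rightarrow> 'k::alg_closed_field) set"
  assumes hom: "partial_hom Z A \<phi>" and F: "hom_poly n d F"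
    and c: "\<And>c. (\<lambda>_. c) \<in> A" "\<And>c. \<phi> (\<lambda>_. c) = c" and w: "\<And>i. w i \<in> A"
  shows "(\<lambda>S. F (\<lambda>i. w i S)) \<in> A" "\<phi> (\<lambda>S. F (\<lambda>i. w i S)) = F (\<lambda>i. \<phi> (w i))"
proof -
  interpret partial_hom Z A \<phi> by (rule hom)
  show "(\<lambda>S. F (\<lambda>i. w i S)) \<in> A" by (rule hom_poly_in_subring[OF F A c(1) w])
  obtain B e where B: "(\<lambda>S. F (\<lambda>i. w i S)) = (\<Sum>\<alpha>\<in>B. (\<lambda>_. e \<alpha>) * (\<Prod>i\<le>n. w i ^ (\<alpha> i :: nat)))"
    and Fx: "\<And>x. F x = (\<Sum>\<alpha>\<in>B. e \<alpha> * (\<Prod>i\<le>n. x i ^ (\<alpha> i :: nat)))"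
    using hom_poly_compose_sum[where t=w, OF F] by blast
  have "\<phi> (\<Prod>i\<le>n. w i ^ \<alpha> i) = (\<Prod>i\<le>n. \<phi> (w i) ^ \<alpha> i)" for \<alpha> :: "nat \<Rightarrow> nat"
    by (subst hom_prod) (auto simp: hom_power subring_power[OF A] w)
  moreover have "(\<Prod>i\<le>n. w i ^ \<alpha> i) \<in> A" for \<alpha> :: "nat \<Rightarrow> nat"
    by (intro subring_prod[OF A] subring_power[OF A] w)
  ultimately have "\<phi> ((\<lambda>_. e \<alpha>) * (\<Prod>i\<le>n. w i ^ \<alpha> i)) = e \<alpha> * (\<Prod>i\<le>n. \<phi> (w i) ^ \<alpha> i)" for \<alpha>
    using hom_mult[OF c(1)] c(2) by simp
  then show "\<phi> (\<lambda>S. F (\<lambda>i. w i S)) = F (\<lambda>i. \<phi> (w i))" unfolding B Fx[of "\<lambda>i. \<phi> (w i)"]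
    by (subst hom_sum)
      (auto intro!: subring_mult[OF A] subring_prod[OF A] subring_power[OF A] w c)
qed

text \<open>
  The valuative criterion of properness, for a rational section \<open>\<psi>\<close> of \<open>\<nu>\<close> over \<open>Y'\<close> and a place
  \<open>\<phi>\<close> over \<open>P\<close>.
\<close>

lemma lift_centre:
  fixes \<nu> \<psi> :: "'k::alg_closed_field ppoint \<Rightarrow> 'k ppoint"
  assumes irr: "irreducible_set zariski Y'" and Y: "Y \<subseteq> pspaces" "Y' \<subseteq> Y" and P: "P \<in> Y'"
    and X: "X \<subseteq> pspace N" and X': "closedin zariski X'" "X' \<subseteq> X" and \<nu>: "morphism \<nu> X Y"
    and U: "open_in Y' U" "U \<noteq> {}"
    and pre: "\<And>n d F. hom_poly n d F \<Longrightarrow> open_in Y' {S \<in> U. F (coords (\<psi> S)) \<noteq> 0}"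
    and \<psi>: "\<And>S. S \<in> U \<Longrightarrow> \<psi> S \<in> X'" "\<And>S. S \<in> U \<Longrightarrow> \<nu> (\<psi> S) = S"
    and hom: "partial_hom (generic_zero Y') A \<phi>" "germ_fns Y' {P} \<subseteq> A"
      "\<And>h. h \<in> germ_fns Y' {P} \<Longrightarrow> \<phi> h = h P"
  obtains A' \<phi>' j q where "partial_hom (generic_zero Y') A' \<phi>'" "A \<subseteq> A'" "generic_zero Y' \<subseteq> A'"
    "\<And>a. a \<in> A \<Longrightarrow> \<phi>' a = \<phi> a" "j \<le> N" "q j = 1" "\<And>i. i > N \<Longrightarrow> q i = 0"
    "ppoint_of q \<in> X'" "\<nu> (ppoint_of q) = P"
    "\<And>i. (\<lambda>S. coords (\<psi> S) i / coords (\<psi> S) j) \<in> A'"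
    "\<And>i. \<phi>' (\<lambda>S. coords (\<psi> S) i / coords (\<psi> S) j) = q i"
    "\<exists>S\<in>U. coords (\<psi> S) j \<noteq> 0"
proof -
  let ?Z = "generic_zero Y'"
  \<comment> \<open>\<open>coords\<close> is an arbitrary choice, so \<open>t i\<close> need not be
    regular. Only its zero set and its ratios are controlled, and the extension of places asks for
    nothing more.\<close>
  define t where "t i S = coords (\<psi> S) i" for i S
  define u where "u i S = inverse (t i S)" for i S
  \<comment> \<open>A coordinate outside \<open>I\<close> vanishes on \<open>U\<close> and so lies
    in the ideal; the coordinates in \<open>I\<close> are invertible modulo it.\<close>
  define I where "I = {i. i \<le> N \<and> (\<exists>S\<in>U. t i S \<noteq> 0)}"
  have Up: "U \<subseteq> Y'" using openin_sub_zariski_subset[OF U(1)] by simp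
  have \<psi>P: "\<psi> S \<in> pspace N" if "S \<in> U" for S using \<psi>(1)[OF that] X' X by blast
  then have \<psi>PP: "\<psi> S \<in> pspaces" if "S \<in> U" for S using that by blast
  have t0: "t i S = 0" if "S \<in> U" "i > N" for i S
    using pspace_coords[OF \<psi>P[OF that(1)] that(2)] by (simp add: t_def)
  have open_t: "open_in Y' {S \<in> U. t i S \<noteq> 0}" for i
    using pre[OF hom_poly_var[of i i]] by (simp add: t_def)
  have "I \<noteq> {}"
  proof -
    obtain S where S: "S \<in> U" using U by blast
    obtain i where "t i S \<noteq> 0" using coords_nz[OF \<psi>PP[OF S]] unfolding t_def by blast
    then have "i \<in> I" using S t0[OF S, of i] unfolding I_def by (cases "i \<le> N") auto
    then show ?thesis by blast
  qed
  moreover have "finite I" unfolding I_def by simp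
  moreover have inv: "t i * u i - 1 \<in> ?Z" if "i \<in> I" for i
    unfolding generic_zero_def mem_Collect_eq
  proof (intro exI[of _ "{S \<in> U. t i S \<noteq> 0}"] conjI ballI)
    show "open_in Y' {S \<in> U. t i S \<noteq> 0}" by (rule open_t)
    show "{S \<in> U. t i S \<noteq> 0} \<noteq> {}" using that by (auto simp: I_def)
  qed (simp add: u_def)
  ultimately obtain A' \<phi>' j where A': "partial_hom ?Z A' \<phi>'" "A \<subseteq> A'" "?Z \<subseteq> A'"
    "\<And>a. a \<in> A \<Longrightarrow> \<phi>' a = \<phi> a" "j \<in> I" and ratio: "\<And>i. i \<in> I \<Longrightarrow> t i * u j \<in> A'"
    using partial_hom_extend_ratios[OF hom(1), of I t u] by metis
  interpret partial_hom ?Z A' \<phi>' by (rule A'(1))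
  have germs: "h \<in> A'" "\<phi>' h = h P" if "h \<in> germ_fns Y' {P}" for h
    using that hom A'(2,4) by auto
  have P': "P \<in> pspaces" using P Y by blast
  have nb: "nbhd Y' {P} Y'" by (rule nbhd_whole[OF irreducible_point[OF P']]) (use P Y in auto)
  have const: "(\<lambda>_. c) \<in> A'" "\<phi>' (\<lambda>_. c) = c" for c
    using germs[OF germ_fns_const[of Y' "{P}" c]] nb by auto
  \<comment> \<open>Affine coordinates of the rational section in the chart \<open>j\<close>. Their
    values \<open>q\<close> under the place are homogeneous coordinates of its centre
    \<open>Q\<close>.\<close>
  define w where "w i = t i * u j" for i
  have w0: "w i \<in> ?Z" if "i \<notin> I" for i
  proof -
    have "t i S = 0" if "S \<in> U" for S using \<open>i \<notin> I\<close> that t0[OF that, of i] unfolding I_def by (cases "i \<le> N") auto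
    then show ?thesis unfolding generic_zero_def w_def using U by (auto intro!: exI[of _ U])
  qed
  have w: "w i \<in> A'" for i using ratio w0 A'(3) by (cases "i \<in> I") (auto simp: w_def)
  define q where "q i = \<phi>' (w i)" for i
  have wj: "w j - 1 \<in> ?Z" unfolding w_def by (rule inv[OF A'(5)])
  have qj: "q j = 1"
    using hom_cong[OF w subring_1[OF A] wj] hom_1 by (simp add: q_def)
  have jN: "j \<le> N" using A'(5) by (simp add: I_def)
  have q0: "q i = 0" if "i > N" for i
    unfolding q_def by (rule hom_Z[OF w w0]) (use that in \<open>simp add: I_def\<close>)
  define Q where "Q = ppoint_of q"
  have QN: "Q \<in> pspace N" and "\<exists>c. c \<noteq> 0 \<and> q = (\<lambda>i. c * coords Q i)"
    using coords_ppoint_of[of q j N] qj q0 by (auto simp: Q_def)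
  then obtain c where c: "c \<noteq> 0" "q = (\<lambda>i. c * coords Q i)" by blast
  have Qp: "Q \<in> pspaces" using QN by blast
  have Fw: "(\<lambda>S. F (\<lambda>i. w i S)) \<in> A'" "\<phi>' (\<lambda>S. F (\<lambda>i. w i S)) = F q" if "hom_poly n d F" for n d F
    using partial_hom_hom_poly[where w=w, OF A'(1) that const w] by (simp_all add: q_def[abs_def])
  have Fq: "F q = c ^ d * F (coords Q)" if "hom_poly n d F" for n d F
    using hom_poly_scale[OF that] c by simp
  define Uj where "Uj = {S \<in> U. t j S \<noteq> 0}"
  have Uj: "open_in Y' Uj" "Uj \<noteq> {}" "Uj \<subseteq> U"
    using open_t[of j] A'(5) by (auto simp: Uj_def I_def)
  have FwS: "F (\<lambda>i. w i S) = u j S ^ d * F (coords (\<psi> S))" if "hom_poly n d F" for n d F S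
    using hom_poly_scale[OF that, of "u j S" "coords (\<psi> S)"] by (simp add: w_def t_def mult.commute)
  have ujS: "u j S \<noteq> 0" if "S \<in> Uj" for S using that by (simp add: Uj_def u_def)
  \<comment> \<open>An equation of \<open>X'\<close> holds along \<open>\<psi>\<close>, so it passes
    to the values under the place.\<close>
  have QX': "Q \<in> X'"
  proof (rule ccontr)
    assume "Q \<notin> X'"
    then obtain n d F where F: "hom_poly n d F" "F (coords Q) \<noteq> 0" "\<And>R. R \<in> X' \<Longrightarrow> F (coords R) = 0"
      using closedin_zariski_sep[OF X'(1) Qp] by metis
    have "(\<lambda>S. F (\<lambda>i. w i S)) \<in> ?Z"
      unfolding generic_zero_def mem_Collect_eq
      by (intro exI[of _ Uj] conjI ballI Uj) (use F(3) \<psi>(1) Uj(3) in \<open>auto simp: FwS[OF F(1)]\<close>)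
    from hom_Z[OF Fw(1)[OF F(1)] this] show False
      using Fw(2)[OF F(1)] Fq[OF F(1)] F(2) c by simp
  qed
  have "\<nu> Q = P"
  proof -
    define P' where "P' = \<nu> Q"
    have Xp: "X \<subseteq> pspaces" using X by blast
    have QX: "Q \<in> X" using QX' X' by blast
    have P'Y: "P' \<in> Y" unfolding P'_def using morphism_in[OF \<nu> Xp QX] .
    then have P'p: "P' \<in> pspaces" using Y by blast
    obtain m where m: "coords P' m \<noteq> 0" using coords_nz[OF P'p] by blast
    obtain k where k: "coords P k \<noteq> 0" using coords_nz[OF P'] by blast
    \<comment> \<open>Affine coordinates around \<open>P\<close> are germs at \<open>P\<close>, so
      the place takes them to their values there.\<close>
    define e where "e i R = coords R i / coords R k" for i and R :: "'k ppoint"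
    have Y'p: "Y' \<subseteq> pspaces" using Y by blast
    have "e i \<in> germ_fns Y' {P}" for i
      unfolding germ_fns_def nbhd_def mem_Collect_eq
      using coord_ratio_regular[OF Y'p, of i k] openin_sub_basic[OF hom_poly_var[of k k]] P k P'
      unfolding e_def[abs_def]
      by (intro exI[of _ "Y' \<inter> basic_open (\<lambda>x. x k)"]) (simp add: basic_open_def)
    note e = germs[OF this]
    have main: "coords P i / coords P k = coords P m / coords P k * (coords P' i / coords P' m)" for i
    proof -
      have reg: "(\<lambda>R. coords R i / coords R m) \<circ> \<nu> \<in> regular_fns X (X \<inter> \<nu> -` (Y \<inter> basic_open (\<lambda>x. x m)))"
        by (rule morphism_regular[OF \<nu> coord_ratio_regular[OF Y(1)]])
      have "Q \<in> X \<inter> \<nu> -` (Y \<inter> basic_open (\<lambda>x. x m))"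
        using QX P'Y P'p m by (simp add: basic_open_def P'_def)
      with reg obtain V n d F G where V: "open_in X V" "Q \<in> V"
        "V \<subseteq> X \<inter> \<nu> -` (Y \<inter> basic_open (\<lambda>x. x m))"
        "hom_poly n d F" "hom_poly n d G" "ratio_on V ((\<lambda>R. coords R i / coords R m) \<circ> \<nu>) F G"
        by (rule regular_local)
      note r = ratio_onD[OF V(6)]
      \<comment> \<open>The expression \<open>F / G\<close> for \<open>\<nu>\<close> is valid only
        on \<open>V\<close>. The factor \<open>H\<close> vanishes on \<open>X\<close> outside
        \<open>V\<close>, so the relation multiplied by it needs no restriction to \<open>V\<close>;
        as \<open>H\<close> is nonzero at \<open>Q\<close>, it cancels once the place is
        applied.\<close>
      obtain n' d' H where H: "hom_poly n' d' H" "H (coords Q) \<noteq> 0" "X \<inter> basic_open H \<subseteq> V"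
        using openin_sub_zariski_basic[OF V(1,2)] by metis
      define Gw Fw' Hw where "Gw = (\<lambda>S. G (\<lambda>i. w i S))" and "Fw' = (\<lambda>S. F (\<lambda>i. w i S))" and "Hw = (\<lambda>S. H (\<lambda>i. w i S))"
      have in_A: "Gw \<in> A'" "Fw' \<in> A'" "Hw \<in> A'" "\<phi>' Gw = G q" "\<phi>' Fw' = F q" "\<phi>' Hw = H q"
        using Fw[OF V(5)] Fw[OF V(4)] Fw[OF H(1)] by (auto simp: Gw_def Fw'_def Hw_def)
      have "e i * Gw * Hw - e m * Fw' * Hw \<in> ?Z"
        unfolding generic_zero_def mem_Collect_eq
      proof (intro exI[of _ "Uj \<inter> (Y' \<inter> basic_open (\<lambda>x. x k))"] conjI ballI)
        have o: "open_in Y' (Y' \<inter> basic_open (\<lambda>x. x k))"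
          by (rule openin_sub_basic[OF hom_poly_var[of k k]]) simp
        have "P \<in> Y' \<inter> basic_open (\<lambda>x. x k)" using P P' k by (simp add: basic_open_def)
        with irreducible_open_inter[OF irr Uj(1) o Uj(2)]
        show "Uj \<inter> (Y' \<inter> basic_open (\<lambda>x. x k)) \<noteq> {}" by blast
        show "open_in Y' (Uj \<inter> (Y' \<inter> basic_open (\<lambda>x. x k)))" using o Uj(1) by blast
        fix S assume S: "S \<in> Uj \<inter> (Y' \<inter> basic_open (\<lambda>x. x k))"
        then have SU: "S \<in> U" and u: "u j S \<noteq> 0" and Sk: "coords S k \<noteq> 0"
          using Uj(3) ujS by (auto simp: basic_open_def)
        have HwS: "Hw S = u j S ^ d' * H (coords (\<psi> S))" and GwS: "Gw S = u j S ^ d * G (coords (\<psi> S))"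
          and FwS': "Fw' S = u j S ^ d * F (coords (\<psi> S))"
          using FwS[OF H(1)] FwS[OF V(5)] FwS[OF V(4)] by (simp_all add: Hw_def Gw_def Fw'_def)
        show "(e i * Gw * Hw - e m * Fw' * Hw) S = 0"
        proof (cases "H (coords (\<psi> S)) = 0")
          case True then show ?thesis by (simp add: HwS)
        next
          case False
          have "\<psi> S \<in> X" using \<psi>(1)[OF SU] X' by blast
          with False \<psi>PP[OF SU] have V': "\<psi> S \<in> V" using H(3) by (auto simp: basic_open_def)
          have "\<nu> (\<psi> S) \<in> basic_open (\<lambda>x. x m)" using V' V(3) by blast
          then have Sm: "coords S m \<noteq> 0" using \<psi>(2)[OF SU] by (simp add: basic_open_def)
          have "coords S i / coords S m = F (coords (\<psi> S)) / G (coords (\<psi> S))"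
            using r(2)[OF V'] \<psi>(2)[OF SU] by simp
          then have "coords S i * G (coords (\<psi> S)) = coords S m * F (coords (\<psi> S))"
            using r(1)[OF V'] Sm by (simp add: field_simps)
          then have "e i S * Gw S = e m S * Fw' S"
            unfolding e_def GwS FwS' using Sk by (simp add: field_simps)
          then show ?thesis by simp
        qed
      qed
      moreover have "e i * Gw * Hw \<in> A'" "e m * Fw' * Hw \<in> A'"
        using e(1) in_A by (auto intro!: subring_mult[OF A])
      ultimately have "\<phi>' (e i * Gw * Hw) = \<phi>' (e m * Fw' * Hw)" by (intro hom_cong)
      then have "e i P * G q * H q = e m P * F q * H q"
        using e in_A by (simp add: hom_mult subring_mult[OF A])
      moreover have "H q \<noteq> 0" using Fq[OF H(1)] H(2) c by simp
      ultimately have "e i P * G q = e m P * F q" by simp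
      moreover have Gq: "F q / G q = coords P' i / coords P' m" "G q \<noteq> 0"
        using r[OF V(2)] c(1) unfolding Fq[OF V(4)] Fq[OF V(5)] by (simp_all add: P'_def)
      then have "F q = coords P' i / coords P' m * G q" by (simp add: field_simps)
      ultimately have "(e i P - e m P * (coords P' i / coords P' m)) * G q = 0"
        by (simp add: algebra_simps)
      with \<open>G q \<noteq> 0\<close> have "e i P = e m P * (coords P' i / coords P' m)" by simp
      then show ?thesis by (simp add: e_def)
    qed
    from main[of k] k have Pm: "coords P m \<noteq> 0" by auto
    have pr: "coords P i = (coords P m / coords P' m) * coords P' i" for i
      using main[of i] k m by (simp add: field_simps)
    have "coords P m / coords P' m \<noteq> 0" using Pm m by simp
    from ppoint_eqI[OF P' P'p this pr] have "P = P'" .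
    then show ?thesis by (simp add: P'_def)
  qed
  have weq: "w i = (\<lambda>S. coords (\<psi> S) i / coords (\<psi> S) j)" for i
    by (auto simp: w_def t_def u_def fun_eq_iff divide_inverse)
  show ?thesis
  proof (rule that[of A' \<phi>' j q, OF A'(1-4) jN qj q0])
    show "ppoint_of q \<in> X'" "\<nu> (ppoint_of q) = P" using QX' \<open>\<nu> Q = P\<close> by (auto simp: Q_def)
    show "(\<lambda>S. coords (\<psi> S) i / coords (\<psi> S) j) \<in> A'" "\<phi>' (\<lambda>S. coords (\<psi> S) i / coords (\<psi> S) j) = q i" for i
      using w[of i] by (auto simp: weq[symmetric] q_def)
    show "\<exists>S\<in>U. coords (\<psi> S) j \<noteq> 0" using A'(5) by (auto simp: I_def t_def)
  qed auto
qed

section \<open>The basis theorem and finite fibres\<close>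

definition combinations :: "'a::comm_ring_1 set \<Rightarrow> (nat \<Rightarrow> 'a) \<Rightarrow> nat \<Rightarrow> 'a set" where
  "combinations B b n = {\<Sum>i<n. c i * b i | c. \<forall>i<n. c i \<in> B}"

text \<open>The ascending chain condition in sequence form: no sequence escapes forever the ideals
  spanned by its predecessors. Both the basis theorem and the descent of closed sets need precisely
  such a dependence.\<close>

definition noetherian_subring :: "'a::comm_ring_1 set \<Rightarrow> bool" where
  "noetherian_subring A \<longleftrightarrow>
     subring A \<and> (\<forall>a. (\<forall>i. a i \<in> A) \<longrightarrow> (\<exists>n. a n \<in> combinations A a n))"

lemma combinationsI: "\<forall>i<n. c i \<in> B \<Longrightarrow> x = (\<Sum>i<n. c i * b i) \<Longrightarrow> x \<in> combinations B b n"
  unfolding combinations_def by blast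

lemma combinations_diff:
  assumes "subring B" "x \<in> combinations B b n" "y \<in> combinations B b n" shows "x - y \<in> combinations B b n"
proof -
  obtain c c' where "\<forall>i<n. c i \<in> B" "x = (\<Sum>i<n. c i * b i)" "\<forall>i<n. c' i \<in> B" "y = (\<Sum>i<n. c' i * b i)"
    using assms unfolding combinations_def by blast
  then have "\<forall>i<n. c i - c' i \<in> B" "x - y = (\<Sum>i<n. (c i - c' i) * b i)"
    using subring_diff[OF assms(1)] by (auto simp: sum_subtractf algebra_simps)
  then show ?thesis by (rule combinationsI)
qed

lemma combinations_mult:
  assumes "subring B" "x \<in> combinations B b n" "y \<in> B" shows "y * x \<in> combinations B b n"
proof -
  obtain c where "\<forall>i<n. c i \<in> B" "x = (\<Sum>i<n. c i * b i)"
    using assms unfolding combinations_def by blast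
  then have "\<forall>i<n. y * c i \<in> B" "y * x = (\<Sum>i<n. (y * c i) * b i)"
    using subring_mult[OF assms(1)] assms(3) by (auto simp: sum_distrib_left mult.assoc)
  then show ?thesis by (rule combinationsI)
qed

lemma combinations_0: "subring B \<Longrightarrow> 0 \<in> combinations B b n"
  unfolding combinations_def using subring_0 by (auto intro!: exI[of _ "\<lambda>_. 0"])

lemma combinations_add:
  assumes "subring B" "x \<in> combinations B b n" "y \<in> combinations B b n" shows "x + y \<in> combinations B b n"
  using combinations_diff[OF assms(1,2) combinations_diff[OF assms(1) combinations_0[OF assms(1)] assms(3)]] by simp

lemma combinations_sum:
  "subring B \<Longrightarrow> (\<And>i. i \<in> I \<Longrightarrow> g i \<in> combinations B b n) \<Longrightarrow> sum g I \<in> combinations B b n"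
  by (induction I rule: infinite_finite_induct) (auto intro: combinations_0 combinations_add)

lemma combinations_mono:
  assumes "subring B" "n \<le> m" shows "combinations B b n \<subseteq> combinations B b m"
proof
  fix x assume "x \<in> combinations B b n"
  then obtain c where c: "\<forall>i<n. c i \<in> B" "x = (\<Sum>i<n. c i * b i)" unfolding combinations_def by blast
  have "x = (\<Sum>i<m. (if i < n then c i else 0) * b i)"
    unfolding c by (rule sum.mono_neutral_cong_left) (use assms in auto)
  then show "x \<in> combinations B b m" unfolding combinations_def using c subring_0[OF assms(1)]
    by (intro CollectI exI[of _ "\<lambda>i. if i < n then c i else 0"]) auto
qed

lemma combinations_gen:
  assumes "subring B" "i < n" shows "b i \<in> combinations B b n"
proof -
  have "b i = (\<Sum>k<n. (if k = i then 1 else 0) * b k)" using assms by (simp add: if_distrib[of "\<lambda>x. x * _"] cong: if_cong)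
  then show ?thesis unfolding combinations_def using subring_0[OF assms(1)] subring_1[OF assms(1)]
    by (intro CollectI exI[of _ "\<lambda>k. if k = i then 1 else 0"]) auto
qed

text \<open>Hilbert's basis theorem for \<open>A[x]\<close>. As \<open>x\<close> may be algebraic
  over \<open>A\<close>, an element can have several polynomial representatives; least degrees are
  taken over all of them.\<close>

lemma noetherian_adjoin:
  fixes A :: "'a::comm_ring_1 set"
  assumes A: "noetherian_subring A" shows "noetherian_subring {poly p x | p. coeffs_in A p}"
proof -
  have sA: "subring A" using A by (simp add: noetherian_subring_def)
  define B where "B = {poly p x | p. coeffs_in A p}"
  have B: "subring B" unfolding subring_def
  proof (intro conjI ballI)
    show "1 \<in> B" unfolding B_def using coeffs_in_1[OF sA] by (metis (mono_tags, lifting) mem_Collect_eq poly_1)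
    fix a b assume "a \<in> B" "b \<in> B"
    then obtain p q where "a = poly p x" "b = poly q x" "coeffs_in A p" "coeffs_in A q" unfolding B_def by blast
    then show "a - b \<in> B" "a * b \<in> B" unfolding B_def
      using coeffs_in_diff[OF sA, of p q] coeffs_in_mult[OF sA, of p q] by (metis (mono_tags, lifting) mem_Collect_eq poly_diff poly_mult)+
  qed
  have "\<exists>n. b n \<in> combinations B b n" if b: "\<forall>i. b i \<in> B" for b
  proof (rule ccontr)
    assume none: "\<not> (\<exists>n. b n \<in> combinations B b n)"
    define J where "J = (\<Union>n. combinations B b n)"
    have J_diff: "y - z \<in> J" if "y \<in> J" "z \<in> J" for y z
    proof -
      from that obtain n m where "y \<in> combinations B b n" "z \<in> combinations B b m" unfolding J_def by blast
      then have "y \<in> combinations B b (max n m)" "z \<in> combinations B b (max n m)"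
        using combinations_mono[OF B, of n "max n m" b] combinations_mono[OF B, of m "max n m" b] by auto
      from combinations_diff[OF B this] show ?thesis unfolding J_def by blast
    qed
    define Sp where "Sp f k = combinations B (\<lambda>i. poly (f i) x) k" for f :: "nat \<Rightarrow> 'a poly" and k
    define C where "C f k r \<longleftrightarrow> coeffs_in A r \<and> poly r x \<in> J \<and> poly r x \<notin> Sp f k" for f k r
    define Pr where "Pr f k r \<longleftrightarrow> C f k r \<and> (\<forall>r'. C f k r' \<longrightarrow> degree r \<le> degree r')" for f k r
    \<comment> \<open>\<open>f k\<close> represents an element of the ideal \<open>J\<close> outside
      the span of the earlier ones, with least possible degree. That span depends on
      \<open>f\<close> only below \<open>k\<close>, as a recursive choice requires.\<close>
    have "\<exists>f. \<forall>k. Pr f k (f k)"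
    proof (rule dependent_wf_choice[OF wf_less_than])
      fix f g :: "nat \<Rightarrow> 'a poly" and k r assume "\<And>z. (z, k) \<in> less_than \<Longrightarrow> f z = g z"
      then have "Sp f k = Sp g k" unfolding Sp_def combinations_def by simp
      then show "Pr f k r = Pr g k r" unfolding Pr_def C_def by simp
    next
      fix k f assume "\<And>y. (y, k) \<in> less_than \<Longrightarrow> Pr f y (f y)"
      then have fJ: "poly (f i) x \<in> J" if "i < k" for i using that by (auto simp: Pr_def C_def)
      have "\<exists>M. \<forall>i<k. poly (f i) x \<in> combinations B b M"
        using fJ
      proof (induction k)
        case (Suc k)
        then obtain M where M: "\<forall>i<k. poly (f i) x \<in> combinations B b M" by auto
        obtain M' where M': "poly (f k) x \<in> combinations B b M'" using Suc.prems[of k] unfolding J_def by auto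
        have "poly (f i) x \<in> combinations B b (max M M')" if "i < Suc k" for i
          using that M M' combinations_mono[OF B, of M "max M M'" b] combinations_mono[OF B, of M' "max M M'" b]
          by (cases "i = k") auto
        then show ?case by blast
      qed simp
      then obtain M where M: "\<forall>i<k. poly (f i) x \<in> combinations B b M" by blast
      have "Sp f k \<subseteq> combinations B b M"
        unfolding Sp_def combinations_def[of B "\<lambda>i. poly (f i) x"] using M by (auto intro!: combinations_sum[OF B] combinations_mult[OF B])
      \<comment> \<open>The earlier values lie in the span of finitely many \<open>b i\<close>, so
        the counterexample sequence itself supplies an element outside their span.\<close>
      then have "b M \<notin> Sp f k" using none by blast
      moreover have "b M \<in> J" unfolding J_def using combinations_gen[OF B, of M "Suc M" b] by blast
      moreover obtain r where "coeffs_in A r" "b M = poly r x" using b unfolding B_def by blast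
      ultimately have "C f k r" unfolding C_def by simp
      then show "\<exists>r. Pr f k r" unfolding Pr_def
        using ex_has_least_nat[of "C f k" r degree] by blast
    qed
    then obtain p where p: "\<And>k. Pr p k (p k)" by blast
    have pC: "C p k (p k)" and pmin: "C p k r \<Longrightarrow> degree (p k) \<le> degree r" for k r
      using p[of k] by (auto simp: Pr_def)
    have "\<forall>k. lead_coeff (p k) \<in> A" using pC by (auto simp: C_def coeffs_in_def)
    then obtain n where "lead_coeff (p n) \<in> combinations A (\<lambda>k. lead_coeff (p k)) n"
      using conjunct2[OF A[unfolded noetherian_subring_def], THEN spec, of "\<lambda>k. lead_coeff (p k)"] by blast
    then obtain c where c: "\<forall>i<n. c i \<in> A" "lead_coeff (p n) = (\<Sum>i<n. c i * lead_coeff (p i))"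
      unfolding combinations_def by blast
    have deg: "degree (p i) \<le> degree (p n)" if "i < n" for i
    proof (rule pmin)
      have "Sp p i \<subseteq> Sp p n" unfolding Sp_def using combinations_mono[OF B] that by simp
      then show "C p i (p n)" using pC[of n] by (auto simp: C_def)
    qed
    \<comment> \<open>Each \<open>p i\<close> is shifted up to the degree of \<open>p n\<close>, so
      that \<open>s\<close> and \<open>p n\<close> have the same coefficient there.\<close>
    define s where "s = (\<Sum>i<n. monom (c i) (degree (p n) - degree (p i)) * p i)"
    define r where "r = p n - s"
    have "coeffs_in A s" unfolding s_def
      using c pC by (intro coeffs_in_sum[OF sA] coeffs_in_mult[OF sA] coeffs_in_monom[OF sA]) (auto simp: C_def)
    moreover have sSp: "poly s x \<in> Sp p n"
    proof -
      have "poly (monom (c i) (degree (p n) - degree (p i))) x \<in> B" if "i < n" for i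
        unfolding B_def using coeffs_in_monom[OF sA] c that by blast
      then show ?thesis unfolding s_def Sp_def poly_sum poly_mult combinations_def
        by (intro CollectI exI[of _ "\<lambda>i. poly (monom (c i) (degree (p n) - degree (p i))) x"]) simp
    qed
    moreover have "poly s x \<in> J"
    proof -
      have "0 \<in> J" unfolding J_def using combinations_0[OF B] by blast
      have J_add: "y + z \<in> J" if "y \<in> J" "z \<in> J" for y z
        using J_diff[OF that(1) J_diff[OF \<open>0 \<in> J\<close> that(2)]] by simp
      have "(\<Sum>i\<in>K. poly (monom (c i) (degree (p n) - degree (p i)) * p i) x) \<in> J" if "K \<subseteq> {..<n}" for K
        using that
      proof (induction K rule: infinite_finite_induct)
        case (insert i K)
        obtain m where "poly (p i) x \<in> combinations B b m" using pC[of i] unfolding C_def J_def by blast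
        moreover have "poly (monom (c i) (degree (p n) - degree (p i))) x \<in> B"
          unfolding B_def using coeffs_in_monom[OF sA] c insert.prems by blast
        ultimately have "poly (monom (c i) (degree (p n) - degree (p i)) * p i) x \<in> J"
          unfolding J_def poly_mult using combinations_mult[OF B] by blast
        then show ?case using insert J_add by simp
      qed (auto simp: \<open>0 \<in> J\<close>)
      then show ?thesis unfolding s_def poly_sum by blast
    qed
    moreover have "poly r x \<notin> Sp p n"
    proof
      assume "poly r x \<in> Sp p n"
      then have "poly r x + poly s x \<in> Sp p n" using combinations_add[OF B] sSp unfolding Sp_def by blast
      then show False using pC[of n] by (simp add: r_def C_def)
    qed
    ultimately have "C p n r" unfolding C_def
      using pC[of n] coeffs_in_diff[OF sA] J_diff by (auto simp: r_def C_def)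
    then have "degree (p n) \<le> degree r" by (rule pmin)
    moreover have cs: "coeff s k = (\<Sum>i<n. if k < degree (p n) - degree (p i) then 0 else c i * coeff (p i) (k - (degree (p n) - degree (p i))))" for k
      unfolding s_def coeff_sum by (rule sum.cong) (auto simp: coeff_monom_mult)
    have "coeff s (degree (p n)) = lead_coeff (p n)"
      unfolding cs c(2) using deg by (intro sum.cong) auto
    then have "coeff r (degree (p n)) = 0" by (simp add: r_def)
    moreover have "coeff r k = 0" if "k > degree (p n)" for k
    proof -
      have "coeff (p i) (k - (degree (p n) - degree (p i))) = 0" if "i < n" for i
        using deg[OF that] \<open>k > degree (p n)\<close> by (intro coeff_eq_0) auto
      then have "coeff s k = 0" unfolding cs by (intro sum.neutral) auto
      then show ?thesis using that by (simp add: r_def coeff_eq_0)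
    qed
    \<comment> \<open>The coefficients of \<open>r\<close> vanish from the degree of
      \<open>p n\<close> on, while \<open>r\<close> has at least that degree. So \<open>r\<close> is
      0, and its value lies in every span, contrary to \<open>C p n r\<close>.\<close>
    ultimately have "lead_coeff r = 0" by (metis le_neq_implies_less)
    then show False using \<open>C p n r\<close> combinations_0[OF B] by (simp add: C_def Sp_def)
  qed
  then show ?thesis unfolding noetherian_subring_def B_def[symmetric] using B by blast
qed

text \<open>Polynomial functions in the coordinates with index below \<open>n\<close>, adjoined one
  at a time to match \<open>noetherian_adjoin\<close>. Functions suffice in place of formal
  polynomials because dependences are only evaluated at points.\<close>

primrec coord_ring :: "nat \<Rightarrow> ((nat \<Rightarrow> 'k::field) \<Rightarrow> 'k) set" where
  "coord_ring 0 = {(\<lambda>_. c) | c. True}"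
| "coord_ring (Suc n) = {poly p (\<lambda>x. x n) | p. coeffs_in (coord_ring n) p}"

lemma noetherian_coord_ring: "noetherian_subring (coord_ring n :: ((nat \<Rightarrow> 'k::field) \<Rightarrow> 'k) set)"
proof (induction n)
  case 0
  have sub: "subring (coord_ring 0 :: ((nat \<Rightarrow> 'k) \<Rightarrow> 'k) set)"
    unfolding subring_def by (auto simp: one_fun_def fun_diff_def times_fun_def)
  have "\<exists>n. a n \<in> combinations (coord_ring 0) a n" if "\<forall>i. a i \<in> coord_ring 0" for a :: "nat \<Rightarrow> (nat \<Rightarrow> 'k) \<Rightarrow> 'k"
  proof -
    define d where "d i = a i (\<lambda>_. 0)" for i
    have d: "a i = (\<lambda>_. d i)" for i
      using that[rule_format, of i] by (auto simp: d_def)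
    \<comment> \<open>The constants form a field: the term of index 0 is zero and needs no
      generator, or it is a unit and the term of index 1 is a multiple of it.\<close>
    show ?thesis
    proof (cases "d 0 = 0")
      case True
      then have "a 0 = 0" unfolding d by (simp add: zero_fun_def)
      then show ?thesis using combinations_0[OF sub] by metis
    next
      case False
      have "a 1 = (\<lambda>_. d 1 / d 0) * a 0" unfolding d using False by (auto simp: fun_eq_iff)
      moreover have "(\<lambda>_. d 1 / d 0) * a 0 \<in> combinations (coord_ring 0) a 1"
        by (intro combinations_mult combinations_gen sub) auto
      ultimately show ?thesis by metis
    qed
  qed
  then show ?case unfolding noetherian_subring_def using sub by blast
qed (simp add: noetherian_adjoin)

lemma coord_ring_subring: "subring (coord_ring n :: ((nat \<Rightarrow> 'k::field) \<Rightarrow> 'k) set)"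
  by (rule conjunct1[OF noetherian_coord_ring[unfolded noetherian_subring_def]])

lemma coord_ring_mono: "coord_ring n \<subseteq> coord_ring (Suc n)"
proof
  fix a assume "a \<in> coord_ring n"
  then have "coeffs_in (coord_ring n) [:a:]" "a = poly [:a:] (\<lambda>x. x n)"
    using coeffs_in_const[OF coord_ring_subring] by auto
  then show "a \<in> coord_ring (Suc n)" unfolding coord_ring.simps by blast
qed

lemma coord_ring_const: "(\<lambda>_. c) \<in> coord_ring n"
  by (induction n) (use coord_ring_mono in auto)

lemma coord_ring_var: "i < n \<Longrightarrow> (\<lambda>x. x i :: 'k::field) \<in> coord_ring n"
proof (induction n)
  case (Suc n)
  show ?case
  proof (cases "i = n")
    case True
    have "coeffs_in (coord_ring n) [:0, 1 :: (nat \<Rightarrow> 'k) \<Rightarrow> 'k:]"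
      using coeffs_in_pCons[OF coord_ring_subring subring_0[OF coord_ring_subring] coeffs_in_1[OF coord_ring_subring]]
      by (simp add: one_pCons)
    moreover have "(\<lambda>x. x n :: 'k) = poly [:0, 1:] (\<lambda>x. x n)" by simp
    ultimately show ?thesis unfolding coord_ring.simps True by blast
  next
    case False then show ?thesis using Suc coord_ring_mono by auto
  qed
qed simp

text \<open>For each \<open>i\<close> a form is chosen that vanishes on \<open>C (Suc i)\<close> but
  not at a point \<open>P i\<close> of \<open>C i\<close>. A dependence of the form of index
  \<open>m\<close> on its predecessors fails at \<open>P m\<close>, where all predecessors
  vanish.\<close>

lemma closed_dcc:
  fixes C :: "nat \<Rightarrow> 'k::field ppoint set"
  assumes C: "\<And>i. closedin zariski (C i)" "\<And>i. C i \<subseteq> pspace N" "\<And>i. C (Suc i) \<subset> C i"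
  shows False
proof -
  have mono: "j \<ge> i \<Longrightarrow> C j \<subseteq> C i" for i j
    by (rule lift_Suc_antimono_le[of C]) (use C(3) in blast)
  have "\<exists>P n d F. P \<in> C i \<and> hom_poly n d F \<and> F (coords P) \<noteq> 0 \<and> (\<forall>Q\<in>C (Suc i). F (coords Q) = 0)" for i
  proof -
    obtain P where P: "P \<in> C i" "P \<notin> C (Suc i)" using C(3) by blast
    then have "P \<in> pspaces" using C(2) by blast
    from closedin_zariski_sep[OF C(1) this P(2)] show ?thesis using P(1) by metis
  qed
  then obtain P n d F where F: "\<And>i. P i \<in> C i" "\<And>i. hom_poly (n i) (d i) (F i)" "\<And>i. F i (coords (P i)) \<noteq> 0"
    "\<And>i Q. Q \<in> C (Suc i) \<Longrightarrow> F i (coords Q) = 0" by metis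
  \<comment> \<open>The number of variables of the separating forms is not bounded in
    \<open>i\<close>. Setting the variables beyond \<open>N\<close> to 0 keeps the values on
    \<open>pspace N\<close> and puts all forms into one noetherian ring.\<close>
  define F' where "F' i x = F i (\<lambda>k. if k \<le> N then x k else 0)" for i x
  have F': "F' i (coords Q) = F i (coords Q)" if "Q \<in> C j" for i j Q
  proof -
    have "Q \<in> pspace N" using that C(2) by blast
    then have "(\<lambda>k. if k \<le> N then coords Q k else 0) = coords Q"
      using pspace_coords[OF \<open>Q \<in> pspace N\<close>] by (auto simp: fun_eq_iff)
    then show ?thesis by (simp add: F'_def)
  qed
  have "F' i \<in> coord_ring (Suc N)" for i
  proof -
    have v: "(\<lambda>x. if k \<le> N then x k else 0) \<in> coord_ring (Suc N)" for k
      using coord_ring_var[of k "Suc N"] coord_ring_const[of 0 "Suc N"] by (cases "k \<le> N") auto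
    show ?thesis unfolding F'_def[abs_def]
      by (rule hom_poly_in_subring[OF F(2) coord_ring_subring coord_ring_const v])
  qed
  then obtain m where "F' m \<in> combinations (coord_ring (Suc N)) F' m"
    using noetherian_coord_ring[of "Suc N"] unfolding noetherian_subring_def by blast
  then obtain c where c: "F' m = (\<Sum>i<m. c i * F' i)" unfolding combinations_def by blast
  have "F' i (coords (P m)) = 0" if "i < m" for i
    using F'[OF F(1)] F(4)[of "P m" i] F(1)[of m] mono[of "Suc i" m] that by auto
  then have "F' m (coords (P m)) = 0" unfolding c by (simp add: fun_sum_apply)
  then show False using F'[OF F(1)] F(3) by simp
qed

text \<open>Noetherian induction along \<open>closed_dcc\<close>: a closed set that is neither empty
  nor irreducible splits into two strictly smaller ones.\<close>

lemma closed_finite_irreducible: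
  fixes B :: "'k::field ppoint set"
  assumes "closedin zariski B" "B \<subseteq> pspace N"
  obtains \<Z> where "finite \<Z>" "B = \<Union>\<Z>" "\<And>Z. Z \<in> \<Z> \<Longrightarrow> closedin zariski Z \<and> irreducible_set zariski Z"
proof -
  define R where "R = {(C :: 'k ppoint set, B). closedin zariski C \<and> C \<subseteq> pspace N \<and>
    closedin zariski B \<and> B \<subseteq> pspace N \<and> C \<subset> B}"
  have wf: "wf R" unfolding wf_iff_no_infinite_down_chain
  proof
    assume "\<exists>f. \<forall>i. (f (Suc i), f i) \<in> R"
    then obtain f where f: "\<And>i. (f (Suc i), f i) \<in> R" by blast
    show False by (rule closed_dcc[of f N]) (use f in \<open>auto simp: R_def\<close>)
  qed
  have "closedin zariski B \<longrightarrow> B \<subseteq> pspace N \<longrightarrow> (\<exists>\<Z>. finite \<Z> \<and> B = \<Union>\<Z> \<and> (\<forall>Z\<in>\<Z>. closedin zariski Z \<and> irreducible_set zariski Z))"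
    using wf
  proof (induction B rule: wf_induct_rule)
    case (less B)
    show ?case
    proof (intro impI)
      assume B: "closedin zariski B" "B \<subseteq> pspace N"
      show "\<exists>\<Z>. finite \<Z> \<and> B = \<Union>\<Z> \<and> (\<forall>Z\<in>\<Z>. closedin zariski Z \<and> irreducible_set zariski Z)"
      proof (cases "B = {} \<or> irreducible_set zariski B")
        case True
        then show ?thesis
        proof
          assume "B = {}" then show ?thesis by (intro exI[of _ "{}"]) auto
        next
          assume "irreducible_set zariski B" then show ?thesis using B by (intro exI[of _ "{B}"]) auto
        qed
      next
        case False
        then obtain A1 A2 where A: "closedin zariski A1" "closedin zariski A2" "B \<subseteq> A1 \<union> A2" "\<not> B \<subseteq> A1" "\<not> B \<subseteq> A2"
          using closedin_subset[OF B(1)] unfolding irreducible_set_def by blast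
        have "(B \<inter> A1, B) \<in> R" "(B \<inter> A2, B) \<in> R" using A B unfolding R_def by (auto intro: closedin_Int)
        then obtain \<Z>1 \<Z>2 where "finite \<Z>1" "B \<inter> A1 = \<Union>\<Z>1" "\<forall>Z\<in>\<Z>1. closedin zariski Z \<and> irreducible_set zariski Z"
          "finite \<Z>2" "B \<inter> A2 = \<Union>\<Z>2" "\<forall>Z\<in>\<Z>2. closedin zariski Z \<and> irreducible_set zariski Z"
          using less.IH unfolding R_def by simp metis
        moreover have "B = (B \<inter> A1) \<union> (B \<inter> A2)" using A by auto
        ultimately show ?thesis by (intro exI[of _ "\<Z>1 \<union> \<Z>2"]) auto
      qed
    qed
  qed
  then show ?thesis using assms that by blast
qed

section \<open>Curves on surfaces\<close>

lemma projective_surfaceD: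
  assumes "projective_surface X"
  shows "\<exists>N. X \<subseteq> pspace N" "closedin zariski X" "irreducible_set zariski X" "X \<subseteq> pspaces"
  using assms unfolding projective_surface_def projective_variety_def by blast+

lemma surface_no_chain:
  assumes X: "projective_surface X"
    and Z: "irreducible_set zariski Z0" "irreducible_set zariski Z1" "irreducible_set zariski Z2"
      "closedin zariski Z0" "closedin zariski Z1" "closedin zariski Z2"
      "Z0 \<subset> Z1" "Z1 \<subset> Z2" "Z2 \<subset> X"
  shows False
proof -
  have "irreducible_chain X 3 (\<lambda>i. [Z0, Z1, Z2, X] ! i)"
    unfolding irreducible_chain_def closedin_closed_subtopology[OF projective_surfaceD(2)[OF X]]
    using projective_surfaceD[OF X] Z by (auto simp: numeral_eq_Suc less_Suc_eq le_Suc_eq)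
  then show False using X unfolding projective_surface_def has_dim_def by (auto simp: numeral_eq_Suc)
qed

text \<open>Two points make \<open>{P}\<close> and \<open>D\<close> a chain of length 1. A chain of
  length 2 inside \<open>D\<close> would be prolonged by \<open>X\<close> to one of length
  3.\<close>

lemma prime_divisorI:
  assumes X: "projective_surface X" and D: "closedin zariski D" "irreducible_set zariski D" "D \<subset> X"
    and PQ: "P \<in> D" "Q \<in> D" "P \<noteq> Q"
  shows "prime_divisor X D"
proof -
  have Pp: "P \<in> pspaces" using PQ D projective_surfaceD(4)[OF X] by blast
  have "irreducible_chain D 1 (\<lambda>i. if i = 0 then {P} else D)"
    unfolding irreducible_chain_def closedin_closed_subtopology[OF D(1)]
    using D PQ closedin_point[OF Pp] irreducible_point[OF Pp] by auto
  moreover have "\<not> irreducible_chain D (Suc 1) Z" for Z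
  proof
    assume Z: "irreducible_chain D (Suc 1) Z"
    have *: "closedin zariski (Z i)" "Z i \<subseteq> D" "irreducible_set zariski (Z i)" if "i \<le> 2" for i
      using Z that unfolding irreducible_chain_def closedin_closed_subtopology[OF D(1)]
      by (auto simp: numeral_eq_Suc)
    have "Z 0 \<subset> Z 1" "Z 1 \<subset> Z 2" using Z unfolding irreducible_chain_def by (auto simp: numeral_eq_Suc)
    with *[of 0] *[of 1] *[of 2] D(3) show False using surface_no_chain[OF X, of "Z 0" "Z 1" "Z 2"] by auto
  qed
  moreover have "\<exists>n. D \<subseteq> pspace n" using D(3) projective_surfaceD(1)[OF X] by blast
  ultimately show ?thesis
    unfolding prime_divisor_def projective_curve_def projective_variety_def has_dim_def using D by auto
qed

lemma prime_divisorD: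
  assumes X: "projective_surface X" and D: "prime_divisor X D"
  shows "closedin zariski D" "irreducible_set zariski D" "D \<subset> X" "infinite D"
proof -
  show cl: "closedin zariski D" and irr: "irreducible_set zariski D"
    using D unfolding prime_divisor_def projective_curve_def projective_variety_def by auto
  have "D \<noteq> X"
    using X D unfolding projective_surface_def prime_divisor_def projective_curve_def has_dim_def
    by (auto simp: numeral_eq_Suc)
  then show "D \<subset> X" using D by (auto simp: prime_divisor_def)
  obtain Z where "irreducible_chain D 1 Z" using D unfolding prime_divisor_def projective_curve_def has_dim_def by auto
  then have Z: "Z 0 \<subset> Z 1" "Z 1 \<subseteq> D" "irreducible_set zariski (Z 0)"
    unfolding irreducible_chain_def closedin_closed_subtopology[OF cl] by auto
  show "infinite D"
  proof
    assume "finite D"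
    then obtain P where "D = {P}" using finite_irreducible_point[OF irr] by blast
    with Z(1,2) have "Z 0 = {}" by blast
    then show False using Z(3) by (simp add: irreducible_set_def)
  qed
qed

lemma infinite_two_points: "infinite D \<Longrightarrow> \<exists>P\<in>D. \<exists>Q\<in>D. P \<noteq> Q"
  by (metis finite.emptyI infinite_imp_nonempty finite_insert finite_subset insertI1 insert_iff subsetI ex_in_conv)

lemma closed_finite_if_no_curve:
  assumes C: "closedin zariski C" "C \<subseteq> pspace N"
    and no: "\<And>W P. closedin zariski W \<Longrightarrow> irreducible_set zariski W \<Longrightarrow> {P} \<subset> W \<Longrightarrow> W \<subseteq> C \<Longrightarrow> False"
  shows "finite C"
proof -
  obtain \<Z> where \<Z>: "finite \<Z>" "C = \<Union>\<Z>" "\<And>Z. Z \<in> \<Z> \<Longrightarrow> closedin zariski Z \<and> irreducible_set zariski Z"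
    using closed_finite_irreducible[OF C] by metis
  have "finite W" if W: "W \<in> \<Z>" for W
  proof -
    obtain P where P: "P \<in> W" using \<Z>(3)[OF W] unfolding irreducible_set_def by blast
    have "W = {P}" using no[of W P] \<Z>(2) \<Z>(3)[OF W] W P by blast
    then show ?thesis by simp
  qed
  then show ?thesis using \<Z> by auto
qed

text \<open>A component \<open>Z\<close> of \<open>B\<close> not contained in the fibre over
  \<open>P\<close> meets it in finitely many points: an irreducible closed set with more than one
  point in the intersection gives a chain of length 3 through \<open>Z\<close> up to
  \<open>X\<close>. Each of the finitely many components lies in at most one fibre, and
  \<open>D\<close> is infinite.\<close>

lemma finite_fibre:
  assumes X: "projective_surface X" and B: "closedin zariski B" "B \<subset> X"
    and fib: "\<And>P. P \<in> D \<Longrightarrow> closedin zariski (X \<inter> \<nu> -` {P})" and D: "infinite D"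
  shows "\<exists>P\<in>D. finite (B \<inter> \<nu> -` {P})"
proof -
  obtain N where N: "X \<subseteq> pspace N" using projective_surfaceD[OF X] by blast
  then have BN: "B \<subseteq> pspace N" using B by blast
  obtain \<Z> where \<Z>: "finite \<Z>" "B = \<Union>\<Z>" "\<And>Z. Z \<in> \<Z> \<Longrightarrow> closedin zariski Z \<and> irreducible_set zariski Z"
    using closed_finite_irreducible[OF B(1) BN] by metis
  have fin: "finite (Z \<inter> \<nu> -` {P})" if Z: "Z \<in> \<Z>" and P: "P \<in> D" and "\<not> Z \<subseteq> \<nu> -` {P}" for Z P
  proof (rule closed_finite_if_no_curve)
    have ZX: "Z \<subset> X" using Z \<Z>(2) B(2) by blast
    then have eq: "Z \<inter> \<nu> -` {P} = Z \<inter> (X \<inter> \<nu> -` {P})" by blast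
    show "closedin zariski (Z \<inter> \<nu> -` {P})" unfolding eq
      using \<Z>(3)[OF Z] fib[OF P] by (blast intro: closedin_Int)
    show "Z \<inter> \<nu> -` {P} \<subseteq> pspace N" using ZX N by blast
    fix W Q assume W: "closedin zariski W" "irreducible_set zariski W" "{Q} \<subset> W" "W \<subseteq> Z \<inter> \<nu> -` {P}"
    have "W \<subset> Z" using W(4) that(3) by blast
    have Qp: "Q \<in> pspaces" using W(3,4) ZX N by blast
    show False
      by (rule surface_no_chain[OF X irreducible_point[OF Qp] W(2) conjunct2[OF \<Z>(3)[OF Z]]
            closedin_point[OF Qp] W(1) conjunct1[OF \<Z>(3)[OF Z]] W(3) \<open>W \<subset> Z\<close> ZX])
  qed
  \<comment> \<open>A component contained in a fibre determines that fibre through any of its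
    points, so one sample point of each component is enough.\<close>
  define Bad where "Bad = (\<lambda>Z. \<nu> (SOME z. z \<in> Z)) ` \<Z>"
  have "finite Bad" unfolding Bad_def using \<Z>(1) by simp
  then have "infinite (D - Bad)" using D by simp
  then have "D - Bad \<noteq> {}" by (metis finite.emptyI)
  then obtain P where P: "P \<in> D" "P \<notin> Bad" by blast
  have "\<not> Z \<subseteq> \<nu> -` {P}" if Z: "Z \<in> \<Z>" for Z
  proof
    assume *: "Z \<subseteq> \<nu> -` {P}"
    have "Z \<noteq> {}" using \<Z>(3)[OF Z] by (simp add: irreducible_set_def)
    then have "(SOME z. z \<in> Z) \<in> Z" by (rule some_in_eq[THEN iffD2])
    then have "\<nu> (SOME z. z \<in> Z) = P" using * by auto
    then show False using P(2) Z unfolding Bad_def by blast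
  qed
  then have "finite (\<Union>Z\<in>\<Z>. Z \<inter> \<nu> -` {P})" using fin P \<Z>(1) by blast
  moreover have "B \<inter> \<nu> -` {P} = (\<Union>Z\<in>\<Z>. Z \<inter> \<nu> -` {P})" using \<Z>(2) by blast
  ultimately have "finite (B \<inter> \<nu> -` {P})" by simp
  then show ?thesis using P(1) by blast
qed

section \<open>Inverting a birational morphism at a normal point with finite fibre\<close>

text \<open>The coefficients are taken on the moment curve \<open>(1, x, x^2, ...)\<close>: each
  point of \<open>T\<close> then only asks that \<open>x\<close> avoid the roots of a nonzero
  polynomial in one variable.\<close>

lemma linear_form_avoiding:
  fixes T :: "'k::field_char_0 ppoint set"
  assumes "finite T" "T \<subseteq> pspace N"
  obtains c :: "nat \<Rightarrow> 'k" where "\<And>Q. Q \<in> T \<Longrightarrow> (\<Sum>i\<le>N. c i * coords Q i) \<noteq> 0"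
proof -
  define p where "p Q = (\<Sum>i\<le>N. monom (coords Q i) i)" for Q :: "'k ppoint"
  have cp: "coeff (p Q) k = (if k \<le> N then coords Q k else 0)" for Q k
    unfolding p_def coeff_sum by simp
  have "p Q \<noteq> 0" if "Q \<in> T" for Q
  proof -
    have QN: "Q \<in> pspace N" using that assms by blast
    then have "Q \<in> pspaces" by blast
    then obtain i where i: "coords Q i \<noteq> 0" using coords_nz by blast
    then have "i \<le> N" using pspace_coords[OF QN, of i] by (cases "i \<le> N") auto
    then have "coeff (p Q) i \<noteq> 0" using i by (simp add: cp)
    then show ?thesis by auto
  qed
  then have "finite (\<Union>Q\<in>T. {x. poly (p Q) x = 0})" using assms poly_roots_finite by blast
  then obtain x where x: "x \<notin> (\<Union>Q\<in>T. {x. poly (p Q) x = 0})"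
    using ex_new_if_finite[OF infinite_UNIV_char_0] by blast
  have "poly (p Q) x = (\<Sum>i\<le>N. x ^ i * coords Q i)" for Q
    unfolding p_def poly_sum by (simp add: poly_monom mult.commute)
  then show ?thesis using x that[of "\<lambda>i. x ^ i"] by auto
qed

text \<open>Evaluation at \<open>P\<close> is the homomorphism from which places over
  \<open>P\<close> are built. On germs it kills \<open>generic_zero Y\<close> by the identity
  theorem.\<close>

lemma partial_hom_germs:
  fixes Y :: "'k::alg_closed_field ppoint set"
  assumes irr: "irreducible_set zariski Y" and Y: "Y \<subseteq> pspaces" and P: "P \<in> Y"
  shows "partial_hom (generic_zero Y) (germ_fns Y {P}) (\<lambda>h. h P)"
proof
  have Pp: "P \<in> pspaces" using P Y by blast
  show "ring_ideal (generic_zero Y)" by (rule generic_zero_ideal[OF irr])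
  have PY: "{P} \<subseteq> Y" using P by simp
  show "subring (germ_fns Y {P})" by (rule germ_fns_subring[OF irreducible_point[OF Pp] PY Y])
  have "(\<lambda>_. c) \<in> germ_fns Y {P}" for c
    using germ_fns_const nbhd_whole[OF irreducible_point[OF Pp] PY Y] by blast
  then have "c \<in> (\<lambda>h. h P) ` germ_fns Y {P}" for c by (rule rev_image_eqI) simp
  then show "(\<lambda>h. h P) ` germ_fns Y {P} = UNIV" by blast
  fix h assume h: "h \<in> germ_fns Y {P}" "h \<in> generic_zero Y"
  obtain U where U: "nbhd Y {P} U" "h \<in> regular_fns Y U" using h(1) unfolding germ_fns_def by blast
  obtain V where V: "open_in Y V" "V \<noteq> {}" "\<forall>Q\<in>V. h Q = 0"
    using h(2) unfolding generic_zero_def by blast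
  have "P \<in> U" using U(1) by (auto simp: nbhd_def)
  from regular_identity[OF irr U(2) regular_const[OF regular_fns_open[OF U(2)], of 0] V(1,2) _ this]
  show "h P = 0" using V(3) by blast
qed auto

lemma generic_finite:
  assumes irr: "irreducible_set zariski Y" and g: "\<And>i::nat. i \<le> N \<Longrightarrow> g i \<in> generic_zero Y"
  obtains V where "open_in Y V" "V \<noteq> {}" "\<And>i Q. i \<le> N \<Longrightarrow> Q \<in> V \<Longrightarrow> g i Q = 0"
proof -
  have "\<exists>V. open_in Y V \<and> V \<noteq> {} \<and> (\<forall>i\<le>N. \<forall>Q\<in>V. g i Q = 0)"
    using g
  proof (induction N)
    case 0
    then show ?case using 0[of 0] unfolding generic_zero_def by auto
  next
    case (Suc N)
    then obtain V where V: "open_in Y V" "V \<noteq> {}" "\<forall>i\<le>N. \<forall>Q\<in>V. g i Q = 0" by auto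
    obtain V' where V': "open_in Y V'" "V' \<noteq> {}" "\<forall>Q\<in>V'. g (Suc N) Q = 0"
      using Suc.prems[of "Suc N"] unfolding generic_zero_def by auto
    have "open_in Y (V \<inter> V')" using V V' by blast
    moreover have "V \<inter> V' \<noteq> {}" by (rule irreducible_open_inter[OF irr V(1) V'(1) V(2) V'(2)])
    moreover have "\<forall>i\<le>Suc N. \<forall>Q\<in>V \<inter> V'. g i Q = 0" using V(3) V'(3) by (auto simp: le_Suc_eq)
    ultimately show ?case by blast
  qed
  then show ?thesis using that by blast
qed

lemma ppoint_of_scale: "e \<noteq> 0 \<Longrightarrow> R \<in> pspaces \<Longrightarrow> ppoint_of (\<lambda>i. e * coords R i) = R"
proof -
  assume e: "e \<noteq> 0" and R: "R \<in> pspaces"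
  obtain N where RN: "R \<in> pspace N" using R by blast
  obtain i where i: "coords R i \<noteq> 0" using coords_nz[OF R] by blast
  obtain c where c: "c \<noteq> 0" "(\<lambda>i. e * coords R i) = (\<lambda>i. c * coords (ppoint_of (\<lambda>i. e * coords R i)) i)"
    and P: "ppoint_of (\<lambda>i. e * coords R i) \<in> pspace N"
    using coords_ppoint_of[of "\<lambda>i. e * coords R i" i N] e i pspace_coords[OF RN] by auto
  let ?P = "ppoint_of (\<lambda>i. e * coords R i)"
  have "coords ?P i = (e / c) * coords R i" for i using fun_cong[OF c(2), of i] c(1) by (simp add: field_simps)
  moreover have "e / c \<noteq> 0" using e c by simp
  ultimately show ?thesis using ppoint_eqI[of ?P R "e / c"] P R by blast
qed

lemma morphism_into_open:
  assumes "morphism \<phi> X Y" "open_in Y W" "X \<subseteq> pspaces" "\<And>P. P \<in> X \<Longrightarrow> \<phi> P \<in> W"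
  shows "morphism \<phi> X W"
  unfolding morphism_def
proof (intro conjI allI ballI)
  have W: "W \<subseteq> Y" using openin_sub_zariski_subset[OF assms(2)] by simp
  have "continuous_map (subtopology zariski X) (subtopology (subtopology zariski Y) W) \<phi>"
    by (rule continuous_map_in_subtopology[THEN iffD2])
      (use morphism_cont[OF assms(1)] assms(3,4) in \<open>auto simp: topspace_zariski\<close>)
  then show "continuous_map (subtopology zariski X) (subtopology zariski W) \<phi>"
    using W by (simp add: subtopology_subtopology Int_absorb1)
  fix V h assume "h \<in> regular_fns W V"
  then have "h \<in> regular_fns Y V" using regular_fns_open_sub[OF assms(2)] by blast
  then show "h \<circ> \<phi> \<in> regular_fns X (X \<inter> \<phi> -` V)" by (rule morphism_regular[OF assms(1)])
qed

text \<open>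
  With \<open>y = 1 / \<tau>\<close>, an equation contradicting \<open>y \<mapsto> 0\<close> would be an equation of integral
  dependence for \<open>\<tau>\<close>.
\<close>

lemma normal_pole:
  fixes Y :: "'k::alg_closed_field ppoint set"
  assumes irr: "irreducible_set zariski Y" and Y: "Y \<subseteq> pspaces" "normal_variety Y" and P: "P \<in> Y"
    and \<tau>: "\<tau> \<in> germ_fns Y Y" "\<tau> * y - 1 \<in> generic_zero Y"
    and not: "\<And>h. h \<in> germ_fns Y {P} \<Longrightarrow> \<tau> - h \<notin> generic_zero Y"
  obtains A \<phi> where "partial_hom (generic_zero Y) A \<phi>" "germ_fns Y {P} \<subseteq> A"
    "\<And>h. h \<in> germ_fns Y {P} \<Longrightarrow> \<phi> h = h P" "y \<in> A" "\<phi> y = 0"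
proof -
  let ?Z = "generic_zero Y" and ?A = "germ_fns Y {P}"
  have Pp: "P \<in> pspaces" using P Y by blast
  interpret partial_hom ?Z ?A "\<lambda>h. h P" by (rule partial_hom_germs[OF irr Y(1) P])
  have "poly (map_poly (\<lambda>h. h P) p) 0 = 0" if p: "p \<in> relations y" for p
  proof (rule ccontr)
    assume "poly (map_poly (\<lambda>h. h P) p) 0 \<noteq> 0"
    then have p0: "coeff p 0 P \<noteq> 0" by (simp add: poly_0_coeff_0 coeff_map)
    have pA: "coeff p i \<in> ?A" for i using p by (auto simp: relations_def coeffs_in_def)
    obtain U where U: "nbhd Y {P} U" "coeff p 0 \<in> regular_fns Y U"
      using pA[of 0] unfolding germ_fns_def by blast
    define U' where "U' = {Q \<in> U. coeff p 0 Q \<noteq> 0}"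
    have U': "open_in Y U'" "P \<in> U'"
      using regular_nz_open[OF U(2)] U(1) p0 by (auto simp: U'_def nbhd_def)
    \<comment> \<open>The constant coefficient of the relation is a unit at \<open>P\<close>.
      Multiplying \<open>poly p y\<close> by \<open>v * \<tau> ^ n\<close> reverses the order of the
      coefficients and gives a monic equation for \<open>\<tau>\<close>.\<close>
    define v where "v Q = 1 / coeff p 0 Q" for Q
    have "v \<in> regular_fns Y U'" unfolding v_def[abs_def]
      by (rule regular_divide[OF regular_const[OF U'(1)] regular_restrict[OF U(2) U'(1)]])
        (auto simp: U'_def)
    then have vA: "v \<in> ?A" unfolding germ_fns_def nbhd_def using U' by blast
    define n where "n = degree p"
    define a where "a i = v * coeff p (n - i)" for i
    have aA: "a i \<in> ?A" for i unfolding a_def by (rule subring_mult[OF A vA pA])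
    have py: "poly p y \<in> ?Z" using p by (simp add: relations_def)
    obtain V where V: "open_in Y V" "V \<noteq> {}" "\<forall>Q\<in>V. poly p y Q = 0"
      using py unfolding generic_zero_def by blast
    obtain V' where V': "open_in Y V'" "V' \<noteq> {}" "\<forall>Q\<in>V'. (\<tau> * y - 1) Q = 0"
      using \<tau>(2) unfolding generic_zero_def by blast
    have VV: "V \<inter> V' \<noteq> {}" by (rule irreducible_open_inter[OF irr V(1) V'(1) V(2) V'(2)])
    have oVV: "open_in Y (V \<inter> V')" using V V' by blast
    have "U' \<noteq> {}" using U' by blast
    have ne: "V \<inter> V' \<inter> U' \<noteq> {}" by (rule irreducible_open_inter[OF irr oVV U'(1) VV \<open>U' \<noteq> {}\<close>])
    have o: "open_in Y (V \<inter> V' \<inter> U')" using oVV U' by blast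
    have "germ_eq Y Y (\<lambda>Q. \<tau> Q ^ n + (\<Sum>i<n. a i Q * \<tau> Q ^ i)) (\<lambda>_. 0)"
      unfolding germ_eq_def nbhd_def
    proof (intro exI[of _ "V \<inter> V' \<inter> U'"] conjI ballI o)
      show "V \<inter> V' \<inter> U' \<inter> Y \<noteq> {}" using ne openin_sub_zariski_subset[OF o] by blast
      fix Q assume Q: "Q \<in> V \<inter> V' \<inter> U'"
      have "\<tau> Q * y Q = 1" using V'(3) Q by auto
      then have yQ: "\<tau> Q \<noteq> 0" "y Q = inverse (\<tau> Q)" by (auto simp: inverse_unique)
      have c0: "coeff p 0 Q \<noteq> 0" using Q by (simp add: U'_def)
      have "0 = (\<Sum>k\<le>n. coeff p k Q * y Q ^ k)"
        using V(3) Q unfolding poly_altdef n_def by (simp add: fun_sum_apply fun_power_apply)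
      then have "0 = v Q * \<tau> Q ^ n * (\<Sum>k\<le>n. coeff p k Q * y Q ^ k)" by simp
      also have "\<dots> = (\<Sum>k\<le>n. v Q * coeff p k Q * \<tau> Q ^ (n - k))"
        unfolding sum_distrib_left
      proof (rule sum.cong)
        fix k assume "k \<in> {..n}"
        then have "\<tau> Q ^ n = \<tau> Q ^ (n - k) * \<tau> Q ^ k" by (simp flip: power_add)
        then show "v Q * \<tau> Q ^ n * (coeff p k Q * y Q ^ k) = v Q * coeff p k Q * \<tau> Q ^ (n - k)"
          using yQ by (simp add: power_inverse)
      qed simp
      also have "\<dots> = (\<Sum>i\<le>n. v Q * coeff p (n - i) Q * \<tau> Q ^ i)"
        by (rule sum.reindex_bij_witness[of _ "\<lambda>i. n - i" "\<lambda>i. n - i"]) auto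
      also have "\<dots> = (\<Sum>i<n. a i Q * \<tau> Q ^ i) + v Q * coeff p 0 Q * \<tau> Q ^ n"
        by (simp add: lessThan_Suc_atMost[symmetric] a_def)
      also have "v Q * coeff p 0 Q = 1" using c0 by (simp add: v_def)
      finally show "\<tau> Q ^ n + (\<Sum>i<n. a i Q * \<tau> Q ^ i) = 0" by (simp add: add.commute)
    qed
    then have "\<exists>n a. (\<forall>i<n. a i \<in> ?A) \<and> germ_eq Y Y (\<lambda>Q. \<tau> Q ^ n + (\<Sum>i<n. a i Q * \<tau> Q ^ i)) (\<lambda>_. 0)"
      using aA by blast
    then obtain h where "h \<in> ?A" "germ_eq Y Y \<tau> h"
      using Y(2) P \<tau>(1) unfolding normal_variety_def by meson
    then show False using not germ_eq_generic[OF Y(1)] by blast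
  qed
  from extend_to_root[of y 0, OF this] show ?thesis using that by metis
qed

text \<open>Zariski's main theorem at a normal point with finite fibre. \<open>\<psi>'\<close> is a
  section over \<open>W\<close> and every point of \<open>X\<close> over \<open>W\<close> is in its
  image, so \<open>\<nu>\<close> is an isomorphism over \<open>W\<close>.\<close>

lemma extend_inverse:
  fixes X Y :: "'k::{alg_closed_field, field_char_0} ppoint set"
  assumes irrX: "irreducible_set zariski X" and clX: "closedin zariski X" and XN: "X \<subseteq> pspace N"
    and irr: "irreducible_set zariski Y" and Y: "Y \<subseteq> pspaces" "normal_variety Y"
    and \<nu>: "morphism \<nu> X Y" and V0: "open_in Y V0" "V0 \<noteq> {}"
    and U0: "open_in X U0"
    and \<psi>: "morphism \<psi> V0 X" "\<And>S. S \<in> V0 \<Longrightarrow> \<psi> S \<in> U0" "\<And>S. S \<in> V0 \<Longrightarrow> \<nu> (\<psi> S) = S"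
      "\<And>R. R \<in> U0 \<Longrightarrow> \<psi> (\<nu> R) = R"
    and P: "P \<in> Y" and fin: "finite (X \<inter> \<nu> -` {P})"
  obtains W \<psi>' where "open_in Y W" "P \<in> W" "morphism \<psi>' W X"
    "\<And>S. S \<in> W \<Longrightarrow> \<nu> (\<psi>' S) = S" "\<And>R. R \<in> X \<Longrightarrow> \<nu> R \<in> W \<Longrightarrow> \<psi>' (\<nu> R) = R"
proof -
  let ?Z = "generic_zero Y" and ?A = "germ_fns Y {P}"
  have Xp: "X \<subseteq> pspaces" using XN by blast
  have V0p: "V0 \<subseteq> pspaces" "V0 \<subseteq> Y" using openin_sub_zariski_subset[OF V0(1)] by auto
  have \<psi>X: "\<psi> S \<in> X" if "S \<in> V0" for S using morphism_in[OF \<psi>(1) V0p(1) that] .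
  have \<psi>p: "\<psi> S \<in> pspaces" if "S \<in> V0" for S using \<psi>X[OF that] Xp by blast
  have pre_eq: "{S \<in> V0. F (coords (\<psi> S)) \<noteq> 0} = V0 \<inter> \<psi> -` (X \<inter> basic_open F)" for F
    using \<psi>X \<psi>p by (auto simp: basic_open_def)
  have pre: "open_in Y {S \<in> V0. F (coords (\<psi> S)) \<noteq> 0}" if "hom_poly n d F" for n d F
    unfolding pre_eq using morphism_preimage[OF \<psi>(1) V0p(1) openin_sub_basic[OF that]] openin_open_sub[OF V0(1)]
    by blast
  note lift = lift_centre[OF irr Y(1) subset_refl P XN clX subset_refl \<nu> V0 pre \<psi>X \<psi>(3)]
  have TN: "X \<inter> \<nu> -` {P} \<subseteq> pspace N" using XN by blast
  obtain c where c: "\<And>Q. Q \<in> X \<inter> \<nu> -` {P} \<Longrightarrow> (\<Sum>i\<le>N. c i * coords Q i) \<noteq> 0"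
    using linear_form_avoiding[OF fin TN] by metis
  define lf where "lf v = (\<Sum>i\<le>N. c i * v i)" for v
  have lf: "hom_poly N 1 lf" unfolding lf_def[abs_def]
    by (intro hom_poly_sum hom_poly_cmult hom_poly_var) auto
  have lf_div: "lf (\<lambda>i. v i / e) = lf v / e" for v e
    unfolding lf_def by (simp add: sum_divide_distrib)
  \<comment> \<open>By the choice of \<open>c\<close>, the linear form is nonzero at the centre of
    every place over \<open>P\<close>. Both the nonemptiness of \<open>V1\<close> and the regularity
    of the \<open>\<tau> i\<close> rest on this.\<close>
  have lfq: "lf q \<noteq> 0" if q: "q j = 1" "\<And>i. i > N \<Longrightarrow> q i = 0" "ppoint_of q \<in> X" "\<nu> (ppoint_of q) = P" for j q
  proof -
    obtain e where e: "e \<noteq> 0" "q = (\<lambda>i. e * coords (ppoint_of q) i)"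
      using coords_ppoint_of(2)[of q j N] q by auto
    have "lf q = e * lf (coords (ppoint_of q))" using hom_poly_scale[OF lf, of e "coords (ppoint_of q)"] unfolding e(2)[symmetric] by simp
    then show ?thesis using c[of "ppoint_of q"] q e(1) by (simp add: lf_def)
  qed
  have const: "(\<lambda>_. x) \<in> ?A" for x
    by (rule germ_fns_const) (use nbhd_whole[OF irreducible_point _ Y(1)] P Y(1) in blast)
  have lift': "\<exists>A' \<phi>' j q. partial_hom ?Z A' \<phi>' \<and> A \<subseteq> A' \<and> (\<forall>a\<in>A. \<phi>' a = \<phi> a) \<and> lf q \<noteq> 0 \<and>
      (\<lambda>S. lf (coords (\<psi> S)) / coords (\<psi> S) j) \<in> A' \<and>
      \<phi>' (\<lambda>S. lf (coords (\<psi> S)) / coords (\<psi> S) j) = lf q \<and>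
      (\<forall>i. (\<lambda>S. coords (\<psi> S) i / coords (\<psi> S) j) \<in> A')"
    if A: "partial_hom ?Z A \<phi>" "?A \<subseteq> A" "\<And>h. h \<in> ?A \<Longrightarrow> \<phi> h = h P" for A \<phi>
  proof -
    obtain A' \<phi>' j q where *: "partial_hom ?Z A' \<phi>'" "A \<subseteq> A'" "\<And>a. a \<in> A \<Longrightarrow> \<phi>' a = \<phi> a"
      "q j = 1" "\<And>i. i > N \<Longrightarrow> q i = 0" "ppoint_of q \<in> X" "\<nu> (ppoint_of q) = P"
      "\<And>i. (\<lambda>S. coords (\<psi> S) i / coords (\<psi> S) j) \<in> A'"
      "\<And>i. \<phi>' (\<lambda>S. coords (\<psi> S) i / coords (\<psi> S) j) = q i"
      by (rule lift[OF _ _ _ A]) simp_all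
    have co: "(\<lambda>_. x) \<in> A'" "\<phi>' (\<lambda>_. x) = x" for x
      using const[of x] A(2,3) *(2,3) by (auto dest!: subsetD)
    define w where "w i = (\<lambda>S. coords (\<psi> S) i / coords (\<psi> S) j)" for i
    have "(\<lambda>S. lf (\<lambda>i. w i S)) \<in> A'" "\<phi>' (\<lambda>S. lf (\<lambda>i. w i S)) = lf (\<lambda>i. \<phi>' (w i))"
      using partial_hom_hom_poly[where w=w, OF *(1) lf co] *(8) by (simp_all add: w_def)
    moreover have "(\<lambda>S. lf (\<lambda>i. w i S)) = (\<lambda>S. lf (coords (\<psi> S)) / coords (\<psi> S) j)"
      by (simp add: w_def lf_div)
    moreover have "(\<lambda>i. \<phi>' (w i)) = q" using *(9) by (simp add: w_def)
    moreover have "lf q \<noteq> 0" by (rule lfq[OF *(4-7)])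
    ultimately show ?thesis
      by (intro exI[of _ A'] exI[of _ \<phi>'] exI[of _ j] exI[of _ q] conjI) (use *(1-3,8) in simp_all)
  qed
  define V1 where "V1 = {S \<in> V0. lf (coords (\<psi> S)) \<noteq> 0}"
  have oV1: "open_in Y V1" unfolding V1_def by (rule pre[OF lf])
  \<comment> \<open>Otherwise \<open>lf\<close> vanishes along \<open>\<psi>\<close> on all of
    \<open>V0\<close>, and a place over \<open>P\<close> would give it the value 0 at its
    centre.\<close>
  have V1ne: "V1 \<noteq> {}"
  proof
    assume e: "V1 = {}"
    obtain A' \<phi>' j q where *: "partial_hom ?Z A' \<phi>'" "lf q \<noteq> 0"
      "(\<lambda>S. lf (coords (\<psi> S)) / coords (\<psi> S) j) \<in> A'"
      "\<phi>' (\<lambda>S. lf (coords (\<psi> S)) / coords (\<psi> S) j) = lf q"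
      using lift'[OF partial_hom_germs[OF irr Y(1) P] subset_refl] by auto
    have "(\<lambda>S. lf (coords (\<psi> S)) / coords (\<psi> S) j) \<in> ?Z"
      unfolding generic_zero_def using V0 e by (auto simp: V1_def)
    from partial_hom.hom_Z[OF *(1,3) this] *(2,4) show False by simp
  qed
  define \<tau> where "\<tau> i S = coords (\<psi> S) i / lf (coords (\<psi> S))" for i S
  have \<tau>reg: "\<tau> i \<in> regular_fns Y V1" for i
  proof -
    have "(\<lambda>R. coords R i / lf (coords R)) \<in> regular_fns X (X \<inter> basic_open lf)"
      by (rule regular_ratio[OF hom_poly_var[of i "max i N"] hom_poly_mono[OF lf] openin_sub_basic[OF lf]])
        (auto simp: basic_open_def ratio_on_def)
    from morphism_regular[OF \<psi>(1) this]
    have "(\<lambda>R. coords R i / lf (coords R)) \<circ> \<psi> \<in> regular_fns Y (V0 \<inter> \<psi> -` (X \<inter> basic_open lf))"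
      using regular_fns_open_sub[OF V0(1)] by blast
    then show ?thesis unfolding V1_def pre_eq by (simp add: comp_def \<tau>_def[abs_def])
  qed
  have V1Y: "V1 \<inter> Y \<noteq> {}" using V1ne V0p by (auto simp: V1_def)
  \<comment> \<open>If \<open>\<tau> i\<close> is not a germ at \<open>P\<close>, some place over
    \<open>P\<close> sends its inverse \<open>y\<close> to 0. After division by the coordinate
    \<open>j\<close> that is adapted to the centre, \<open>lf\<close> equals \<open>y\<close> times
    the finite coordinate \<open>i\<close>; so \<open>lf\<close> would vanish at the centre.\<close>
  have "\<exists>h\<in>?A. \<tau> i - h \<in> ?Z" for i
  proof (rule ccontr)
    assume no: "\<not> (\<exists>h\<in>?A. \<tau> i - h \<in> ?Z)"
    define y where "y S = inverse (\<tau> i S)" for S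
    define V where "V = {S \<in> V1. \<tau> i S \<noteq> 0}"
    have oV: "open_in Y V" unfolding V_def by (rule regular_nz_open[OF \<tau>reg])
    have Vne: "V \<noteq> {}"
    proof
      assume "V = {}"
      then have "\<tau> i - (\<lambda>_. 0) \<in> ?Z" unfolding generic_zero_def using oV1 V1ne by (auto simp: V_def)
      then show False using no const by blast
    qed
    have 1: "\<tau> i * y - 1 \<in> ?Z" unfolding generic_zero_def using oV Vne by (auto simp: V_def y_def)
    have 2: "\<tau> i \<in> germ_fns Y Y" unfolding germ_fns_def nbhd_def using \<tau>reg oV1 V1Y by blast
    obtain A \<phi> where A: "partial_hom ?Z A \<phi>" "?A \<subseteq> A" "\<And>h. h \<in> ?A \<Longrightarrow> \<phi> h = h P" "y \<in> A" "\<phi> y = 0"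
      by (rule normal_pole[OF irr Y P 2 1]) (use no in blast)+
    obtain A' \<phi>' j q where *: "partial_hom ?Z A' \<phi>'" "A \<subseteq> A'" "\<forall>a\<in>A. \<phi>' a = \<phi> a" "lf q \<noteq> 0"
      "(\<lambda>S. lf (coords (\<psi> S)) / coords (\<psi> S) j) \<in> A'"
      "\<phi>' (\<lambda>S. lf (coords (\<psi> S)) / coords (\<psi> S) j) = lf q"
      "\<forall>i. (\<lambda>S. coords (\<psi> S) i / coords (\<psi> S) j) \<in> A'"
      using lift'[OF A(1-3)] by auto
    interpret h: partial_hom ?Z A' \<phi>' by (rule *(1))
    have y': "y \<in> A'" "\<phi>' y = 0" using A(4,5) *(2,3) by auto
    have "(\<lambda>S. lf (coords (\<psi> S)) / coords (\<psi> S) j) - y * (\<lambda>S. coords (\<psi> S) i / coords (\<psi> S) j) \<in> ?Z"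
      unfolding generic_zero_def mem_Collect_eq
      by (intro exI[of _ V] conjI oV Vne) (auto simp: V_def V1_def y_def \<tau>_def)
    from h.hom_cong[OF *(5) subring_mult[OF h.A y'(1)] this] *(7)
    have "lf q = \<phi>' (y * (\<lambda>S. coords (\<psi> S) i / coords (\<psi> S) j))" using *(6) by simp
    also have "\<dots> = 0" using h.hom_mult[OF y'(1)] *(7) y'(2) by simp
    finally show False using *(4) by simp
  qed
  then obtain h0 where h0: "\<And>i. h0 i \<in> ?A" "\<And>i. \<tau> i - h0 i \<in> ?Z" by metis
  define h where "h i = (if i \<le> N then h0 i else (\<lambda>_. 0))" for i
  have hA: "h i \<in> ?A" for i using h0 const by (simp add: h_def)
  then have "\<forall>i. \<exists>U. nbhd Y {P} U \<and> h i \<in> regular_fns Y U" unfolding germ_fns_def by blast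
  then obtain U where U: "\<And>i. nbhd Y {P} (U i)" "\<And>i. h i \<in> regular_fns Y (U i)" by metis
  define W where "W = (\<Inter>i\<in>{..N}. U i)"
  have W: "open_in Y W" "P \<in> W"
    unfolding W_def using U(1) by (auto simp: nbhd_def intro!: openin_INT2)
  have hW: "h i \<in> regular_fns Y W" for i
  proof (cases "i \<le> N")
    case True
    have "W \<subseteq> U i" using True by (auto simp: W_def)
    then show ?thesis by (rule regular_restrict[OF U(2) W(1)])
  next
    case False then show ?thesis by (simp add: h_def regular_const[OF W(1)])
  qed
  obtain V2 where V2: "open_in Y V2" "V2 \<noteq> {}"
    "\<And>i Q. i \<le> N \<Longrightarrow> Q \<in> V2 \<Longrightarrow> (\<tau> i - h0 i) Q = 0"
    using generic_finite[OF irr, of N "\<lambda>i. \<tau> i - h0 i"] h0(2) by metis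
  define V3 where "V3 = V1 \<inter> V2"
  have V3: "open_in Y V3" "V3 \<noteq> {}"
    using irreducible_open_inter[OF irr oV1 V2(1) V1ne V2(2)] oV1 V2(1) by (auto simp: V3_def)
  have V30: "V3 \<subseteq> V0" by (auto simp: V3_def V1_def)
  have lfS: "lf (coords (\<psi> S)) \<noteq> 0" if "S \<in> V3" for S using that by (simp add: V3_def V1_def)
  have hS: "(\<lambda>i. h i S) = (\<lambda>i. (1 / lf (coords (\<psi> S))) * coords (\<psi> S) i)" if S: "S \<in> V3" for S
  proof
    fix i
    have "\<psi> S \<in> pspace N" using \<psi>X S V30 XN by blast
    then show "h i S = (1 / lf (coords (\<psi> S))) * coords (\<psi> S) i"
      using V2(3)[of i S] S pspace_coords[of "\<psi> S" N i] by (cases "i \<le> N") (auto simp: h_def \<tau>_def V3_def)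
  qed
  \<comment> \<open>The \<open>\<tau> i\<close> are normalised so that \<open>lf\<close> takes the
    value 1 on them. The identity theorem extends this to \<open>W\<close>, where it rules out a
    common zero of the \<open>h i\<close>.\<close>
  have lfh: "lf (\<lambda>i. h i S) = 1" if S: "S \<in> W" for S
  proof (rule regular_identity[OF irr regular_hom_poly[OF lf W(1) hW] regular_const[OF W(1)] V3 _ S])
    fix Q assume "Q \<in> V3" "Q \<in> W"
    show "lf (\<lambda>i. h i Q) = 1"
      unfolding hS[OF \<open>Q \<in> V3\<close>] using lfS[OF \<open>Q \<in> V3\<close>] by (simp add: lf_div)
  qed
  have hnz: "\<exists>i. h i S \<noteq> 0" if "S \<in> W" for S
  proof (rule ccontr)
    assume "\<not> (\<exists>i. h i S \<noteq> 0)"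
    then have "lf (\<lambda>i. h i S) = 0" by (simp add: lf_def)
    then show False using lfh[OF that] by simp
  qed
  have h_N: "h i S = 0" if "i > N" for i S using that by (simp add: h_def)
  define \<psi>' where "\<psi>' S = ppoint_of (\<lambda>i. h i S)" for S
  have \<psi>'N: "\<psi>' S \<in> pspace N" "\<exists>c. c \<noteq> 0 \<and> (\<lambda>i. h i S) = (\<lambda>i. c * coords (\<psi>' S) i)" if S: "S \<in> W" for S
  proof -
    obtain i where "h i S \<noteq> 0" using hnz[OF S] by blast
    then show "\<psi>' S \<in> pspace N" "\<exists>c. c \<noteq> 0 \<and> (\<lambda>i. h i S) = (\<lambda>i. c * coords (\<psi>' S) i)"
      unfolding \<psi>'_def by (intro coords_ppoint_of[of "\<lambda>i. h i S" i N] h_N; simp)+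
  qed
  have \<psi>'X: "\<psi>' S \<in> X" if S: "S \<in> W" for S
  proof (rule ccontr)
    assume "\<psi>' S \<notin> X"
    moreover have "\<psi>' S \<in> pspaces" using \<psi>'N(1)[OF S] by blast
    ultimately obtain n d F where F: "hom_poly n d F" "F (coords (\<psi>' S)) \<noteq> 0" "\<And>R. R \<in> X \<Longrightarrow> F (coords R) = 0"
      using closedin_zariski_sep[OF clX] by metis
    have "F (\<lambda>i. h i S) = 0"
    proof (rule regular_identity[OF irr regular_hom_poly[OF F(1) W(1) hW] regular_const[OF W(1)] V3 _ S])
      fix Q assume Q: "Q \<in> V3" "Q \<in> W"
      have "\<psi> Q \<in> X" using \<psi>X Q V30 by blast
      then show "F (\<lambda>i. h i Q) = 0"
        unfolding hS[OF Q(1)] hom_poly_scale[OF F(1)] by (simp add: F(3))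
    qed
    moreover obtain e where "e \<noteq> 0" "(\<lambda>i. h i S) = (\<lambda>i. e * coords (\<psi>' S) i)" using \<psi>'N(2)[OF S] by blast
    ultimately show False using hom_poly_scale[OF F(1), of e "coords (\<psi>' S)"] F(2) by simp
  qed
  have gen: "\<psi>' S = \<psi> S" if S: "S \<in> V3" for S
  proof -
    have "S \<in> V0" using S V30 by blast
    then show ?thesis unfolding \<psi>'_def hS[OF S] using lfS[OF S] \<psi>p by (intro ppoint_of_scale) auto
  qed
  have mor: "morphism \<psi>' W X"
    by (rule morphism_from_coords[OF XN W(1) hW h_N hnz]) (auto simp: \<psi>'_def[symmetric] \<psi>'X)
  have Wp: "W \<subseteq> pspaces" "W \<subseteq> Y" using openin_sub_zariski_subset[OF W(1)] by auto
  have \<nu>\<psi>': "\<nu> (\<psi>' S) = S" if S: "S \<in> W" for S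
  proof -
    have "(\<nu> \<circ> \<psi>') S = S"
    proof (rule morphism_identity[OF irr W(1) morphism_compose[OF mor \<nu> Wp(1)] morphism_id[OF Y(1) Wp(2)] Y(1) V3 _ S])
      fix Q assume "Q \<in> V3" "Q \<in> W"
      then show "(\<nu> \<circ> \<psi>') Q = Q" using gen \<psi>(3) V30 by auto
    qed
    then show ?thesis by simp
  qed
  have "\<psi>' (\<nu> R) = R" if R: "R \<in> X" "\<nu> R \<in> W" for R
  proof -
    let ?W' = "X \<inter> \<nu> -` W"
    have oW': "open_in X ?W'" by (rule morphism_preimage[OF \<nu> Xp W(1)])
    have W'p: "?W' \<subseteq> pspaces" "?W' \<subseteq> X" using Xp by auto
    have \<nu>W: "morphism \<nu> ?W' W"
      by (rule morphism_into_open[OF morphism_restrict[OF \<nu> oW'] W(1) W'p(1)]) auto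
    \<comment> \<open>Here \<open>\<psi>'\<close> agrees with the given \<open>\<psi>\<close>, which
      inverts \<open>\<nu>\<close> on \<open>U0\<close>. Separatedness then extends the identity of
      \<open>\<psi>' \<circ> \<nu>\<close> to every point over \<open>W\<close>.\<close>
    have oV: "open_in X (U0 \<inter> (X \<inter> \<nu> -` V3))"
      using U0 morphism_preimage[OF \<nu> Xp V3(1)] by blast
    have ne: "U0 \<inter> (X \<inter> \<nu> -` V3) \<noteq> {}"
    proof -
      obtain S where S: "S \<in> V3" using V3(2) by blast
      then have "\<psi> S \<in> U0 \<inter> (X \<inter> \<nu> -` V3)" using \<psi>(2,3) \<psi>X V30 by auto
      then show ?thesis by blast
    qed
    have RW: "R \<in> ?W'" using R by simp
    have "(\<psi>' \<circ> \<nu>) R = R"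
    proof (rule morphism_identity[OF irrX oW' morphism_compose[OF \<nu>W mor W'p(1)] morphism_id[OF Xp W'p(2)] Xp oV ne _ RW])
      fix Q assume Q: "Q \<in> U0 \<inter> (X \<inter> \<nu> -` V3)"
      then show "(\<psi>' \<circ> \<nu>) Q = Q" using gen[of "\<nu> Q"] \<psi>(4)[of Q] by simp
    qed
    then show ?thesis by simp
  qed
  from that[OF W mor \<nu>\<psi>' this] show ?thesis by simp
qed

section \<open>Orders along curves\<close>

text \<open>The assumption \<open>dom\<close> says that the part of \<open>G\<close> in
  \<open>W\<close> reaches every neighbourhood of the generic point of \<open>D\<close>. The
  transfer is applied to \<open>\<nu>\<close>, to its inverse over \<open>W\<close> with the roles
  exchanged, and to the map to the base curve with \<open>{t}\<close> in place of
  \<open>D\<close>.\<close>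

context
  fixes X Y G D W :: "'k::field ppoint set" and \<phi> :: "'k ppoint \<Rightarrow> 'k ppoint"
  assumes W: "open_in X W" and \<phi>: "morphism \<phi> W Y"
    and GD: "\<And>P. P \<in> W \<Longrightarrow> P \<in> G \<Longrightarrow> \<phi> P \<in> D"
    and dom: "\<And>U. nbhd Y D U \<Longrightarrow> \<exists>P\<in>W. P \<in> G \<and> \<phi> P \<in> U"
begin

lemma nbhd_pullback: "nbhd Y D U \<Longrightarrow> nbhd X G (W \<inter> \<phi> -` U)"
  using dom[of U] morphism_preimage[OF \<phi>, of U] openin_open_sub[OF W] openin_sub_zariski_subset(2)[OF W]
  unfolding nbhd_def by blast

lemma regular_pullback: "h \<in> regular_fns Y U \<Longrightarrow> h \<circ> \<phi> \<in> regular_fns X (W \<inter> \<phi> -` U)"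
  using morphism_regular[OF \<phi>] regular_fns_open_sub[OF W] by blast

lemma germ_fns_pullback:
  assumes "h \<in> germ_fns Y D" shows "h \<circ> \<phi> \<in> germ_fns X G"
proof -
  obtain U where U: "nbhd Y D U" "h \<in> regular_fns Y U" using assms unfolding germ_fns_def by blast
  show ?thesis unfolding germ_fns_def
    using nbhd_pullback[OF U(1)] regular_pullback[OF U(2)] by blast
qed

lemma germ_eq_pullback:
  assumes "germ_eq Y D h h'" shows "germ_eq X G (h \<circ> \<phi>) (h' \<circ> \<phi>)"
proof -
  obtain U where U: "nbhd Y D U" "\<forall>Q\<in>U. h Q = h' Q" using assms unfolding germ_eq_def by blast
  show ?thesis unfolding germ_eq_def
    by (intro exI[of _ "W \<inter> \<phi> -` U"] conjI nbhd_pullback[OF U(1)]) (use U(2) in auto)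
qed

lemma max_ideal_pullback:
  assumes "h \<in> max_ideal Y D" shows "h \<circ> \<phi> \<in> max_ideal X G"
proof -
  obtain U where U: "nbhd Y D U" "h \<in> regular_fns Y U" "\<forall>Q\<in>U \<inter> D. h Q = 0"
    using assms unfolding max_ideal_def vanishing_germs_def by blast
  have "\<forall>Q\<in>(W \<inter> \<phi> -` U) \<inter> G. (h \<circ> \<phi>) Q = 0" using U(3) GD by auto
  then show ?thesis unfolding max_ideal_def vanishing_germs_def
    using nbhd_pullback[OF U(1)] regular_pullback[OF U(2)] by blast
qed

lemma max_ideal_pow_pullback:
  assumes "h \<in> max_ideal_pow Y D N" shows "h \<circ> \<phi> \<in> max_ideal_pow X G N"
proof -
  obtain r c g where h: "h \<in> germ_fns Y D"
    and cg: "\<And>i. i < r \<Longrightarrow> c i \<in> germ_fns Y D" "\<And>i j. i < r \<Longrightarrow> j < N \<Longrightarrow> g i j \<in> max_ideal Y D"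
    and eq: "germ_eq Y D h (\<lambda>Q. \<Sum>i<r::nat. c i Q * (\<Prod>j<N. g i j Q))"
    using assms unfolding max_ideal_pow_def by blast
  show ?thesis unfolding max_ideal_pow_def mem_Collect_eq
  proof (intro conjI exI[of _ r] exI[of _ "\<lambda>i. c i \<circ> \<phi>"] exI[of _ "\<lambda>i j. g i j \<circ> \<phi>"] allI impI)
    show "germ_eq X G (h \<circ> \<phi>) (\<lambda>Q. \<Sum>i<r. (c i \<circ> \<phi>) Q * (\<Prod>j<N. (g i j \<circ> \<phi>) Q))"
      using germ_eq_pullback[OF eq] by (simp add: comp_def)
  qed (use h cg germ_fns_pullback max_ideal_pullback in auto)
qed

end

section \<open>Powers of the maximal ideal along an irreducible set\<close>

context
  fixes X Z :: "'k::field ppoint set"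
  assumes irr: "irreducible_set zariski Z" and ZX: "Z \<subseteq> X" and Xp: "X \<subseteq> pspaces"
begin

text \<open>With \<open>e\<close> equal to 1 this replaces a function by another with the same germ;
  with a general \<open>e\<close> it compares two local equations of a divisor.\<close>

lemma max_ideal_pow_multiple:
  assumes e: "e \<in> germ_fns X Z" and h: "h \<in> max_ideal_pow X Z N"
    and h': "h' \<in> germ_fns X Z" "germ_eq X Z h' (\<lambda>Q. e Q * h Q)"
  shows "h' \<in> max_ideal_pow X Z N"
proof -
  obtain r c g where cg: "\<And>i. i < r \<Longrightarrow> c i \<in> germ_fns X Z" "\<And>i j. i < r \<Longrightarrow> j < N \<Longrightarrow> g i j \<in> max_ideal X Z"
    and eq: "germ_eq X Z h (\<lambda>Q. \<Sum>i<r::nat. c i Q * (\<Prod>j<N. g i j Q))"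
    using h unfolding max_ideal_pow_def by blast
  obtain U where U: "nbhd X Z U" "\<forall>Q\<in>U. h Q = (\<Sum>i<r. c i Q * (\<Prod>j<N. g i j Q))"
    using eq unfolding germ_eq_def by blast
  obtain V where V: "nbhd X Z V" "\<forall>Q\<in>V. h' Q = e Q * h Q" using h' unfolding germ_eq_def by blast
  have ec: "e * c i \<in> germ_fns X Z" if "i < r" for i
    by (rule subring_mult[OF germ_fns_subring[OF irr ZX Xp] e cg(1)[OF that]])
  have "germ_eq X Z h' (\<lambda>Q. \<Sum>i<r. (e * c i) Q * (\<Prod>j<N. g i j Q))"
    unfolding germ_eq_def
    by (intro exI[of _ "U \<inter> V"] conjI nbhd_inter[OF irr ZX U(1) V(1)])
      (use U V in \<open>auto simp: sum_distrib_left mult.assoc\<close>)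
  then show ?thesis unfolding max_ideal_pow_def mem_Collect_eq
    using h'(1) ec cg(2) by (intro conjI exI[of _ r] exI[of _ "\<lambda>i. e * c i"] exI[of _ g]) auto
qed

lemma nbhd_finite_inter:
  fixes r :: nat
  assumes "\<And>i. i < r \<Longrightarrow> nbhd X Z (U i)" shows "\<exists>V. nbhd X Z V \<and> (\<forall>i<r. V \<subseteq> U i)"
  using assms
proof (induction r)
  case 0 then show ?case using nbhd_whole[OF irr ZX Xp] by blast
next
  case (Suc r)
  then obtain V where V: "nbhd X Z V" "\<forall>i<r. V \<subseteq> U i" by auto
  have "nbhd X Z (V \<inter> U r)" by (rule nbhd_inter[OF irr ZX V(1)]) (simp add: Suc.prems)
  then show ?case using V(2) by (intro exI[of _ "V \<inter> U r"]) (auto simp: less_Suc_eq)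
qed

lemma max_ideal_pow_vanish:
  assumes "h \<in> max_ideal_pow X Z N" "N > 0"
  obtains U where "nbhd X Z U" "\<And>Q. Q \<in> U \<Longrightarrow> Q \<in> Z \<Longrightarrow> h Q = 0"
proof -
  obtain r c g where cg: "\<And>i j. i < r \<Longrightarrow> j < N \<Longrightarrow> g i j \<in> max_ideal X Z"
    and eq: "germ_eq X Z h (\<lambda>Q. \<Sum>i<r::nat. c i Q * (\<Prod>j<N. g i j Q))"
    using assms unfolding max_ideal_pow_def by blast
  obtain V where V: "nbhd X Z V" "\<forall>Q\<in>V. h Q = (\<Sum>i<r. c i Q * (\<Prod>j<N. g i j Q))"
    using eq unfolding germ_eq_def by blast
  have "\<exists>U. nbhd X Z U \<and> (\<forall>Q\<in>U \<inter> Z. g i 0 Q = 0)" if "i < r" for i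
    using cg[OF that assms(2)] unfolding max_ideal_def vanishing_germs_def by blast
  then obtain U where U: "\<And>i. i < r \<Longrightarrow> nbhd X Z (U i) \<and> (\<forall>Q\<in>U i \<inter> Z. g i 0 Q = 0)" by metis
  then obtain V' where V': "nbhd X Z V'" "\<forall>i<r. V' \<subseteq> U i" using nbhd_finite_inter[of r U] by blast
  show ?thesis
  proof (rule that[OF nbhd_inter[OF irr ZX V(1) V'(1)]])
    fix Q assume Q: "Q \<in> V \<inter> V'" "Q \<in> Z"
    have pz: "(\<Prod>j<N. g i j Q) = 0" if "i < r" for i
    proof (rule prod_zero)
      show "\<exists>j\<in>{..<N}. g i j Q = 0" using U[OF that] V'(2) Q that assms(2) by blast
    qed simp
    have "(\<Sum>i<r. c i Q * (\<Prod>j<N. g i j Q)) = 0"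
      by (rule sum.neutral) (metis lessThan_iff mult_zero_right pz)
    then show "h Q = 0" using V(2) Q by simp
  qed
qed

lemma max_ideal_pow_0: "h \<in> germ_fns X Z \<Longrightarrow> h \<in> max_ideal_pow X Z 0"
  unfolding max_ideal_pow_def mem_Collect_eq germ_eq_def
  using nbhd_whole[OF irr ZX Xp]
  by (intro conjI exI[of _ 1] exI[of _ "\<lambda>_. h"] exI[of _ "\<lambda>_ _. h"] exI[of _ X]) auto

text \<open>A nonzero value at a point of \<open>Z\<close> makes \<open>h\<close> a unit along
  \<open>Z\<close>. Then 0 is the only exponent whose power contains \<open>h\<close>, so the
  \<open>GREATEST\<close> in the definition is attained there.\<close>

lemma ord_along_nonzero:
  assumes h: "h \<in> regular_fns X U" "U \<inter> Z \<noteq> {}" and ord: "ord_along X Z h \<noteq> 0"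
    and Q: "Q \<in> U" "Q \<in> Z"
  shows "h Q = 0"
proof (rule ccontr)
  assume hQ: "h Q \<noteq> 0"
  have nU: "nbhd X Z U" using regular_fns_open[OF h(1)] h(2) by (simp add: nbhd_def)
  have "h \<in> germ_fns X Z" unfolding germ_fns_def using nU h(1) by blast
  note h0 = max_ideal_pow_0[OF this]
  have "N = 0" if N: "h \<in> max_ideal_pow X Z N" for N
  proof (rule ccontr)
    assume "N \<noteq> 0"
    then obtain V where V: "nbhd X Z V" "\<And>Q. Q \<in> V \<Longrightarrow> Q \<in> Z \<Longrightarrow> h Q = 0"
      using max_ideal_pow_vanish[OF N] by auto
    have "nbhd X Z {Q \<in> U. h Q \<noteq> 0}"
      unfolding nbhd_def using regular_nz_open[OF h(1)] Q hQ by auto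
    from nbhd_inter[OF irr ZX V(1) this] show False using V(2) unfolding nbhd_def by auto
  qed
  then have "ord_along X Z h = 0" unfolding ord_along_def using h0 by (intro Greatest_equality) auto
  then show False using ord by simp
qed

end

section \<open>Fibre divisors\<close>

lemma has_dim_unique:
  assumes "has_dim X d" "has_dim X d'" shows "d = d'"
proof -
  have "\<not> d < d'" if dims: "has_dim X d" "has_dim X d'" for d d'
  proof
    assume "d < d'"
    obtain Z where Z: "irreducible_chain X d' Z" using dims unfolding has_dim_def by blast
    have "irreducible_chain X (Suc d) Z" using Z \<open>d < d'\<close> unfolding irreducible_chain_def by auto
    then show False using dims unfolding has_dim_def by blast
  qed
  then show ?thesis using assms by (meson linorder_neqE_nat)
qed

lemma curve_two_points:
  assumes "projective_curve C" "t \<in> C" shows "\<exists>t'\<in>C. t' \<noteq> t"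
proof -
  have cl: "closedin zariski C" using assms unfolding projective_curve_def projective_variety_def by blast
  obtain Z where "irreducible_chain C 1 Z" using assms unfolding projective_curve_def has_dim_def by blast
  then have Z: "Z 0 \<subset> Z 1" "Z 1 \<subseteq> C" "irreducible_set zariski (Z 0)"
    unfolding irreducible_chain_def closedin_closed_subtopology[OF cl] by auto
  show ?thesis
  proof (rule ccontr)
    assume "\<not> ?thesis"
    then have "C \<subseteq> {t}" by blast
    then have "Z 0 = {}" using Z(1,2) by blast
    then show False using Z(3) by (simp add: irreducible_set_def)
  qed
qed

text \<open>In dimension 1 smoothness provides a single generator \<open>\<pi>\<close> of the
  maximal ideal at \<open>t\<close>. Its other zeros and the points outside its domain form a finite
  set, which is removed.\<close>

lemma point_divisor_exists:
  assumes C: "projective_curve C" and t: "t \<in> C" "smooth_at C t"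
  obtains V \<pi> where "(V, \<pi>) \<in> point_divisor C t" "t \<in> V"
proof -
  obtain N where N: "C \<subseteq> pspace N" and cl: "closedin zariski C" and irr: "irreducible_set zariski C"
    and dim: "has_dim C 1"
    using C unfolding projective_curve_def projective_variety_def by blast
  have Cp: "C \<subseteq> pspaces" using N by blast
  have tp: "t \<in> pspaces" using t Cp by blast
  obtain x where "generates_ideal C {t} 1 x (max_ideal C {t})"
    using t(2) has_dim_unique[OF dim] unfolding smooth_at_def by blast
  then have gen: "generates_ideal C {t} 1 (\<lambda>_. x 0) (max_ideal C {t})"
    unfolding generates_ideal_def by simp
  define \<pi> where "\<pi> = x 0"
  have "\<pi> \<in> max_ideal C {t}" using gen unfolding generates_ideal_def \<pi>_def by simp
  then obtain U where U: "nbhd C {t} U" "\<pi> \<in> regular_fns C U" "\<forall>Q\<in>U \<inter> {t}. \<pi> Q = 0"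
    unfolding max_ideal_def vanishing_germs_def by blast
  have tU: "t \<in> U" using U(1) by (auto simp: nbhd_def)
  define U' where "U' = {Q \<in> U. \<pi> Q \<noteq> 0}"
  have oU': "open_in C U'" unfolding U'_def by (rule regular_nz_open[OF U(2)])
  have U'C: "U' \<subseteq> C" using openin_sub_zariski_subset[OF oU'] by simp
  \<comment> \<open>If \<open>\<pi>\<close> were 0 near \<open>t\<close>, so would be every function
    vanishing at \<open>t\<close>. A form separating another point \<open>t'\<close> from
    \<open>t\<close>, divided by a power of a coordinate, is such a function and is not generically
    0.\<close>
  have "U' \<noteq> {}"
  proof
    assume e: "U' = {}"
    obtain t' where t': "t' \<in> C" "t' \<noteq> t" using curve_two_points[OF C t(1)] by blast
    then have "t' \<in> pspaces" "t' \<notin> {t}" using Cp by auto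
    then obtain n d F where F: "hom_poly n d F" "F (coords t') \<noteq> 0" "F (coords t) = 0"
      using closedin_zariski_sep[OF closedin_point[OF tp]] by (metis singletonI)
    obtain k where k: "coords t k \<noteq> 0" using coords_nz[OF tp] by blast
    have xk: "hom_poly k d (\<lambda>x. x k ^ d)" for d
    proof (induction d)
      case 0 then show ?case using hom_poly_const[of k 1] by simp
    next
      case (Suc d) then show ?case using hom_poly_mult[OF hom_poly_var[of k k] Suc] by simp
    qed
    define B where "B = C \<inter> basic_open (\<lambda>x. x k)"
    have oB: "open_in C B" unfolding B_def by (rule openin_sub_basic[OF hom_poly_var[of k k]]) simp
    have tB: "t \<in> B" using t tp k by (simp add: B_def basic_open_def)
    define h where "h Q = F (coords Q) / coords Q k ^ d" for Q
    have hB: "h \<in> regular_fns C B"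
      by (rule regular_ratio[OF hom_poly_mono[OF F(1), of "max n k"] hom_poly_mono[OF xk, of "max n k"] oB])
        (auto simp: B_def basic_open_def h_def ratio_on_def)
    have "h \<in> max_ideal C {t}"
      unfolding max_ideal_def vanishing_germs_def nbhd_def mem_Collect_eq
      by (intro exI[of _ B] conjI oB hB) (use tB F(3) in \<open>auto simp: h_def\<close>)
    then obtain c where "germ_eq C {t} h (\<lambda>Q. \<Sum>i<(1::nat). c i Q * \<pi> Q)"
      using gen unfolding generates_ideal_def \<pi>_def by blast
    then obtain V where V: "nbhd C {t} V" "\<forall>Q\<in>V. h Q = (\<Sum>i<(1::nat). c i Q * \<pi> Q)"
      unfolding germ_eq_def by blast
    have oV: "open_in C (V \<inter> U \<inter> B)" using V(1) U(1) oB by (auto simp: nbhd_def)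
    have Vne: "V \<inter> U \<inter> B \<noteq> {}" using V(1) tU tB by (auto simp: nbhd_def)
    have oF: "open_in C (C \<inter> basic_open F)" by (rule openin_sub_basic[OF F(1)])
    have "t' \<in> C \<inter> basic_open F" using t' F(2) Cp by (auto simp: basic_open_def)
    then have "C \<inter> basic_open F \<noteq> {}" by blast
    from irreducible_open_inter[OF irr oV oF Vne this]
    obtain Q where Q: "Q \<in> V" "Q \<in> U" "Q \<in> B" "F (coords Q) \<noteq> 0" by (auto simp: basic_open_def)
    have "\<pi> Q = 0" using e Q(2) by (auto simp: U'_def)
    then have "h Q = 0" using V(2) Q(1) by simp
    then show False using Q(3,4) by (simp add: h_def B_def basic_open_def)
  qed
  define B where "B = C - U'"
  have "closedin (subtopology zariski C) B"
    unfolding B_def using oU' Cp by (auto simp: closedin_def topspace_zariski Int_absorb1 double_diff U'C)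
  then have clB: "closedin zariski B" unfolding closedin_closed_subtopology[OF cl] by simp
  have BC: "B \<subset> C" using \<open>U' \<noteq> {}\<close> U'C by (auto simp: B_def)
  have finB: "finite B"
  proof (rule closed_finite_if_no_curve[OF clB])
    show "B \<subseteq> pspace N" using BC N by blast
    fix W P assume W: "closedin zariski W" "irreducible_set zariski W" "{P} \<subset> W" "W \<subseteq> B"
    have Pp: "P \<in> pspaces" using W(3,4) BC Cp by blast
    have "W \<subset> C" using W(4) BC by blast
    then have "irreducible_chain C (Suc 1) (\<lambda>i. [{P}, W, C] ! i)"
      unfolding irreducible_chain_def closedin_closed_subtopology[OF cl]
      using W irr cl closedin_point[OF Pp] irreducible_point[OF Pp]
      by (auto simp: numeral_eq_Suc less_Suc_eq le_Suc_eq)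
    then show False using dim unfolding has_dim_def by blast
  qed
  define V where "V = C - (B - {t})"
  have "closedin zariski (B - {t})"
  proof -
    have "closedin zariski (\<Union>P\<in>B - {t}. {P})"
      using finB BC Cp by (intro closedin_Union) (auto intro: closedin_point)
    then show ?thesis by simp
  qed
  then have oV: "open_in C V"
    unfolding V_def openin_subtopology using Cp
    by (intro exI[of _ "pspaces - (B - {t})"]) (auto simp: closedin_def topspace_zariski)
  have tV: "t \<in> V" using t by (simp add: V_def)
  have VU: "V \<subseteq> U" using tU by (auto simp: V_def B_def U'_def)
  have "\<pi> Q = 0 \<longleftrightarrow> Q = t" if "Q \<in> V" for Q
    using that tU U(3) by (auto simp: V_def B_def U'_def)
  then have "(V, \<pi>) \<in> point_divisor C t"
    unfolding point_divisor_def using gen regular_restrict[OF U(2) oV VU] by (simp add: \<pi>_def)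
  then show ?thesis using tV that by blast
qed

lemma projective_curve_subset: "projective_curve C \<Longrightarrow> C \<subseteq> pspaces"
  unfolding projective_curve_def projective_variety_def by blast

context
  fixes X C :: "'k::field ppoint set" and \<phi> :: "'k ppoint \<Rightarrow> 'k ppoint" and t :: "'k ppoint"
  assumes X: "projective_surface X" and C: "projective_curve C" "\<And>t. t \<in> C \<Longrightarrow> smooth_at C t"
    and \<phi>: "morphism \<phi> X C" and t: "t \<in> C"
begin

text \<open>Resolves the \<open>SOME\<close> in \<open>weil_divisor\<close>: a local equation whose
  domain meets \<open>D\<close> does exist.\<close>

lemma fiber_divisor_local:
  assumes D: "prime_divisor X D"
  obtains V \<pi> where "(V, \<pi>) \<in> point_divisor C t" "(X \<inter> \<phi> -` V) \<inter> D \<noteq> {}"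
    "fiber_divisor \<phi> X C t D = int (ord_along X D (\<pi> \<circ> \<phi>))"
proof -
  let ?P = "\<lambda>h. \<exists>U. (U, h) \<in> pullback_cartier \<phi> X (point_divisor C t) \<and> U \<inter> D \<noteq> {}"
  have irrD: "irreducible_set zariski D" "D \<subset> X" using prime_divisorD[OF X D] by auto
  obtain Q where Q: "Q \<in> D" using irrD(1) by (auto simp: irreducible_set_def)
  have QX: "Q \<in> X" and \<phi>Q: "\<phi> Q \<in> C" using Q irrD(2) morphism_in[OF \<phi> projective_surfaceD(4)[OF X]] by auto
  have "\<exists>V \<pi>. (V, \<pi>) \<in> point_divisor C t \<and> \<phi> Q \<in> V"
  proof (cases "\<phi> Q = t")
    case True
    then show ?thesis using point_divisor_exists[OF C(1) t C(2)[OF t]] by metis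
  next
    case False
    have tp: "t \<in> pspaces" using t projective_curve_subset[OF C(1)] by blast
    have "open_in C (C - {t})"
      unfolding openin_subtopology using closedin_point[OF tp] projective_curve_subset[OF C(1)]
      by (intro exI[of _ "pspaces - {t}"]) (auto simp: closedin_def topspace_zariski)
    \<comment> \<open>Away from \<open>t\<close> the divisor has the local equation 1; the domain
      omits \<open>t\<close> because a local equation must vanish there.\<close>
    then have "(C - {t}, \<lambda>_. 1) \<in> point_divisor C t"
      unfolding point_divisor_def using regular_const by auto
    then show ?thesis using False \<phi>Q by blast
  qed
  then obtain V0 \<pi>0 where "(V0, \<pi>0) \<in> point_divisor C t" "\<phi> Q \<in> V0" by blast
  then have "?P (\<pi>0 \<circ> \<phi>)" unfolding pullback_cartier_def using Q QX by blast
  then have "?P (SOME h. ?P h)" by (rule someI[of ?P])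
  then obtain V \<pi> where "(SOME h. ?P h) = \<pi> \<circ> \<phi>" "(V, \<pi>) \<in> point_divisor C t" "(X \<inter> \<phi> -` V) \<inter> D \<noteq> {}"
    unfolding pullback_cartier_def by blast
  then show ?thesis using that D unfolding fiber_divisor_def weil_divisor_def by simp
qed

text \<open>A nonzero multiplicity makes the local equation vanish on \<open>D\<close> within its
  domain. So \<open>\<phi>\<close> is \<open>t\<close> on a dense part of \<open>D\<close>, and on
  all of \<open>D\<close> because the fibre is closed.\<close>

lemma fiber_divisor_nonzero:
  assumes nz: "fiber_divisor \<phi> X C t D \<noteq> 0"
  shows "prime_divisor X D" "\<And>Q. Q \<in> D \<Longrightarrow> \<phi> Q = t"
proof -
  show D: "prime_divisor X D"
    using nz unfolding fiber_divisor_def weil_divisor_def by (auto split: if_splits)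
  note XD = projective_surfaceD[OF X] and DD = prime_divisorD[OF X D]
  have DX: "D \<subseteq> X" using DD by blast
  obtain V \<pi> where V: "(V, \<pi>) \<in> point_divisor C t" "(X \<inter> \<phi> -` V) \<inter> D \<noteq> {}"
    "fiber_divisor \<phi> X C t D = int (ord_along X D (\<pi> \<circ> \<phi>))" by (rule fiber_divisor_local[OF D])
  have V\<pi>: "\<pi> \<in> regular_fns C V" "\<And>Q. Q \<in> V \<Longrightarrow> \<pi> Q = 0 \<longleftrightarrow> Q = t"
    using V(1) by (auto simp: point_divisor_def)
  have reg: "\<pi> \<circ> \<phi> \<in> regular_fns X (X \<inter> \<phi> -` V)" by (rule morphism_regular[OF \<phi> V\<pi>(1)])
  have van: "\<phi> Q = t" if "Q \<in> (X \<inter> \<phi> -` V) \<inter> D" for Q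
    using ord_along_nonzero[OF DD(2) DX XD(4) reg V(2), of Q] nz V(3) V\<pi>(2)[of "\<phi> Q"] that by auto
  have tp: "t \<in> pspaces" using t projective_curve_subset[OF C(1)] by blast
  have "closedin (subtopology zariski X) (X \<inter> \<phi> -` {t})"
    by (rule morphism_preimage_closed[OF \<phi> XD(4) closedin_point[OF tp]])
  then have cl: "closedin zariski (X \<inter> \<phi> -` {t})" unfolding closedin_closed_subtopology[OF XD(2)] by simp
  have "open_in D (D \<inter> (X \<inter> \<phi> -` V))"
    by (rule openin_sub_subset[OF regular_fns_open[OF reg] DX])
  moreover have "D \<inter> (X \<inter> \<phi> -` V) \<noteq> {}" using V(2) by blast
  ultimately have "D \<subseteq> zariski closure_of (D \<inter> (X \<inter> \<phi> -` V))" by (rule irreducible_open(2)[OF DD(2)])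
  also have "\<dots> \<subseteq> X \<inter> \<phi> -` {t}"
    by (rule closure_of_minimal[OF _ cl]) (use van in auto)
  finally show "\<phi> Q = t" if "Q \<in> D" for Q using that by auto
qed

text \<open>Both equations generate the maximal ideal at \<open>t\<close>, so \<open>\<pi>'\<close>
  is a multiple of \<open>\<pi>\<close> near \<open>t\<close>. As \<open>D\<close> maps to
  \<open>t\<close>, the factor pulls back to a germ along \<open>D\<close>. The converse follows by
  exchanging the two equations.\<close>

lemma local_equations_equivalent:
  assumes D: "prime_divisor X D" "\<And>Q. Q \<in> D \<Longrightarrow> \<phi> Q = t"
    and V: "(V, \<pi>) \<in> point_divisor C t" "(X \<inter> \<phi> -` V) \<inter> D \<noteq> {}"
    and V': "(V', \<pi>') \<in> point_divisor C t" "(X \<inter> \<phi> -` V') \<inter> D \<noteq> {}"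
    and h: "\<pi> \<circ> \<phi> \<in> max_ideal_pow X D N"
  shows "\<pi>' \<circ> \<phi> \<in> max_ideal_pow X D N"
proof -
  note XD = projective_surfaceD[OF X] and DD = prime_divisorD[OF X D(1)]
  have DX: "D \<subseteq> X" using DD by blast
  have tV: "t \<in> V" "t \<in> V'" using V(2) V'(2) D(2) by auto
  have \<pi>: "generates_ideal C {t} 1 (\<lambda>_. \<pi>) (max_ideal C {t})"
    "generates_ideal C {t} 1 (\<lambda>_. \<pi>') (max_ideal C {t})" "\<pi>' \<in> regular_fns C V'"
    using V(1) V'(1) tV by (auto simp: point_divisor_def)
  have "\<pi>' \<in> max_ideal C {t}" using \<pi>(2) by (simp add: generates_ideal_def)
  then obtain c where c: "\<forall>i<(1::nat). c i \<in> germ_fns C {t}"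
    "germ_eq C {t} \<pi>' (\<lambda>Q. \<Sum>i<(1::nat). c i Q * \<pi> Q)"
    using \<pi>(1) unfolding generates_ideal_def by blast
  have oX: "open_in X X" using XD(4) nbhd_whole[OF DD(2) DX] by (simp add: nbhd_def)
  have Dt: "\<And>P. P \<in> X \<Longrightarrow> P \<in> D \<Longrightarrow> \<phi> P \<in> {t}" using D(2) by blast
  have "D \<noteq> {}" using DD(4) by auto
  then obtain Q where Q: "Q \<in> D" by blast
  have dom: "\<exists>P\<in>X. P \<in> D \<and> \<phi> P \<in> U" if U: "nbhd C {t} U" for U
    using U Q D(2)[OF Q] subsetD[OF DX Q] by (intro bexI[of _ Q]) (auto simp: nbhd_def)
  have "c 0 \<circ> \<phi> \<in> germ_fns X D" using germ_fns_pullback[OF oX \<phi> Dt dom] c(1) by blast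
  moreover have "\<pi>' \<circ> \<phi> \<in> germ_fns X D"
    unfolding germ_fns_def nbhd_def
    using morphism_regular[OF \<phi> \<pi>(3)] regular_fns_open[OF morphism_regular[OF \<phi> \<pi>(3)]] V'(2) by blast
  moreover have "germ_eq X D (\<pi>' \<circ> \<phi>) (\<lambda>Q. (c 0 \<circ> \<phi>) Q * (\<pi> \<circ> \<phi>) Q)"
    using germ_eq_pullback[OF oX \<phi> Dt dom c(2)] by (simp add: comp_def)
  ultimately show ?thesis using max_ideal_pow_multiple[OF DD(2) DX XD(4)] h by blast
qed

end

section \<open>Strict transforms\<close>

text \<open>\<open>\<nu>\<close> is invertible over \<open>W\<close>, so a curve in the preimage of
  \<open>D\<close> with a point over \<open>W\<close> is the closure of its part over
  \<open>W\<close> and lies in \<open>G\<close>. This uniqueness clause is what later matches curves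
  on \<open>Y\<close> with non-contracted components.\<close>

lemma strict_transform:
  fixes X Y :: "'k::{alg_closed_field, field_char_0} ppoint set"
  assumes X: "projective_surface X" and Y: "projective_surface Y" "normal_variety Y"
    and \<nu>: "birational_morphism \<nu> X Y" and D: "prime_divisor Y D"
  obtains G W \<psi> where "prime_divisor X G" "\<nu> ` G = D" "open_in Y W" "W \<inter> D \<noteq> {}"
    "morphism \<psi> W X" "\<And>S. S \<in> W \<Longrightarrow> \<nu> (\<psi> S) = S" "\<And>S. S \<in> W \<Longrightarrow> S \<in> D \<Longrightarrow> \<psi> S \<in> G"
    "\<And>R. R \<in> X \<Longrightarrow> \<nu> R \<in> W \<Longrightarrow> \<psi> (\<nu> R) = R"
    "\<And>G'. prime_divisor X G' \<Longrightarrow> \<nu> ` G' \<subseteq> D \<Longrightarrow> \<nu> ` G' \<inter> W \<noteq> {} \<Longrightarrow> G' = G"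
proof -
  note XD = projective_surfaceD[OF X] and YD = projective_surfaceD[OF Y(1)] and DD = prime_divisorD[OF Y(1) D]
  obtain N where N: "X \<subseteq> pspace N" using XD(1) by blast
  have mor: "morphism \<nu> X Y" using \<nu> by (simp add: birational_morphism_def)
  obtain U0 V0 where UV: "open_in X U0" "U0 \<noteq> {}" "open_in Y V0" "V0 \<noteq> {}"
    and iso: "isomorphism \<nu> U0 V0" using \<nu> unfolding birational_morphism_def by blast
  obtain \<psi>0 where "morphism \<psi>0 V0 U0" "\<forall>R\<in>U0. \<psi>0 (\<nu> R) = R" "\<forall>S\<in>V0. \<nu> (\<psi>0 S) = S"
    using iso unfolding isomorphism_def by metis
  then have \<psi>0: "morphism \<psi>0 V0 U0" "\<And>R. R \<in> U0 \<Longrightarrow> \<psi>0 (\<nu> R) = R" "\<And>S. S \<in> V0 \<Longrightarrow> \<nu> (\<psi>0 S) = S"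
    by simp_all
  have V0p: "V0 \<subseteq> pspaces" using openin_sub_zariski_subset[OF UV(3)] by simp
  have U0X: "U0 \<subseteq> X" using openin_sub_zariski_subset[OF UV(1)] by simp
  have \<psi>0X: "morphism \<psi>0 V0 X" by (rule morphism_incl[OF U0X \<psi>0(1) V0p])
  have \<psi>0U: "\<psi>0 S \<in> U0" if "S \<in> V0" for S by (rule morphism_in[OF \<psi>0(1) V0p that])
  have closed_pre: "closedin zariski (X \<inter> \<nu> -` C)" if "closedin zariski C" for C
    using morphism_preimage_closed[OF mor XD(4) that] unfolding closedin_closed_subtopology[OF XD(2)] by simp
  define B where "B = X \<inter> \<nu> -` D"
  have clB: "closedin zariski B" unfolding B_def by (rule closed_pre[OF DD(1)])
  have BX: "B \<subset> X"
  proof -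
    have oD: "open_in Y (Y - D)"
      unfolding openin_subtopology using DD(1) YD(4)
      by (intro exI[of _ "pspaces - D"]) (auto simp: closedin_def topspace_zariski)
    have "Y - D \<noteq> {}" using DD(3) by blast
    from irreducible_open_inter[OF YD(3) UV(3) oD UV(4) this]
    obtain S where S: "S \<in> V0" "S \<notin> D" by blast
    have "\<psi>0 S \<in> X - B" using \<psi>0U[OF S(1)] U0X \<psi>0(3)[OF S(1)] S(2) by (auto simp: B_def)
    then show ?thesis unfolding B_def by blast
  qed
  have DY: "D \<subseteq> Y" using DD(3) by blast
  have Dp: "D \<subseteq> pspaces" using DY YD(4) by blast
  have "\<exists>P\<in>D. finite (B \<inter> \<nu> -` {P})"
    by (rule finite_fibre[OF X clB BX _ DD(4)]) (use closed_pre closedin_point Dp in blast)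
  then obtain P where P: "P \<in> D" "finite (B \<inter> \<nu> -` {P})" by blast
  have "X \<inter> \<nu> -` {P} = B \<inter> \<nu> -` {P}" using P(1) by (auto simp: B_def)
  then have fin: "finite (X \<inter> \<nu> -` {P})" using P(2) by simp
  have PY: "P \<in> Y" using P(1) DY by blast
  obtain W \<psi> where W: "open_in Y W" "P \<in> W" and \<psi>: "morphism \<psi> W X"
    and inv: "\<And>S. S \<in> W \<Longrightarrow> \<nu> (\<psi> S) = S" "\<And>R. R \<in> X \<Longrightarrow> \<nu> R \<in> W \<Longrightarrow> \<psi> (\<nu> R) = R"
    using extend_inverse[OF XD(3,2) N YD(3,4) Y(2) mor UV(3,4,1) \<psi>0X \<psi>0U \<psi>0(3) \<psi>0(2) PY fin] by metis
  have Wp: "W \<subseteq> pspaces" using openin_sub_zariski_subset[OF W(1)] by simp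
  have \<psi>X: "\<psi> S \<in> X" if "S \<in> W" for S by (rule morphism_in[OF \<psi> Wp that])
  have oWD: "open_in D (D \<inter> W)" by (rule openin_sub_subset[OF W(1) DY])
  have WDne: "D \<inter> W \<noteq> {}" using P(1) W(2) by blast
  note WDirr = irreducible_open[OF DD(2) oWD WDne]
  define G0 where "G0 = \<psi> ` (D \<inter> W)"
  define G where "G = zariski closure_of G0"
  have G0X: "G0 \<subseteq> X" using \<psi>X by (auto simp: G0_def)
  have "continuous_map (subtopology zariski W) zariski \<psi>"
    using morphism_cont[OF \<psi>] by (simp add: continuous_map_in_subtopology)
  then have "continuous_map (subtopology (subtopology zariski W) (D \<inter> W)) zariski \<psi>"
    by (rule continuous_map_from_subtopology)
  then have cont: "continuous_map (subtopology zariski (D \<inter> W)) zariski \<psi>"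
    by (simp add: subtopology_subtopology Int_absorb1)
  have irrG: "irreducible_set zariski G"
    unfolding G_def G0_def by (rule irreducible_closure[OF irreducible_image[OF WDirr(1) cont]])
  have clG: "closedin zariski G" unfolding G_def by simp
  have GB: "G \<subseteq> B" unfolding G_def
    by (rule closure_of_minimal[OF _ clB]) (auto simp: G0_def B_def \<psi>X inv)
  have GX: "G \<subset> X" using GB BX by blast
  have G0G: "G0 \<subseteq> G" unfolding G_def
    by (rule closure_of_subset) (use G0X XD(4) in \<open>simp add: topspace_zariski\<close>)
  \<comment> \<open>A single point is closed, while \<open>D \<inter> W\<close> is dense in the
    infinite set \<open>D\<close>. Two of its points lift to two points of \<open>G\<close>.\<close>
  have "infinite (D \<inter> W)"
  proof
    assume "finite (D \<inter> W)"
    then obtain Q where Q: "D \<inter> W = {Q}" using finite_irreducible_point[OF WDirr(1)] by blast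
    then have "Q \<in> pspaces" using Dp by blast
    then have "zariski closure_of {Q} = {Q}" by (simp add: closure_of_eq closedin_point)
    then have "D \<subseteq> {Q}" using WDirr(2) Q by simp
    then show False using DD(4) finite_subset by blast
  qed
  then obtain S1 S2 where S: "S1 \<in> D \<inter> W" "S2 \<in> D \<inter> W" "S1 \<noteq> S2"
    using infinite_two_points[of "D \<inter> W"] by meson
  have "\<psi> S1 \<noteq> \<psi> S2" using S inv(1) by (metis IntD2)
  moreover have "\<psi> S1 \<in> G" "\<psi> S2 \<in> G" using S G0G by (auto simp: G0_def)
  ultimately have G: "prime_divisor X G" by (intro prime_divisorI[OF X clG irrG GX])
  \<comment> \<open>The inverse over \<open>W\<close> only shows that the image of \<open>G\<close>
    contains a dense part of \<open>D\<close>. For arbitrary \<open>Q\<close>, a place of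
    \<open>D\<close> over \<open>Q\<close> has its centre on the closed set \<open>G\<close>, and
    this centre maps to \<open>Q\<close>.\<close>
  have "Q \<in> \<nu> ` G" if Q: "Q \<in> D" for Q
  proof -
    have pre: "open_in D {S \<in> D \<inter> W. F (coords (\<psi> S)) \<noteq> 0}" if F: "hom_poly n d F" for n d F
    proof -
      have "open_in Y (W \<inter> \<psi> -` (X \<inter> basic_open F))"
        using morphism_preimage[OF \<psi> Wp openin_sub_basic[OF F]] openin_open_sub[OF W(1)] by blast
      from openin_sub_subset[OF this DY]
      have "open_in D (D \<inter> (W \<inter> \<psi> -` (X \<inter> basic_open F)))" .
      moreover have "\<psi> S \<in> pspaces" if "S \<in> W" for S using \<psi>X[OF that] XD(4) by blast
      then have "D \<inter> (W \<inter> \<psi> -` (X \<inter> basic_open F)) = {S \<in> D \<inter> W. F (coords (\<psi> S)) \<noteq> 0}"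
        using \<psi>X by (auto simp: basic_open_def)
      ultimately show ?thesis by simp
    qed
    have GX': "G \<subseteq> X" using GX by blast
    have \<psi>G: "\<psi> S \<in> G" if "S \<in> D \<inter> W" for S using that G0G by (auto simp: G0_def)
    have \<nu>\<psi>: "\<nu> (\<psi> S) = S" if "S \<in> D \<inter> W" for S using that inv(1) by auto
    have "\<exists>q. ppoint_of q \<in> G \<and> \<nu> (ppoint_of q) = Q"
    proof (rule lift_centre[OF DD(2) YD(4) DY Q N clG GX' mor oWD WDne pre \<psi>G \<nu>\<psi>
          partial_hom_germs[OF DD(2) Dp Q] subset_refl refl])
      fix q assume "ppoint_of q \<in> G" "\<nu> (ppoint_of q) = Q"
      then show "\<exists>q. ppoint_of q \<in> G \<and> \<nu> (ppoint_of q) = Q" by blast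
    qed
    then show ?thesis by blast
  qed
  moreover have "\<nu> ` G \<subseteq> D" using GB by (auto simp: B_def)
  ultimately have GD: "\<nu> ` G = D" by blast
  have "G' = G" if G': "prime_divisor X G'" "\<nu> ` G' \<subseteq> D" "\<nu> ` G' \<inter> W \<noteq> {}" for G'
  proof (rule ccontr)
    assume ne: "G' \<noteq> G"
    note GD' = prime_divisorD[OF X G'(1)]
    have G'X: "G' \<subseteq> X" using GD'(3) by blast
    have o: "open_in G' (G' \<inter> (X \<inter> \<nu> -` W))"
      by (rule openin_sub_subset[OF morphism_preimage[OF mor XD(4) W(1)] G'X])
    have "G' \<inter> (X \<inter> \<nu> -` W) \<noteq> {}" using G'(3) G'X by blast
    from irreducible_open(2)[OF GD'(2) o this]
    have "G' \<subseteq> zariski closure_of (G' \<inter> (X \<inter> \<nu> -` W))" .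
    also have "\<dots> \<subseteq> G"
    proof (rule closure_of_minimal[OF _ clG], rule subsetI)
      fix R assume R: "R \<in> G' \<inter> (X \<inter> \<nu> -` W)"
      then have "R = \<psi> (\<nu> R)" "\<nu> R \<in> D \<inter> W" using inv(2)[of R] G'(2) by auto
      then have "R \<in> G0" unfolding G0_def by blast
      then show "R \<in> G" using G0G by blast
    qed
    finally have "G' \<subset> G" using ne by blast
    obtain R1 R2 where R: "R1 \<in> G'" "R2 \<in> G'" "R1 \<noteq> R2" using infinite_two_points[OF GD'(4)] by blast
    have Rp: "R1 \<in> pspaces" using R(1) G'X XD(4) by blast
    have "{R1} \<subset> G'" using R by blast
    then show False
      using surface_no_chain[OF X irreducible_point[OF Rp] GD'(2) irrG closedin_point[OF Rp] GD'(1) clG _ \<open>G' \<subset> G\<close> GX]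
      by blast
  qed
  moreover have "W \<inter> D \<noteq> {}" using WDne by blast
  moreover have "\<psi> S \<in> G" if "S \<in> W" "S \<in> D" for S using that G0G by (auto simp: G0_def)
  ultimately show ?thesis using that[OF G GD W(1) _ \<psi> inv(1) _ inv(2)] by blast
qed

text \<open>One direction is pullback along \<open>\<nu>\<close>, the other along
  \<open>\<psi>\<close>. The function \<open>h \<circ> \<nu> \<circ> \<psi>\<close> equals
  \<open>h\<close> only on \<open>W\<close>, which is enough for the germ along
  \<open>D\<close>.\<close>

lemma strict_transform_order:
  fixes X Y :: "'k::{alg_closed_field, field_char_0} ppoint set"
  assumes X: "projective_surface X" and Y: "projective_surface Y"
    and \<nu>: "morphism \<nu> X Y" and D: "prime_divisor Y D" and G: "prime_divisor X G" "\<nu> ` G = D"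
    and W: "open_in Y W" "W \<inter> D \<noteq> {}" "morphism \<psi> W X"
    and \<psi>: "\<And>S. S \<in> W \<Longrightarrow> \<nu> (\<psi> S) = S" "\<And>S. S \<in> W \<Longrightarrow> S \<in> D \<Longrightarrow> \<psi> S \<in> G"
      "\<And>R. R \<in> X \<Longrightarrow> \<nu> R \<in> W \<Longrightarrow> \<psi> (\<nu> R) = R"
    and h: "h \<in> germ_fns Y D"
  shows "h \<circ> \<nu> \<in> max_ideal_pow X G N \<longleftrightarrow> h \<in> max_ideal_pow Y D N"
proof
  note XD = projective_surfaceD[OF X] and YD = projective_surfaceD[OF Y]
  note GD = prime_divisorD[OF X G(1)] and DD = prime_divisorD[OF Y D]
  have GX: "G \<subseteq> X" and DY: "D \<subseteq> Y" using GD(3) DD(3) by auto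
  have oX: "open_in X X" using nbhd_whole[OF GD(2) GX XD(4)] by (simp add: nbhd_def)
  have GtoD: "\<And>P. P \<in> X \<Longrightarrow> P \<in> G \<Longrightarrow> \<nu> P \<in> D" using G(2) by blast
  have dom: "\<exists>P\<in>X. P \<in> G \<and> \<nu> P \<in> U" if "nbhd Y D U" for U
  proof -
    obtain Q where "Q \<in> U" "Q \<in> D" using \<open>nbhd Y D U\<close> unfolding nbhd_def by blast
    then show ?thesis using G(2) GX by blast
  qed
  show "h \<circ> \<nu> \<in> max_ideal_pow X G N" if "h \<in> max_ideal_pow Y D N"
    by (rule max_ideal_pow_pullback[OF oX \<nu> GtoD dom that])
  have nW: "nbhd Y D W" using W(1,2) by (simp add: nbhd_def)
  have "open_in X (X \<inter> \<nu> -` W)" by (rule morphism_preimage[OF \<nu> XD(4) W(1)])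
  then have nW': "nbhd X G (X \<inter> \<nu> -` W)" using dom[OF nW] unfolding nbhd_def by blast
  have dom': "\<exists>P\<in>W. P \<in> D \<and> \<psi> P \<in> U" if U: "nbhd X G U" for U
  proof -
    obtain R where R: "R \<in> U" "R \<in> X" "\<nu> R \<in> W" "R \<in> G"
      using nbhd_inter[OF GD(2) GX U nW'] unfolding nbhd_def by blast
    then have "\<psi> (\<nu> R) \<in> U" using \<psi>(3) by simp
    then show ?thesis using R GtoD by blast
  qed
  assume hp: "h \<circ> \<nu> \<in> max_ideal_pow X G N"
  have "h \<circ> \<nu> \<circ> \<psi> \<in> max_ideal_pow Y D N"
    by (rule max_ideal_pow_pullback[OF W(1,3) \<psi>(2) dom' hp])
  moreover have "germ_eq Y D h (\<lambda>Q. (\<lambda>_. 1) Q * (h \<circ> \<nu> \<circ> \<psi>) Q)"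
    unfolding germ_eq_def by (intro exI[of _ W] conjI nW) (simp add: \<psi>(1))
  moreover have "(\<lambda>_. 1) \<in> germ_fns Y D" using germ_fns_const nW by blast
  ultimately show "h \<in> max_ideal_pow Y D N"
    using max_ideal_pow_multiple[OF DD(2) DY YD(4)] h by blast
qed

lemma fiber_multiplicity_strict_transform:
  fixes X Y C :: "'k::{alg_closed_field, field_char_0} ppoint set"
  assumes X: "projective_surface X" and Y: "projective_surface Y"
    and C: "projective_curve C" "\<And>t. t \<in> C \<Longrightarrow> smooth_at C t" and f: "morphism f Y C" and t: "t \<in> C"
    and \<nu>: "morphism \<nu> X Y" and D: "prime_divisor Y D" and G: "prime_divisor X G" "\<nu> ` G = D"
    and W: "open_in Y W" "W \<inter> D \<noteq> {}" "morphism \<psi> W X"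
    and \<psi>: "\<And>S. S \<in> W \<Longrightarrow> \<nu> (\<psi> S) = S" "\<And>S. S \<in> W \<Longrightarrow> S \<in> D \<Longrightarrow> \<psi> S \<in> G"
      "\<And>R. R \<in> X \<Longrightarrow> \<nu> R \<in> W \<Longrightarrow> \<psi> (\<nu> R) = R"
  shows "fiber_divisor (f \<circ> \<nu>) X C t G = fiber_divisor f Y C t D"
proof (cases "\<forall>Q\<in>D. f Q = t")
  case False
  have g: "morphism (f \<circ> \<nu>) X C" by (rule morphism_compose[OF \<nu> f projective_surfaceD(4)[OF X]])
  have "fiber_divisor f Y C t D = 0" using fiber_divisor_nonzero(2)[OF Y C f t] False by blast
  moreover have "fiber_divisor (f \<circ> \<nu>) X C t G = 0"
  proof (rule ccontr)
    assume "fiber_divisor (f \<circ> \<nu>) X C t G \<noteq> 0"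
    then have "\<forall>R\<in>G. (f \<circ> \<nu>) R = t" using fiber_divisor_nonzero(2)[OF X C g t] by blast
    then show False using False G(2) by auto
  qed
  ultimately show ?thesis by simp
next
  case True
  note XD = projective_surfaceD[OF X]
  have g: "morphism (f \<circ> \<nu>) X C" by (rule morphism_compose[OF \<nu> f XD(4)])
  obtain V \<pi> where V: "(V, \<pi>) \<in> point_divisor C t" "(Y \<inter> f -` V) \<inter> D \<noteq> {}"
    "fiber_divisor f Y C t D = int (ord_along Y D (\<pi> \<circ> f))" by (rule fiber_divisor_local[OF Y C f t D])
  obtain V' \<pi>' where V': "(V', \<pi>') \<in> point_divisor C t" "(X \<inter> (f \<circ> \<nu>) -` V') \<inter> G \<noteq> {}"
    "fiber_divisor (f \<circ> \<nu>) X C t G = int (ord_along X G (\<pi>' \<circ> (f \<circ> \<nu>)))"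
    by (rule fiber_divisor_local[OF X C g t G(1)])
  have gG: "(f \<circ> \<nu>) R = t" if "R \<in> G" for R using True G(2) that by auto
  have tV: "t \<in> V" using V(2) True by auto
  have V2: "(X \<inter> (f \<circ> \<nu>) -` V) \<inter> G \<noteq> {}" using V'(2) gG tV by auto
  have "\<pi> \<in> regular_fns C V" using V(1) by (simp add: point_divisor_def)
  from morphism_regular[OF f this] have reg: "\<pi> \<circ> f \<in> regular_fns Y (Y \<inter> f -` V)" .
  then have germ: "\<pi> \<circ> f \<in> germ_fns Y D"
    unfolding germ_fns_def nbhd_def using regular_fns_open[OF reg] V(2) by blast
  \<comment> \<open>The two multiplicities come from independent choices \<open>\<pi>\<close> and
    \<open>\<pi>'\<close>: the choice is first changed on \<open>X\<close>, then the order is moved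
    to \<open>Y\<close>. Membership agrees for every exponent, so the two \<open>GREATEST\<close>
    values coincide without an argument that they are attained.\<close>
  have "\<pi>' \<circ> (f \<circ> \<nu>) \<in> max_ideal_pow X G n \<longleftrightarrow> \<pi> \<circ> f \<in> max_ideal_pow Y D n" for n
  proof -
    have "\<pi>' \<circ> (f \<circ> \<nu>) \<in> max_ideal_pow X G n \<longleftrightarrow> \<pi> \<circ> (f \<circ> \<nu>) \<in> max_ideal_pow X G n"
      using local_equations_equivalent[OF X C g t G(1) gG V'(1,2) V(1) V2]
        local_equations_equivalent[OF X C g t G(1) gG V(1) V2 V'(1,2)] by blast
    also have "\<dots> \<longleftrightarrow> \<pi> \<circ> f \<in> max_ideal_pow Y D n"
      using strict_transform_order[OF X Y \<nu> D G W \<psi> germ] by (simp add: comp_assoc)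
    finally show ?thesis .
  qed
  then show ?thesis unfolding V(3) V'(3) ord_along_def by simp
qed

lemma sum_wdiv_apply: "(\<Sum>i\<in>I. wdiv (a i) (H i)) D = (\<Sum>i\<in>I. if D = H i then a i else 0)"
  by (simp add: fun_sum_apply wdiv_def)

theorem theorem2p4:
  fixes X Y :: "'k::{alg_closed_field, field_char_0} ppoint set"
    and f \<nu> :: "'k ppoint \<Rightarrow> 'k ppoint"
    and s :: "'k ppoint"
    and m n :: nat
    and a b :: "nat \<Rightarrow> int"
    and G E :: "nat \<Rightarrow> 'k ppoint set"
  assumes "normal_K3 Y"
    and "elliptic_fibration f Y (pspace 1)"
    and "minimal_resolution \<nu> X Y"
    and "s \<in> pspace 1"
    and "Supp (fiber_divisor f Y (pspace 1) s) \<inter> Sing Y \<noteq> {}"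
    and "inj_on G {1..m}"
    and "G ` {1..m} = {D \<in> components (fiber_divisor (f \<circ> \<nu>) X (pspace 1) s). \<not> contracted \<nu> D}"
    and "inj_on E {1..n}"
    and "E ` {1..n} = {D \<in> components (fiber_divisor (f \<circ> \<nu>) X (pspace 1) s). contracted \<nu> D}"
    and "fiber_divisor (f \<circ> \<nu>) X (pspace 1) s =
           (\<Sum>i=1..m. wdiv (a i) (G i)) + (\<Sum>j=1..n. wdiv (b j) (E j))"
  shows "fiber_divisor f Y (pspace 1) s = (\<Sum>i=1..m. wdiv (a i) (\<nu> ` G i))"
proof -
  have Y: "projective_surface Y" "normal_variety Y" using assms(1) by (auto simp: normal_K3_def)
  have C: "projective_curve (pspace 1 :: 'k ppoint set)" "\<And>t. t \<in> (pspace 1 :: 'k ppoint set) \<Longrightarrow> smooth_at (pspace 1) t"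
    and f: "morphism f Y (pspace 1)" and surj: "f ` Y = pspace 1"
    using assms(2) by (auto simp: elliptic_fibration_def)
  have X: "projective_surface X" and bir: "birational_morphism \<nu> X Y"
    using assms(3) by (auto simp: minimal_resolution_def resolution_def)
  note XD = projective_surfaceD[OF X] and YD = projective_surfaceD[OF Y(1)]
  have \<nu>: "morphism \<nu> X Y" using bir by (simp add: birational_morphism_def)
  define g where "g = f \<circ> \<nu>"
  have g: "morphism g X (pspace 1)" unfolding g_def by (rule morphism_compose[OF \<nu> f XD(4)])
  define vX vY where "vX = fiber_divisor g X (pspace 1) s" and "vY = fiber_divisor f Y (pspace 1) s"
  have G_iff: "D \<in> G ` {1..m} \<longleftrightarrow> vX D \<noteq> 0 \<and> \<not> contracted \<nu> D" for D
    using assms(7) unfolding vX_def g_def components_def by blast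
  \<comment> \<open>A non-contracted curve is none of the \<open>E j\<close>, and injectivity of
    \<open>G\<close> leaves a single term in the other sum.\<close>
  have a: "vX (G i) = a i" if i: "i \<in> {1..m}" for i
  proof -
    have "\<not> contracted \<nu> (G i)" using G_iff i by blast
    then have "G i \<noteq> E j" if "j \<in> {1..n}" for j using assms(9) that by blast
    then have "(\<Sum>j=1..n. if G i = E j then b j else 0) = 0" by (intro sum.neutral) auto
    moreover have "(\<Sum>k=1..m. if G i = G k then a k else 0) = (\<Sum>k=1..m. if k = i then a k else 0)"
      using assms(6) i by (intro sum.cong) (auto dest: inj_onD)
    then have "(\<Sum>k=1..m. if G i = G k then a k else 0) = a i" using i by simp
    ultimately show ?thesis
      unfolding vX_def g_def assms(10) by (simp only: plus_fun_apply sum_wdiv_apply add_0_right)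
  qed
  have comp: "prime_divisor X (G i)" "\<And>R. R \<in> G i \<Longrightarrow> g R = s" "\<not> contracted \<nu> (G i)" if i: "i \<in> {1..m}" for i
  proof -
    have nz: "fiber_divisor g X (pspace 1) s (G i) \<noteq> 0" "\<not> contracted \<nu> (G i)"
      using G_iff i unfolding vX_def by blast+
    then show "\<not> contracted \<nu> (G i)" by simp
    from fiber_divisor_nonzero[OF X C g assms(4) nz(1)]
    show "prime_divisor X (G i)" "\<And>R. R \<in> G i \<Longrightarrow> g R = s" by blast+
  qed
  \<comment> \<open>The closure \<open>D\<close> of the image is a curve: it stays in one fibre,
    hence is not \<open>Y\<close>, and it has two points because \<open>G i\<close> is not
    contracted. By uniqueness \<open>G i\<close> is the strict transform of \<open>D\<close>, whose
    image is all of \<open>D\<close>; so the image was already closed.\<close>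
  have image_prime: "prime_divisor Y (\<nu> ` G i)" if i: "i \<in> {1..m}" for i
  proof -
    note GD = prime_divisorD[OF X comp(1)[OF i]]
    have GX: "G i \<subseteq> X" using GD(3) by blast
    have \<nu>G: "\<nu> ` G i \<subseteq> Y" using GX morphism_in[OF \<nu> XD(4)] by blast
    define D where "D = zariski closure_of (\<nu> ` G i)"
    have "continuous_map (subtopology zariski X) zariski \<nu>"
      using morphism_cont[OF \<nu>] by (simp add: continuous_map_in_subtopology)
    then have "continuous_map (subtopology (subtopology zariski X) (G i)) zariski \<nu>"
      by (rule continuous_map_from_subtopology)
    then have cont: "continuous_map (subtopology zariski (G i)) zariski \<nu>"
      using GX by (simp add: subtopology_subtopology Int_absorb1)
    have irrD: "irreducible_set zariski D" and clD: "closedin zariski D"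
      unfolding D_def by (simp_all add: irreducible_closure[OF irreducible_image[OF GD(2) cont]])
    have subD: "\<nu> ` G i \<subseteq> D" unfolding D_def
      by (rule closure_of_subset) (use \<nu>G YD(4) in \<open>auto simp: topspace_zariski\<close>)
    have sp: "s \<in> pspaces" using assms(4) by blast
    have "closedin zariski (Y \<inter> f -` {s})"
      using morphism_preimage_closed[OF f YD(4) closedin_point[OF sp]]
      unfolding closedin_closed_subtopology[OF YD(2)] by simp
    then have Df: "D \<subseteq> Y \<inter> f -` {s}" unfolding D_def
      by (rule closure_of_minimal[rotated]) (use \<nu>G comp(2)[OF i] in \<open>auto simp: g_def\<close>)
    obtain s' where "s' \<in> pspace 1" "s' \<noteq> s" using curve_two_points[OF C(1) assms(4)] by blast
    then obtain Q where "Q \<in> Y" "f Q \<noteq> s" using surj by (metis imageE)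
    then have DY: "D \<subset> Y" using Df by blast
    obtain R where R: "R \<in> G i" using GD(2) by (auto simp: irreducible_set_def)
    have "\<nu> ` G i \<noteq> {\<nu> R}" using comp(3)[OF i] unfolding contracted_def by blast
    then obtain R' where R': "R' \<in> G i" "\<nu> R' \<noteq> \<nu> R" using R by blast
    have D: "prime_divisor Y D"
      by (rule prime_divisorI[OF Y(1) clD irrD DY, of "\<nu> R'" "\<nu> R"]) (use R R' subD in auto)
    obtain G' W \<psi> where G': "\<nu> ` G' = D" "open_in Y W" "W \<inter> D \<noteq> {}"
      and uniq: "\<And>G''. prime_divisor X G'' \<Longrightarrow> \<nu> ` G'' \<subseteq> D \<Longrightarrow> \<nu> ` G'' \<inter> W \<noteq> {} \<Longrightarrow> G'' = G'"
      by (rule strict_transform[OF X Y bir D]) blast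
    \<comment> \<open>The image is dense in \<open>D\<close>, so it cannot avoid an open set that
      meets \<open>D\<close>.\<close>
    have "\<nu> ` G i \<inter> W \<noteq> {}"
    proof
      assume e: "\<nu> ` G i \<inter> W = {}"
      obtain T where T: "openin zariski T" "W = T \<inter> Y" using G'(2) by (auto simp: openin_subtopology)
      have "closedin zariski (pspaces - T)"
        using T(1) topspace_zariski[where 'a='k] by (metis closedin_diff closedin_topspace)
      moreover have "\<nu> ` G i \<subseteq> pspaces - T" using e T(2) \<nu>G YD(4) by blast
      ultimately have "D \<subseteq> pspaces - T" unfolding D_def by (intro closure_of_minimal)
      then show False using G'(3) T(2) by blast
    qed
    then have "G i = G'" by (rule uniq[OF comp(1)[OF i] subD])
    then show ?thesis using G'(1) D by simp
  qed
  \<comment> \<open>If \<open>D\<close> is not a prime divisor, both sides are 0. Otherwise its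
    strict transform \<open>G'\<close> has the same multiplicity as \<open>D\<close>, and it decides
    whether and where \<open>D\<close> occurs in the sum.\<close>
  have "vY D = (\<Sum>i=1..m. if D = \<nu> ` G i then a i else 0)" for D
  proof (cases "prime_divisor Y D")
    case False
    then have "vY D = 0" unfolding vY_def fiber_divisor_def weil_divisor_def by simp
    moreover have "(\<Sum>i=1..m. if D = \<nu> ` G i then a i else 0) = 0"
      using False image_prime by (intro sum.neutral) auto
    ultimately show ?thesis by simp
  next
    case True
    obtain G' W \<psi> where G': "prime_divisor X G'" "\<nu> ` G' = D" and W: "open_in Y W" "W \<inter> D \<noteq> {}"
      "morphism \<psi> W X" and \<psi>: "\<And>S. S \<in> W \<Longrightarrow> \<nu> (\<psi> S) = S" "\<And>S. S \<in> W \<Longrightarrow> S \<in> D \<Longrightarrow> \<psi> S \<in> G'"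
      "\<And>R. R \<in> X \<Longrightarrow> \<nu> R \<in> W \<Longrightarrow> \<psi> (\<nu> R) = R"
      and uniq: "\<And>G''. prime_divisor X G'' \<Longrightarrow> \<nu> ` G'' \<subseteq> D \<Longrightarrow> \<nu> ` G'' \<inter> W \<noteq> {} \<Longrightarrow> G'' = G'"
      by (rule strict_transform[OF X Y bir True]) blast
    have v: "vX G' = vY D" unfolding vX_def vY_def g_def
      by (rule fiber_multiplicity_strict_transform[OF X Y(1) C f assms(4) \<nu> True G' W \<psi>])
    \<comment> \<open>At most one index contributes at \<open>D\<close>: a component with image
      \<open>D\<close> has points over \<open>W\<close> and is therefore the strict
      transform.\<close>
    have only: "G i = G'" if "i \<in> {1..m}" "D = \<nu> ` G i" for i
      by (rule uniq[OF comp(1)[OF that(1)]]) (use that(2) W(2) in blast)+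
    have "infinite D" using prime_divisorD(4)[OF Y(1) True] .
    then have nc: "\<not> contracted \<nu> G'" using G'(2) unfolding contracted_def by auto
    show ?thesis
    proof (cases "vX G' = 0")
      case True
      then have "D \<noteq> \<nu> ` G i" if "i \<in> {1..m}" for i using only[OF that] G_iff that by blast
      then have "(\<Sum>i=1..m. if D = \<nu> ` G i then a i else 0) = 0" by (intro sum.neutral) auto
      then show ?thesis using True v by simp
    next
      case False
      then have "G' \<in> G ` {1..m}" using nc G_iff by simp
      then obtain k where k: "k \<in> {1..m}" "G k = G'" by (metis imageE)
      have "(D = \<nu> ` G i) = (i = k)" if "i \<in> {1..m}" for i
        using only[OF that] k G'(2) inj_onD[OF assms(6), of i k] that by auto
      then have "(\<Sum>i=1..m. if D = \<nu> ` G i then a i else 0) = (\<Sum>i=1..m. if i = k then a i else 0)"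
        by (intro sum.cong) auto
      also have "\<dots> = a k" using k(1) by simp
      also have "\<dots> = vY D" using a[OF k(1)] k(2) v by simp
      finally show ?thesis by simp
    qed
  qed
  then show ?thesis unfolding vY_def by (intro ext) (simp only: sum_wdiv_apply)
qed

end
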